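(* Let $\Bbbk$ be a field and let $M\subset R=\Bbbk[x_1,\ldots,x_d]$ be a rigid monomial ideal. Then the Betti poset $B_M$ supports the minimal free resolution of $M$; that is, the sequence $\mathcal F(B_M)$ of $\mathbb Z^d$-graded free $R$-modules obtained by homogenizing $\mathcal D(B_M)$ is a minimal free resolution of $R/M$.
   Context: Lcm-lattice and Betti poset. The lcm-lattice $L_M$ of $M$ is the set of all least common multiples of subsets of the minimal monomial generators of $M$, ordered by divisibility, with minimal element $\hat 0=1$. For a finite poset $P$ with minimum $\hat 0$ and $p\in P$, $\Delta_p=\Delta_p^P$ is the order complex of the open interval $(\hat 0,p)\subset P$, and $h_i(\Delta_p)=\dim_\Bbbk\widetilde H_i(\Delta_p,\Bbbk)$; the order complex of an empty poset is $\{\varnothing\}$, with $\widetilde H_{-1}=\Bbbk$. The Betti poset is $B_M=\{p\in L_M: h_i(\Delta_p^{L_M})\neq0\text{ for some }i\}$ with the induced order. Rigidity. $M$ is rigid if: (R1) for every $p\in L_M$, $h_i(\Delta_p)$ is nonzero for at most one $i$, and for that $i$ it equals $1$; (R2) if $p\ne q\in L_M$ satisfy $h_i(\Delta_p)=h_i(\Delta_q)=1$ for some common $i$, then $p$ and $q$ are incomparable in $L_M$. The sequence $\mathcal D(P)$. For a finite poset $P$ with minimum $\hat 0$ put $\mathcal D_0=\widetilde H_{-1}(\{\varnothing\},\Bbbk)\cong\Bbbk$ and, for $\ell\ge1$, $\mathcal D_\ell=\bigoplus_{p\in P\setminus\{\hat0\}}\mathcal D_{\ell,p}$ with $\mathcal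 D_{\ell,p}=\widetilde H_{\ell-2}(\Delta_p,\Bbbk)$. Write $p\lessdot q$ if $q$ covers $p$, let $\Delta_{\lceil p\rceil}$ be the order complex of $(\hat0,p]$, so $\Delta_q=\bigcup_{p\lessdot q}\Delta_{\lceil p\rceil}$, and set $\Delta_{q,p}=\Delta_{\lceil p\rceil}\cap\bigcup_{b\lessdot q,\,b\ne p}\Delta_{\lceil b\rceil}\subset\Delta_p$. For $i\ge2$ the map $\varphi_i:\mathcal D_i\to\mathcal D_{i-1}$ is given on $\mathcal D_{i,q}$ by $\sum_{p\lessdot q}\varphi_i^{q,p}$, where $\varphi_i^{q,p}:\mathcal D_{i,q}\to\mathcal D_{i-1,p}$ is the composition of the Mayer–Vietoris connecting map $\delta_{i-2}^{q,p}:\widetilde H_{i-2}(\Delta_q,\Bbbk)\to\widetilde H_{i-3}(\Delta_{q,p},\Bbbk)$ for $\Delta_q=\Delta_{\lceil p\rceil}\cup\bigcup_{b\lessdot q,\,b\neq p}\Delta_{\lceil b\rceil}$ (a cycle $z=z'+z''$ with $z'$ supported on $\Delta_{\lceil p\rceil}$ and $z''$ on the other subcomplex is sent to the class of the boundary of $z'$) with the map $\iota:\widetilde H_{i-3}(\Delta_{q,p},\Bbbk)\to\widetilde H_{i-3}(\Delta_p,\Bbbk)$ induced by inclusion. The map $\varphi_1:\mathcal D_1\to\mathcal D_0$ is the identity of $\widetilde H_{-1}(\{\varnothing\},\Bbbk)$ on each summand $\mathcal D_{1,a}$, $a$ an atom (all other summands of $\mathcal D_1$ vanish). Homogenization and "supports".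 Each $q\in B_M$ is a monomial, with exponent vector $\deg q\in\mathbb Z^d$. $\mathcal F(B_M)$ has $F_0=R\otimes_\Bbbk\mathcal D_0\cong R$, $F_i=\bigoplus_{q\in B_M\setminus\{\hat 0\}}R(-\deg q)\otimes_\Bbbk\mathcal D_{i,q}$ for $i\ge1$, and differential whose component from the $q$-summand of $F_i$ to the $p$-summand of $F_{i-1}$, for $p\lessdot q$ in $B_M$, is $\frac{q}{p}\otimes\varphi_i^{q,p}$ (for $i=1$ and $q$ an atom, it is multiplication by $q$ into $R$). $B_M$ supports the minimal free resolution of $M$ if $\mathcal F(B_M)$ is a minimal free resolution of $R/M$.
   Formalization: M is taken to be a proper ideal (for M = R the sequence is R in position 0 and does not resolve R/M = 0), and (R2) is required only for p, q other than the minimum 0̂, since 0̂ and every atom have h_{-1} = 1 and are comparable, so literal (R2) fails for every nonzero proper M. *)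

theory Defs
  imports
    "HOL-Algebra.Ideal"
    "HOL-Library.Poly_Mapping"
    "HOL-Library.Function_Algebras"
    "Jordan_Normal_Form.VS_Connect"
begin

text \<open>
  The ring \<open>R\<close> is the type of finitely supported maps from exponent vectors to the field, with the
  convolution product; \<open>d\<close> is the cardinality of the finite index type \<open>'x\<close>. A monomial is
  identified with its exponent vector, so divisibility is the pointwise order, the product of
  monomials is \<open>+\<close>, the quotient \<open>q / p\<close> for \<open>p\<close> dividing \<open>q\<close> is \<open>q - p\<close>, and the monomial
  \<open>1\<close> is \<open>0\<close>. Both the field and \<open>R\<close> enter the module theory through \<open>class_ring\<close>, the
  ring record whose carrier is the whole type.
\<close>

type_synonym 'x mon = "'x \<Rightarrow> nat"
type_synonym ('x, 'k) mpoly = "'x mon \<Rightarrow>\<^sub>0 'k"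

definition monomial :: "'x::finite mon \<Rightarrow> ('x, 'k::field) mpoly" where
  "monomial m = Poly_Mapping.single m 1"

definition mdeg :: "'x mon \<Rightarrow> ('x \<Rightarrow> int)" where
  "mdeg m = (\<lambda>x. int (m x))"

definition monomial_ideal :: "('x::finite, 'k::field) mpoly set \<Rightarrow> bool" where
  "monomial_ideal M \<longleftrightarrow> (\<exists>S. M = Idl\<^bsub>class_ring\<^esub> (monomial ` S))"

definition irrelevant_ideal :: "('x::finite, 'k::field) mpoly set" where
  "irrelevant_ideal = Idl\<^bsub>class_ring\<^esub> (range (\<lambda>x. monomial (\<lambda>y. if y = x then 1 else 0)))"


definition order_complex :: "'a::order set \<Rightarrow> 'a set set" where
  "order_complex Q = {\<sigma>. finite \<sigma> \<and> \<sigma> \<subseteq> Q \<and> Complete_Partial_Order.chain (\<le>) \<sigma>}"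

text \<open>
  The empty face is a face of dimension \<open>-1\<close>, so the chain complex below is the augmented one. A
  face \<open>v\<^sub>0 < \<dots> < v\<^sub>n\<close> is oriented by the partial order, and the position of \<open>v\<close> in the face
  \<open>\<sigma>\<close> is the number of elements of \<open>\<sigma>\<close> below \<open>v\<close>.
\<close>

definition simpl_chains :: "'a set set \<Rightarrow> int \<Rightarrow> ('a set \<Rightarrow> 'k::field) set" where
  "simpl_chains \<Delta> i =
     {c. finite {\<sigma>. c \<sigma> \<noteq> 0} \<and> (\<forall>\<sigma>. c \<sigma> \<noteq> 0 \<longrightarrow> \<sigma> \<in> \<Delta> \<and> int (card \<sigma>) = i + 1)}"

definition simpl_boundary :: "('a::order set \<Rightarrow> 'k::field) \<Rightarrow> ('a set \<Rightarrow> 'k)" where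
  "simpl_boundary c =
     (\<lambda>\<tau>. \<Sum>\<sigma> | c \<sigma> \<noteq> 0. \<Sum>v\<in>\<sigma>. if \<sigma> - {v} = \<tau> then (- 1) ^ card {u \<in> \<sigma>. u < v} * c \<sigma> else 0)"

definition simpl_cycles :: "'a::order set set \<Rightarrow> int \<Rightarrow> ('a set \<Rightarrow> 'k::field) set" where
  "simpl_cycles \<Delta> i = {c \<in> simpl_chains \<Delta> i. simpl_boundary c = 0}"

definition simpl_boundaries :: "'a::order set set \<Rightarrow> int \<Rightarrow> ('a set \<Rightarrow> 'k::field) set" where
  "simpl_boundaries \<Delta> i = simpl_boundary ` simpl_chains \<Delta> (i + 1)"

definition cycle_space :: "'a::order set set \<Rightarrow> int \<Rightarrow> ('k::field, 'a set \<Rightarrow> 'k) module" where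
  "cycle_space \<Delta> i =
     \<lparr>carrier = simpl_cycles \<Delta> i, mult = undefined, one = undefined, zero = 0, add = (+),
      smult = (\<lambda>a c \<sigma>. a * c \<sigma>)\<rparr>"

definition quot_module :: "('r, 'b, 'm) module_scheme \<Rightarrow> 'b set \<Rightarrow> ('r, 'b set) module" where
  "quot_module N K =
     \<lparr>carrier = a_rcosets\<^bsub>N\<^esub> K, mult = undefined, one = undefined, zero = K, add = set_add N,
      smult = (\<lambda>r X. K <+>\<^bsub>N\<^esub> (\<lambda>x. r \<odot>\<^bsub>N\<^esub> x) ` X)\<rparr>"

definition reduced_homology ::
    "'a::order set set \<Rightarrow> int \<Rightarrow> ('k::field, ('a set \<Rightarrow> 'k) set) module" where
  "reduced_homology \<Delta> i = quot_module (cycle_space \<Delta> i) (simpl_boundaries \<Delta> i)"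

definition homology_class ::
    "'a::order set set \<Rightarrow> int \<Rightarrow> ('a set \<Rightarrow> 'k::field) \<Rightarrow> ('a set \<Rightarrow> 'k) set" where
  "homology_class \<Delta> i z = simpl_boundaries \<Delta> i +>\<^bsub>cycle_space \<Delta> i\<^esub> z"

definition hdim :: "'k::field itself \<Rightarrow> 'a::order set set \<Rightarrow> int \<Rightarrow> nat" where
  "hdim _ \<Delta> i =
     vectorspace.dim class_ring (reduced_homology \<Delta> i :: ('k, ('a set \<Rightarrow> 'k) set) module)"

text \<open>
  Homology classes are cosets of chains. The connecting map for \<open>A \<union> B\<close> goes from degree \<open>i\<close> to
  degree \<open>i - 1\<close>; its value does not depend on the choice of \<open>z'\<close> and \<open>z''\<close>. In
  \<open>incl_homology\<close> the argument \<open>\<xi>\<close> is a class of a subcomplex of \<open>Y\<close>.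
\<close>

definition mv_connecting ::
    "'a::order set set \<Rightarrow> 'a set set \<Rightarrow> int \<Rightarrow> ('a set \<Rightarrow> 'k::field) set \<Rightarrow> ('a set \<Rightarrow> 'k) set" where
  "mv_connecting A B i \<xi> =
     (THE \<eta>. \<exists>z'\<in>simpl_chains A i. \<exists>z''\<in>simpl_chains B i.
        z' + z'' \<in> \<xi> \<and> \<eta> = homology_class (A \<inter> B) (i - 1) (simpl_boundary z'))"

definition incl_homology ::
    "'a::order set set \<Rightarrow> int \<Rightarrow> ('a set \<Rightarrow> 'k::field) set \<Rightarrow> ('a set \<Rightarrow> 'k) set" where
  "incl_homology Y i \<xi> = (THE \<eta>. \<exists>z\<in>\<xi>. \<eta> = homology_class Y i z)"


definition zero_hat :: "'a::order set \<Rightarrow> 'a" where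
  "zero_hat P = (LEAST x. x \<in> P)"

definition open_complex :: "'a::order set \<Rightarrow> 'a \<Rightarrow> 'a set set" where
  "open_complex P p = order_complex {x \<in> P. zero_hat P < x \<and> x < p}"

definition half_closed_complex :: "'a::order set \<Rightarrow> 'a \<Rightarrow> 'a set set" where
  "half_closed_complex P p = order_complex {x \<in> P. zero_hat P < x \<and> x \<le> p}"

definition covered_by :: "'a::order set \<Rightarrow> 'a \<Rightarrow> 'a \<Rightarrow> bool" where
  "covered_by P p q \<longleftrightarrow> p \<in> P \<and> q \<in> P \<and> p < q \<and> \<not> (\<exists>r\<in>P. p < r \<and> r < q)"

text \<open>
  The space in position \<open>0\<close> is a single summand; it is indexed by the minimum of the poset so that
  all positions have the same shape.
\<close>

definition seq_index :: "'a::order set \<Rightarrow> nat \<Rightarrow> 'a set" where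
  "seq_index P l = (if l = 0 then {zero_hat P} else P - {zero_hat P})"

definition seq_summand ::
    "'a::order set \<Rightarrow> nat \<Rightarrow> 'a \<Rightarrow> ('k::field, ('a set \<Rightarrow> 'k) set) module" where
  "seq_summand P l p =
     (if l = 0 then reduced_homology {{}} (- 1) else reduced_homology (open_complex P p) (int l - 2))"

definition seq_map ::
    "'a::order set \<Rightarrow> nat \<Rightarrow> 'a \<Rightarrow> 'a \<Rightarrow> ('a set \<Rightarrow> 'k::field) set \<Rightarrow> ('a set \<Rightarrow> 'k) set" where
  "seq_map P i q p \<xi> =
     (if i = 1 then \<xi>
      else incl_homology (open_complex P p) (int i - 3)
             (mv_connecting (half_closed_complex P p)
                (\<Union>b \<in> {b. covered_by P b q \<and> b \<noteq> p}. half_closed_complex P b) (int i - 2) \<xi>))"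


record ('r, 'b, 'g) graded_module = "('r, 'b) module" +
  hcomp :: "'g \<Rightarrow> 'b set"

type_synonym ('x, 'k, 'b) multigraded = "(('x, 'k) mpoly, 'b, 'x \<Rightarrow> int) graded_module"

definition is_graded_module :: "('x::finite, 'k::field, 'b) multigraded \<Rightarrow> bool" where
  "is_graded_module N \<longleftrightarrow>
     module class_ring N \<and>
     (\<forall>u. additive_subgroup (hcomp N u) N) \<and>
     (\<forall>x\<in>carrier N. \<exists>!c. (\<forall>u. c u \<in> hcomp N u) \<and> finite {u. c u \<noteq> \<zero>\<^bsub>N\<^esub>} \<and>
        x = finsum N c {u. c u \<noteq> \<zero>\<^bsub>N\<^esub>}) \<and>
     (\<forall>r u v. (\<forall>m\<in>Poly_Mapping.keys r. mdeg m = v) \<longrightarrow>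
        (\<forall>x\<in>hcomp N u. r \<odot>\<^bsub>N\<^esub> x \<in> hcomp N (v + u)))"

definition is_graded_free :: "('x::finite, 'k::field, 'b) multigraded \<Rightarrow> bool" where
  "is_graded_free N \<longleftrightarrow>
     is_graded_module N \<and>
     (\<exists>A \<subseteq> (\<Union>u. hcomp N u).
        \<not> LinearCombinations.module.lin_dep class_ring N A \<and>
        LinearCombinations.module.span class_ring N A = carrier N)"

definition graded_hom ::
    "('x::finite, 'k::field, 'b) multigraded \<Rightarrow> ('x, 'k, 'c) multigraded \<Rightarrow> ('b \<Rightarrow> 'c) \<Rightarrow> bool" where
  "graded_hom N N' f \<longleftrightarrow>
     f \<in> LinearCombinations.module_hom class_ring N N' \<and> (\<forall>u. f ` hcomp N u \<subseteq> hcomp N' u)"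

definition minimal_free_resolution ::
    "(nat \<Rightarrow> ('x::finite, 'k::field, 'b) multigraded) \<Rightarrow> (nat \<Rightarrow> 'b \<Rightarrow> 'b) \<Rightarrow>
     ('x, 'k, 'c) multigraded \<Rightarrow> bool" where
  "minimal_free_resolution F d N \<longleftrightarrow>
     (\<forall>i. is_graded_free (F i)) \<and>
     (\<forall>i\<ge>1. graded_hom (F i) (F (i - 1)) (d i)) \<and>
     (\<forall>i\<ge>1. d (i + 1) ` carrier (F (i + 1)) = a_kernel (F i) (F (i - 1)) (d i)) \<and>
     (\<exists>\<epsilon>. graded_hom (F 0) N \<epsilon> \<and> \<epsilon> ` carrier (F 0) = carrier N \<and>
        d 1 ` carrier (F 1) = a_kernel (F 0) N \<epsilon>) \<and>
     (\<forall>i\<ge>1. d i ` carrier (F i) \<subseteq>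
        LinearCombinations.module.span class_ring (F (i - 1))
          {r \<odot>\<^bsub>F (i - 1)\<^esub> x |r x. r \<in> irrelevant_ideal \<and> x \<in> carrier (F (i - 1))})"

definition ring_module :: "('x::finite, 'k::field, ('x, 'k) mpoly) multigraded" where
  "ring_module =
     \<lparr>carrier = UNIV, mult = (*), one = 1, zero = 0, add = (+), smult = (*),
      hcomp = (\<lambda>u. {r. \<forall>m\<in>Poly_Mapping.keys r. mdeg m = u})\<rparr>"

definition graded_quot ::
    "('x::finite, 'k::field, 'b) multigraded \<Rightarrow> 'b set \<Rightarrow> ('x, 'k, 'b set) multigraded" where
  "graded_quot N K =
     \<lparr>carrier = carrier (quot_module N K), mult = undefined, one = undefined,
      zero = zero (quot_module N K), add = add (quot_module N K), smult = smult (quot_module N K),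
      hcomp = (\<lambda>u. (\<lambda>x. K +>\<^bsub>N\<^esub> x) ` hcomp N u)\<rparr>"

text \<open>
  For a vector space \<open>V\<close>, the module \<open>R \<otimes> V\<close> is realised on the monomial basis of \<open>R\<close>: a
  finitely supported \<open>f\<close> stands for the sum of the tensors of \<open>m\<close> with \<open>f m\<close>.
\<close>

definition poly_tensor ::
    "('k::field, 'v) module \<Rightarrow> ('x::finite, 'k, 'x mon \<Rightarrow> 'v) multigraded" where
  "poly_tensor V =
     (let C = {f. range f \<subseteq> carrier V \<and> finite {m. f m \<noteq> \<zero>\<^bsub>V\<^esub>}} in
     \<lparr>carrier = C, mult = undefined, one = undefined,
      zero = (\<lambda>_. \<zero>\<^bsub>V\<^esub>), add = (\<lambda>f g m. f m \<oplus>\<^bsub>V\<^esub> g m),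
      smult = (\<lambda>r f m. finsum V (\<lambda>a. Poly_Mapping.lookup r a \<odot>\<^bsub>V\<^esub> f (m - a)) {a. a \<le> m}),
      hcomp = (\<lambda>u. {f \<in> C. \<forall>m. f m \<noteq> \<zero>\<^bsub>V\<^esub> \<longrightarrow> mdeg m = u})\<rparr>)"

text \<open>The map \<open>R \<otimes> V \<rightarrow> R \<otimes> W\<close> that multiplies by the monomial \<open>n\<close> and applies \<open>\<phi>\<close>.\<close>

definition tensor_map ::
    "'x::finite mon \<Rightarrow> ('v \<Rightarrow> 'w) \<Rightarrow> ('k::field, 'w) module \<Rightarrow> ('x mon \<Rightarrow> 'v) \<Rightarrow> ('x mon \<Rightarrow> 'w)" where
  "tensor_map n \<phi> W f = (\<lambda>m. if n \<le> m then \<phi> (f (m - n)) else \<zero>\<^bsub>W\<^esub>)"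

definition degree_shift ::
    "('x::finite, 'k::field, 'b) multigraded \<Rightarrow> ('x \<Rightarrow> int) \<Rightarrow> ('x, 'k, 'b) multigraded" where
  "degree_shift N a = N\<lparr>hcomp := (\<lambda>u. hcomp N (a + u))\<rparr>"

definition graded_dsum ::
    "'i set \<Rightarrow> ('i \<Rightarrow> ('x::finite, 'k::field, 'b) multigraded) \<Rightarrow> ('x, 'k, 'i \<Rightarrow> 'b) multigraded" where
  "graded_dsum I N =
     (let C = {f \<in> (\<Pi>\<^sub>E i\<in>I. carrier (N i)). finite {i \<in> I. f i \<noteq> \<zero>\<^bsub>N i\<^esub>}} in
     \<lparr>carrier = C, mult = undefined, one = undefined,
      zero = (\<lambda>i\<in>I. \<zero>\<^bsub>N i\<^esub>), add = (\<lambda>f g. \<lambda>i\<in>I. f i \<oplus>\<^bsub>N i\<^esub> g i),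
      smult = (\<lambda>r f. \<lambda>i\<in>I. r \<odot>\<^bsub>N i\<^esub> f i),
      hcomp = (\<lambda>u. {f \<in> C. \<forall>i\<in>I. f i \<in> hcomp (N i) u})\<rparr>)"


definition homog_module ::
    "'x::finite mon set \<Rightarrow> nat \<Rightarrow>
     ('x, 'k::field, 'x mon \<Rightarrow> 'x mon \<Rightarrow> ('x mon set \<Rightarrow> 'k) set) multigraded" where
  "homog_module P i =
     graded_dsum (seq_index P i) (\<lambda>q. degree_shift (poly_tensor (seq_summand P i q)) (- mdeg q))"

definition homog_diff ::
    "'x::finite mon set \<Rightarrow> nat \<Rightarrow> ('x mon \<Rightarrow> 'x mon \<Rightarrow> ('x mon set \<Rightarrow> 'k::field) set) \<Rightarrow>
     ('x mon \<Rightarrow> 'x mon \<Rightarrow> ('x mon set \<Rightarrow> 'k) set)" where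
  "homog_diff P i f =
     (\<lambda>p\<in>seq_index P (i - 1).
        finsum (poly_tensor (seq_summand P (i - 1) p) :: ('x, 'k, _) multigraded)
          (\<lambda>q. tensor_map (q - p) (seq_map P i q p) (seq_summand P (i - 1) p) (f q))
          {q \<in> seq_index P i. covered_by P p q})"

definition supports_resolution ::
    "'x::finite mon set \<Rightarrow> ('x, 'k::field) mpoly set \<Rightarrow> bool" where
  "supports_resolution P M \<longleftrightarrow>
     minimal_free_resolution (homog_module P) (homog_diff P) (graded_quot ring_module M)"


definition min_gens :: "('x::finite, 'k::field) mpoly set \<Rightarrow> 'x mon set" where
  "min_gens M = {m. monomial m \<in> M \<and> (\<forall>n. monomial n \<in> M \<and> n \<le> m \<longrightarrow> n = m)}"

definition lcm_lattice :: "('x::finite, 'k::field) mpoly set \<Rightarrow> 'x mon set" where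
  "lcm_lattice M = {LEAST u. \<forall>m\<in>S. m \<le> u |S. S \<subseteq> min_gens M}"

definition betti_poset :: "('x::finite, 'k::field) mpoly set \<Rightarrow> 'x mon set" where
  "betti_poset M =
     {p \<in> lcm_lattice M. \<exists>i. hdim TYPE('k) (open_complex (lcm_lattice M) p) i \<noteq> 0}"

text \<open>
  The minimum and every atom have the complex whose only face is empty, hence the same nonzero
  \<open>h\<^sub>-\<^sub>1\<close>, although they are comparable; so the second condition can only concern elements other
  than the minimum (which contributes to position \<open>0\<close> of the resolution, the atoms to position
  \<open>1\<close>).
\<close>

definition rigid :: "('x::finite, 'k::field) mpoly set \<Rightarrow> bool" where
  "rigid M \<longleftrightarrow>
     (let L = lcm_lattice M; h = (\<lambda>p. hdim TYPE('k) (open_complex L p)) in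
      (\<forall>p\<in>L. (\<forall>i j. h p i \<noteq> 0 \<and> h p j \<noteq> 0 \<longrightarrow> i = j) \<and> (\<forall>i. h p i \<noteq> 0 \<longrightarrow> h p i = 1)) \<and>
      (\<forall>p\<in>L - {zero_hat L}. \<forall>q\<in>L - {zero_hat L}.
         p \<noteq> q \<and> (\<exists>i. h p i = 1 \<and> h q i = 1) \<longrightarrow> \<not> p \<le> q \<and> \<not> q \<le> p))"

end

theory Submission
  imports Defs
begin

text \<open>
  The order complexes of the intervals in the Betti poset \<open>B\<close> have the same homology as those in the
  lcm-lattice, because discarding elements with acyclic lower interval changes nothing. The
  degree in which the interval below \<open>p\<close> has homology defines a rank on \<open>B\<close>. It is strictly monotone:
  a cycle below \<open>p\<close> contains a face whose vertices realise every rank below that of \<open>p\<close>, so a rank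
  inversion \<open>p < q\<close> would produce an element below \<open>q\<close> of the same rank as \<open>q\<close>, against rigidity. Hence \<open>B\<close>
  behaves like the face poset of a cell complex: the open interval below \<open>p\<close> carries a single cycle, in
  its top dimension, and the maps of the sequence are cellular boundary maps, given up to
  sign by taking the link of a cycle at a vertex. In multidegree \<open>u\<close> the homogenized sequence is the
  cellular chain complex of \<open>{p \<in> B. p \<le> u}\<close>. If \<open>u\<close> is in the ideal, then the corresponding part of the
  lcm-lattice is a cone over the least common multiple of the generators dividing \<open>u\<close>, so this
  complex is acyclic.
\<close>

section \<open>Chains of order complexes\<close>

text \<open>The arguments about acyclicity eliminate one maximal vertex at a time: a chain splits
  into the faces through it, described by their link, and the rest; once the link is a boundary, a
  join removes all faces through the vertex. Cellular chains are not a separate complex: the cell of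
  \<open>q\<close> is the cone over its fundamental cycle, an honest simplicial chain, so exactness
  for cells is read off from simplicial fillings. The circularity to be avoided is that fundamental
  cycles are first known only modulo boundaries; rank monotonicity, which is proved from them, then
  excludes chains long enough to have boundaries in that degree, and classes become chains. On the
  module side each nonzero summand is one-dimensional, so a choice of generators identifies the
  tensor modules with coordinates over \<open>R\<close>, where the differential is a matrix of
  terms. Faces are counted by their number of vertices, one more than the dimension, so natural
  numbers suffice and the empty face has index 0; a nonzero element of rank \<open>r\<close> has its
  homology on faces with \<open>r - 1\<close> vertices and contributes to position
  \<open>r\<close>.\<close>

definition chains_of :: "'a::order set \<Rightarrow> nat \<Rightarrow> ('a set \<Rightarrow> 'k::field) set" where
  "chains_of Q n = simpl_chains (order_complex Q) (int n - 1)"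

abbreviation (input) scale_chain :: "'k::field \<Rightarrow> ('b \<Rightarrow> 'k) \<Rightarrow> ('b \<Rightarrow> 'k)" where
  "scale_chain a c \<equiv> (\<lambda>\<sigma>. a * c \<sigma>)"

lemma mem_order_complex_iff:
  assumes "finite Q"
  shows "\<sigma> \<in> order_complex Q \<longleftrightarrow> \<sigma> \<subseteq> Q \<and> Complete_Partial_Order.chain (\<le>) \<sigma>"
  using assms finite_subset unfolding order_complex_def by auto

lemma order_complex_subset: "\<tau> \<in> order_complex Q \<Longrightarrow> \<sigma> \<subseteq> \<tau> \<Longrightarrow> \<sigma> \<in> order_complex Q"
  unfolding order_complex_def by (auto intro: finite_subset chain_subset)

lemma chains_of_iff:
  assumes "finite Q"
  shows "c \<in> chains_of Q n \<longleftrightarrow>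
    (\<forall>\<sigma>. c \<sigma> \<noteq> 0 \<longrightarrow> \<sigma> \<subseteq> Q \<and> Complete_Partial_Order.chain (\<le>) \<sigma> \<and> card \<sigma> = n)"
proof -
  have "finite {\<sigma>. c \<sigma> \<noteq> 0}" if "\<forall>\<sigma>. c \<sigma> \<noteq> 0 \<longrightarrow> \<sigma> \<subseteq> Q"
    by (rule finite_subset[of _ "Pow Q"]) (use that assms in auto)
  then show ?thesis
    unfolding chains_of_def simpl_chains_def by (auto simp: mem_order_complex_iff[OF assms])
qed

lemma chains_of_mono: "finite Q' \<Longrightarrow> Q \<subseteq> Q' \<Longrightarrow> c \<in> chains_of Q n \<Longrightarrow> c \<in> chains_of Q' n"
  using finite_subset[of Q Q'] by (fastforce simp: chains_of_iff)

lemma zero_chain [simp]: "0 \<in> simpl_chains D i"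
  by (simp add: simpl_chains_def)

lemma add_chain: "c \<in> simpl_chains D i \<Longrightarrow> d \<in> simpl_chains D i \<Longrightarrow> c + d \<in> simpl_chains D i"
  unfolding simpl_chains_def
  by (auto intro: finite_subset[of _ "{\<sigma>. c \<sigma> \<noteq> 0} \<union> {\<sigma>. d \<sigma> \<noteq> 0}"])
    (metis add.right_neutral)+

lemma scale_chain: "c \<in> simpl_chains D i \<Longrightarrow> scale_chain a c \<in> simpl_chains D i"
  unfolding simpl_chains_def by (auto intro: finite_subset[of _ "{\<sigma>. c \<sigma> \<noteq> 0}"])

lemma diff_chain: "c \<in> simpl_chains D i \<Longrightarrow> d \<in> simpl_chains D i \<Longrightarrow> c - d \<in> simpl_chains D i"
  using add_chain[of c D i "scale_chain (-1) d"] scale_chain[of d D i "-1"]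
  by (simp add: fun_diff_def plus_fun_def)

lemma sum_chain:
  assumes "\<And>q. q \<in> A \<Longrightarrow> c q \<in> simpl_chains D i"
  shows "(\<Sum>q\<in>A. c q) \<in> simpl_chains D i"
  using assms by (induction A rule: infinite_finite_induct) (auto intro: add_chain)

lemmas zero_chains_of [simp] = zero_chain[of "order_complex Q" "int n - 1" for Q n, folded chains_of_def]
lemmas add_chains_of = add_chain[of _ "order_complex Q" "int n - 1" for Q n, folded chains_of_def]
lemmas scale_chains_of = scale_chain[of _ "order_complex Q" "int n - 1" for Q n, folded chains_of_def]
lemmas diff_chains_of = diff_chain[of _ "order_complex Q" "int n - 1" for Q n, folded chains_of_def]
lemmas sum_chains_of = sum_chain[of _ _ "order_complex Q" "int n - 1" for Q n, folded chains_of_def]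

text \<open>A pair of a face and a deleted vertex leading to \<open>\<tau>\<close> is determined by
  the vertex, so the double sum collapses to one over the vertices that can be added to
  \<open>\<tau>\<close>. The index set \<open>V\<close> may be any finite set containing the faces,
  which lets several chains be compared over the same sum.\<close>

lemma simpl_boundary_support:
  assumes "finite V" and "\<And>\<sigma>. c \<sigma> \<noteq> 0 \<Longrightarrow> \<sigma> \<subseteq> V"
  shows "simpl_boundary c \<tau> = (\<Sum>v\<in>V - \<tau>. (- 1) ^ card {u \<in> \<tau>. u < v} * c (insert v \<tau>))"
proof -
  let ?f = "\<lambda>\<sigma> v. if v \<in> \<sigma> \<and> \<sigma> - {v} = \<tau> then (- 1) ^ card {u \<in> \<sigma>. u < v} * c \<sigma> else 0"
  have "simpl_boundary c \<tau> = (\<Sum>\<sigma> | c \<sigma> \<noteq> 0. \<Sum>v\<in>V. ?f \<sigma> v)"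
    unfolding simpl_boundary_def
    by (intro sum.cong refl sum.mono_neutral_cong_left) (use assms in auto)
  also have "\<dots> = (\<Sum>\<sigma>\<in>Pow V. \<Sum>v\<in>V. ?f \<sigma> v)"
    by (rule sum.mono_neutral_left) (use assms in \<open>auto intro!: sum.neutral\<close>)
  also have "\<dots> = (\<Sum>v\<in>V. \<Sum>\<sigma>\<in>Pow V. ?f \<sigma> v)"
    by (rule sum.swap)
  also have "\<dots> = (\<Sum>v\<in>V. if v \<in> \<tau> then 0 else (- 1) ^ card {u \<in> \<tau>. u < v} * c (insert v \<tau>))"
  proof (rule sum.cong[OF refl])
    fix v assume v: "v \<in> V"
    show "(\<Sum>\<sigma>\<in>Pow V. ?f \<sigma> v) = (if v \<in> \<tau> then 0 else (- 1) ^ card {u \<in> \<tau>. u < v} * c (insert v \<tau>))"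
    proof (cases "v \<in> \<tau>")
      case True
      then have "?f \<sigma> v = 0" for \<sigma> by auto
      then show ?thesis using True by simp
    next
      case False
      then have eq: "?f \<sigma> v = (if \<sigma> = insert v \<tau> then (- 1) ^ card {u \<in> \<sigma>. u < v} * c \<sigma> else 0)" for \<sigma>
        by auto
      have card: "{u \<in> insert v \<tau>. u < v} = {u \<in> \<tau>. u < v}" by auto
      show ?thesis unfolding eq
        by (subst sum.delta) (use assms False card in auto)
    qed
  qed
  also have "\<dots> = (\<Sum>v\<in>V - \<tau>. (- 1) ^ card {u \<in> \<tau>. u < v} * c (insert v \<tau>))"
    by (rule sum.mono_neutral_cong_right) (use assms in auto)
  finally show ?thesis .
qed

lemma simpl_boundary_chain:
  assumes "finite Q" and "c \<in> chains_of Q n"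
  shows "simpl_boundary c \<tau> = (\<Sum>v\<in>Q - \<tau>. (- 1) ^ card {u \<in> \<tau>. u < v} * c (insert v \<tau>))"
  by (rule simpl_boundary_support) (use assms in \<open>auto simp: chains_of_iff\<close>)

lemma finite_vertices:
  assumes "c \<in> simpl_chains (order_complex Q) i"
  shows "finite (\<Union>{\<sigma>. c \<sigma> \<noteq> 0})"
  using assms unfolding simpl_chains_def order_complex_def by auto

lemma simpl_boundary_zero [simp]: "simpl_boundary 0 = 0"
  by (auto simp: simpl_boundary_def)

lemma simpl_boundary_add:
  assumes "c \<in> simpl_chains (order_complex Q) i" and "d \<in> simpl_chains (order_complex Q) i"
  shows "simpl_boundary (c + d) = simpl_boundary c + simpl_boundary d"
proof
  fix \<tau>
  \<comment> \<open>Supports may cancel in the sum, so all three boundaries are expanded over one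
    common vertex set.\<close>
  define V where "V = \<Union>{\<sigma>. c \<sigma> \<noteq> 0} \<union> \<Union>{\<sigma>. d \<sigma> \<noteq> 0}"
  have fin: "finite V" unfolding V_def using assms finite_vertices by blast
  have "\<sigma> \<subseteq> V" if "(c + d) \<sigma> \<noteq> 0" for \<sigma>
  proof -
    have "c \<sigma> \<noteq> 0 \<or> d \<sigma> \<noteq> 0" using that by auto
    then show ?thesis by (auto simp: V_def)
  qed
  moreover have "\<sigma> \<subseteq> V" if "c \<sigma> \<noteq> 0 \<or> d \<sigma> \<noteq> 0" for \<sigma>
    using that by (auto simp: V_def)
  ultimately show "simpl_boundary (c + d) \<tau> = (simpl_boundary c + simpl_boundary d) \<tau>"
    using simpl_boundary_support[OF fin, of "c + d" \<tau>] simpl_boundary_support[OF fin, of c \<tau>]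
      simpl_boundary_support[OF fin, of d \<tau>]
    by (simp add: sum.distrib algebra_simps)
qed

lemma simpl_boundary_scale:
  "simpl_boundary (scale_chain a c) = scale_chain a (simpl_boundary c)"
\<comment> \<open>The defining sum runs over the support, which scaling preserves only for a nonzero
  scalar.\<close>
proof (cases "a = 0")
  case True
  then show ?thesis by (auto simp: simpl_boundary_def)
next
  case False
  then show ?thesis
    by (auto simp: simpl_boundary_def sum_distrib_left intro!: ext sum.cong)
qed

lemma simpl_boundary_diff:
  assumes "c \<in> simpl_chains (order_complex Q) i" and "d \<in> simpl_chains (order_complex Q) i"
  shows "simpl_boundary (c - d) = simpl_boundary c - simpl_boundary d"
  using simpl_boundary_add[OF assms(1) scale_chain[OF assms(2), of "-1"]]
    simpl_boundary_scale[of "-1" d]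
  by (simp add: fun_diff_def plus_fun_def)

lemma simpl_boundary_sum:
  assumes "\<And>q. q \<in> A \<Longrightarrow> c q \<in> simpl_chains (order_complex Q) i"
  shows "simpl_boundary (\<Sum>q\<in>A. c q) = (\<Sum>q\<in>A. simpl_boundary (c q))"
  using assms
proof (induction A rule: infinite_finite_induct)
  case (insert q A)
  then have "simpl_boundary (c q + sum c A) = simpl_boundary (c q) + simpl_boundary (sum c A)"
    by (intro simpl_boundary_add[of _ Q i]) (auto intro: sum_chain)
  then show ?case using insert by (simp only: sum.insert insert_iff simp_thms)
qed auto

lemmas boundary_add = simpl_boundary_add[of _ Q "int n - 1" for Q n, folded chains_of_def]
lemmas boundary_diff = simpl_boundary_diff[of _ Q "int n - 1" for Q n, folded chains_of_def]
lemmas boundary_sum = simpl_boundary_sum[of _ _ Q "int n - 1" for Q n, folded chains_of_def]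

lemma boundary_chains_of:
  assumes "finite Q" and "c \<in> chains_of Q (Suc n)"
  shows "simpl_boundary c \<in> chains_of Q n"
  unfolding chains_of_iff[OF assms(1)]
proof (intro allI impI)
  fix \<tau> assume "simpl_boundary c \<tau> \<noteq> 0"
  then obtain v where "v \<in> Q - \<tau>" "c (insert v \<tau>) \<noteq> 0"
    unfolding simpl_boundary_chain[OF assms] by (metis (no_types, lifting) mult_zero_right sum.neutral)
  moreover then have "insert v \<tau> \<subseteq> Q" "Complete_Partial_Order.chain (\<le>) (insert v \<tau>)" "card (insert v \<tau>) = Suc n"
    using assms by (auto simp: chains_of_iff)
  moreover then have "finite \<tau>" using assms(1) finite_subset by auto
  ultimately show "\<tau> \<subseteq> Q \<and> Complete_Partial_Order.chain (\<le>) \<tau> \<and> card \<tau> = n"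
    by (auto intro: chain_subset)
qed

lemma boundary_chains_of_0:
  assumes "finite Q" and "c \<in> chains_of Q 0"
  shows "simpl_boundary c = 0"
proof
  fix \<tau>
  have "c (insert v \<tau>) = 0" if "v \<in> Q" for v
  proof (rule ccontr)
    assume "c (insert v \<tau>) \<noteq> 0"
    then have "card (insert v \<tau>) = 0" "insert v \<tau> \<subseteq> Q" using assms by (auto simp: chains_of_iff)
    then show False using assms(1) finite_subset by (metis card_eq_0_iff insert_not_empty)
  qed
  then show "simpl_boundary c \<tau> = 0 \<tau>"
    by (simp add: simpl_boundary_chain[OF assms])
qed

text \<open>Two vertices added in either order yield the same face. As faces are totally ordered,
  the double sum splits by which of the two is smaller, and the halves cancel.\<close>

lemma boundary_boundary:
  assumes fin: "finite Q" and c: "c \<in> chains_of Q n"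
  shows "simpl_boundary (simpl_boundary c) = 0"
proof (cases n)
  case 0
  then have "simpl_boundary c = 0" using boundary_chains_of_0[OF fin] c by blast
  then show ?thesis by simp
next
  case (Suc m)
  have d: "simpl_boundary c \<in> chains_of Q m" using boundary_chains_of[OF fin] c Suc by blast
  show ?thesis
  proof
    fix \<tau> :: "'a set"
    let ?s = "\<lambda>\<tau> v. (- 1) ^ card {u \<in> \<tau>. u < (v::'a)} :: 'b"
    let ?f = "\<lambda>v w. ?s \<tau> v * (?s (insert v \<tau>) w * c (insert w (insert v \<tau>)))"
    have "simpl_boundary (simpl_boundary c) \<tau> = (\<Sum>v\<in>Q - \<tau>. ?s \<tau> v * (\<Sum>w\<in>Q - insert v \<tau>. ?s (insert v \<tau>) w * c (insert w (insert v \<tau>))))"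
      by (simp add: simpl_boundary_chain[OF fin d] simpl_boundary_chain[OF fin c])
    also have "\<dots> = (\<Sum>v\<in>Q - \<tau>. \<Sum>w\<in>Q - insert v \<tau>. ?f v w)"
      by (simp add: sum_distrib_left)
    also have "\<dots> = (\<Sum>v\<in>Q - \<tau>. \<Sum>w\<in>Q - \<tau>. (if v < w then ?f v w else 0) + (if w < v then ?f v w else 0))"
    proof (rule sum.cong[OF refl], rule sum.mono_neutral_cong_left)
      fix v w assume "v \<in> Q - \<tau>" "w \<in> Q - insert v \<tau>"
      moreover have "v < w \<or> w < v" if "c (insert w (insert v \<tau>)) \<noteq> 0"
      proof -
        have "Complete_Partial_Order.chain (\<le>) (insert w (insert v \<tau>))" using that c chains_of_iff[OF fin] by blast
        then have "v \<le> w \<or> w \<le> v" by (auto simp: chain_def)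
        then show ?thesis using \<open>w \<in> Q - insert v \<tau>\<close> by auto
      qed
      ultimately show "?f v w = (if v < w then ?f v w else 0) + (if w < v then ?f v w else 0)"
        by auto
    qed (use fin in auto)
    also have "\<dots> = (\<Sum>v\<in>Q - \<tau>. \<Sum>w\<in>Q - \<tau>. if v < w then ?f v w else 0) + (\<Sum>v\<in>Q - \<tau>. \<Sum>w\<in>Q - \<tau>. if w < v then ?f v w else 0)"
      by (simp add: sum.distrib)
    also have "(\<Sum>v\<in>Q - \<tau>. \<Sum>w\<in>Q - \<tau>. if w < v then ?f v w else 0) = (\<Sum>v\<in>Q - \<tau>. \<Sum>w\<in>Q - \<tau>. if v < w then ?f w v else 0)"
      by (rule sum.swap)
    also have "\<dots> = - (\<Sum>v\<in>Q - \<tau>. \<Sum>w\<in>Q - \<tau>. if v < w then ?f v w else 0)"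
    proof -
      \<comment> \<open>The position of the larger vertex counts the smaller one when that is
        already present; the position of the smaller never sees the larger. So exactly one exponent
        changes, by one.\<close>
      have "?f w v = - ?f v w" if vw: "v < w" "v \<in> Q - \<tau>" "w \<in> Q - \<tau>" for v w
      proof (cases "c (insert w (insert v \<tau>)) = 0")
        case True
        then show ?thesis by (simp add: insert_commute)
      next
        case False
        then have "insert w (insert v \<tau>) \<subseteq> Q" using c chains_of_iff[OF fin] by blast
        then have ft: "finite \<tau>" using fin finite_subset by auto
        have "{u \<in> insert v \<tau>. u < w} = insert v {u \<in> \<tau>. u < w}" using vw by auto
        moreover have "{u \<in> insert w \<tau>. u < v} = {u \<in> \<tau>. u < v}" using vw by auto
        ultimately show ?thesis using ft vw by (simp add: insert_commute algebra_simps)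
      qed
      then show ?thesis unfolding sum_negf[symmetric] by (intro sum.cong refl) auto
    qed
    finally show "simpl_boundary (simpl_boundary c) \<tau> = 0 \<tau>" by simp
  qed
qed

section \<open>Links and joins at a vertex\<close>

definition link_chain :: "'a \<Rightarrow> ('a set \<Rightarrow> 'k::field) \<Rightarrow> ('a set \<Rightarrow> 'k)" where
  "link_chain p c = (\<lambda>\<tau>. if p \<in> \<tau> then 0 else c (insert p \<tau>))"

text \<open>The cone with apex \<open>p\<close>. A chain \<open>c\<close> is
  \<open>join_chain (link_chain p c) p\<close> plus its faces that avoid \<open>p\<close>, so the
  two operations isolate the part of a chain at a vertex.\<close>

definition join_chain :: "('a set \<Rightarrow> 'k::field) \<Rightarrow> 'a \<Rightarrow> ('a set \<Rightarrow> 'k)" where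
  "join_chain c p = (\<lambda>\<sigma>. if p \<in> \<sigma> then c (\<sigma> - {p}) else 0)"

lemma link_chain_add: "link_chain p (c + d) = link_chain p c + link_chain p d"
  by (auto simp: link_chain_def)

lemma link_chain_diff: "link_chain p (c - d) = link_chain p c - link_chain p d"
  by (auto simp: link_chain_def)

lemma link_chain_scale: "link_chain p (scale_chain a c) = scale_chain a (link_chain p c)"
  by (auto simp: link_chain_def)

lemma link_chain_sum: "link_chain p (\<Sum>q\<in>A. c q) = (\<Sum>q\<in>A. link_chain p (c q))"
proof (induction A rule: infinite_finite_induct)
  case (insert q A)
  then show ?case by (simp only: sum.insert link_chain_add simp_thms)
qed (auto simp: link_chain_def)

text \<open>The other vertices of a face through \<open>p\<close> are comparable with
  \<open>p\<close>, and maximality leaves only elements below it.\<close>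

lemma link_chains_of:
  assumes fin: "finite Q" and p: "\<And>x. x \<in> Q \<Longrightarrow> \<not> p < x" and c: "c \<in> chains_of Q (Suc n)"
  shows "link_chain p c \<in> chains_of {x \<in> Q. x < p} n"
proof -
  have "finite {x \<in> Q. x < p}" using fin by auto
  then show ?thesis unfolding chains_of_iff[OF \<open>finite {x \<in> Q. x < p}\<close>]
  proof (intro allI impI)
    fix \<tau> assume "link_chain p c \<tau> \<noteq> 0"
    then have "p \<notin> \<tau>" "c (insert p \<tau>) \<noteq> 0" by (auto simp: link_chain_def split: if_splits)
    then have *: "insert p \<tau> \<subseteq> Q" "Complete_Partial_Order.chain (\<le>) (insert p \<tau>)" "card (insert p \<tau>) = Suc n"
      using c chains_of_iff[OF fin] by blast+
    moreover have "finite \<tau>" using *(1) fin finite_subset by auto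
    moreover have "x < p" if "x \<in> \<tau>" for x
    proof -
      have "x \<le> p \<or> p \<le> x" using *(2) that by (auto simp: chain_def)
      then show ?thesis using that \<open>p \<notin> \<tau>\<close> p[of x] *(1) by (auto simp: order.order_iff_strict)
    qed
    ultimately show "\<tau> \<subseteq> {x \<in> Q. x < p} \<and> Complete_Partial_Order.chain (\<le>) \<tau> \<and> card \<tau> = n"
      using \<open>p \<notin> \<tau>\<close> by (auto intro: chain_subset)
  qed
qed

lemma join_chains_of:
  assumes fin: "finite Q" and p: "p \<in> Q" and c: "c \<in> chains_of {x \<in> Q. x < p} n"
  shows "join_chain c p \<in> chains_of Q (Suc n)"
  unfolding chains_of_iff[OF fin]
proof (intro allI impI)
  have fin': "finite {x \<in> Q. x < p}" using fin by auto
  fix \<sigma> assume "join_chain c p \<sigma> \<noteq> 0"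
  then have "p \<in> \<sigma>" "c (\<sigma> - {p}) \<noteq> 0" by (auto simp: join_chain_def split: if_splits)
  then have *: "\<sigma> - {p} \<subseteq> {x \<in> Q. x < p}" "Complete_Partial_Order.chain (\<le>) (\<sigma> - {p})" "card (\<sigma> - {p}) = n"
    using c chains_of_iff[OF fin'] by blast+
  have "finite \<sigma>" using *(1) fin' finite_subset by (metis finite_Diff2 finite.emptyI finite_insert)
  moreover have "Complete_Partial_Order.chain (\<le>) \<sigma>"
  proof (rule chainI)
    fix x y assume "x \<in> \<sigma>" "y \<in> \<sigma>"
    then show "x \<le> y \<or> y \<le> x" using *(1,2)
      by (cases "x = p"; cases "y = p") (auto simp: chain_def)
  qed
  moreover have "\<sigma> \<subseteq> Q" using *(1) p by blast
  moreover have "card \<sigma> = Suc n" using card_Suc_Diff1[OF \<open>finite \<sigma>\<close> \<open>p \<in> \<sigma>\<close>] *(3) by simp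
  ultimately show "\<sigma> \<subseteq> Q \<and> Complete_Partial_Order.chain (\<le>) \<sigma> \<and> card \<sigma> = Suc n"
    by blast
qed

lemma link_join:
  assumes "\<And>\<tau>. c \<tau> \<noteq> 0 \<Longrightarrow> p \<notin> \<tau>"
  shows "link_chain p (join_chain c p) = c"
proof
  show "link_chain p (join_chain c p) \<tau> = c \<tau>" for \<tau>
    using assms[of \<tau>] by (auto simp: link_chain_def join_chain_def)
qed

lemma link_join_below:
  assumes "finite Q" and "c \<in> chains_of {x \<in> Q. x < p} n"
  shows "link_chain p (join_chain c p) = c"
proof (rule link_join)
  have "finite {x \<in> Q. x < p}" using assms by auto
  then show "p \<notin> \<tau>" if "c \<tau> \<noteq> 0" for \<tau> using assms(2) that chains_of_iff by blast
qed

text \<open>No sign appears because a maximal vertex is the last one of every face that contains it.\<close>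

lemma link_boundary:
  assumes fin: "finite Q" and p: "\<And>x. x \<in> Q \<Longrightarrow> \<not> p < x" and c: "c \<in> chains_of Q n"
  shows "link_chain p (simpl_boundary c) = simpl_boundary (link_chain p c)"
proof
  fix \<tau>
  have fin': "finite {x \<in> Q. x < p}" using fin by auto
  have "simpl_boundary (link_chain p c) \<tau> = (\<Sum>v\<in>Q - \<tau>. (- 1) ^ card {u \<in> \<tau>. u < v} * link_chain p c (insert v \<tau>))"
  proof (rule simpl_boundary_support[OF fin])
    fix \<sigma> assume "link_chain p c \<sigma> \<noteq> 0"
    then have "c (insert p \<sigma>) \<noteq> 0" by (auto simp: link_chain_def split: if_splits)
    then show "\<sigma> \<subseteq> Q" using c chains_of_iff[OF fin] by blast
  qed
  also have "\<dots> = link_chain p (simpl_boundary c) \<tau>"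
  proof (cases "p \<in> \<tau>")
    case True
    then show ?thesis by (auto simp: link_chain_def)
  next
    case False
    have "(\<Sum>v\<in>Q - \<tau>. (- 1) ^ card {u \<in> \<tau>. u < v} * link_chain p c (insert v \<tau>)) =
      (\<Sum>v\<in>Q - insert p \<tau>. (- 1) ^ card {u \<in> insert p \<tau>. u < v} * c (insert v (insert p \<tau>)))"
    proof (rule sum.mono_neutral_cong_right)
      fix v assume "v \<in> Q - insert p \<tau>"
      moreover then have "{u \<in> insert p \<tau>. u < v} = {u \<in> \<tau>. u < v}" using p by auto
      ultimately show "(- 1) ^ card {u \<in> \<tau>. u < v} * link_chain p c (insert v \<tau>) =
        (- 1) ^ card {u \<in> insert p \<tau>. u < v} * c (insert v (insert p \<tau>))"
        using False by (auto simp: link_chain_def insert_commute)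
    qed (use fin in \<open>auto simp: link_chain_def\<close>)
    then show ?thesis using False by (simp add: link_chain_def simpl_boundary_chain[OF fin c])
  qed
  finally show "link_chain p (simpl_boundary c) \<tau> = simpl_boundary (link_chain p c) \<tau>" by simp
qed

text \<open>Since \<open>c\<close> lives below \<open>p\<close>, the apex is the last of the
  \<open>n + 1\<close> vertices: deleting it costs the sign \<open>(- 1) ^ n\<close>, and the signs
  of the other vertices do not notice it.\<close>

lemma boundary_join:
  assumes fin: "finite Q" and p: "p \<in> Q" and c: "c \<in> chains_of {x \<in> Q. x < p} n"
  shows "simpl_boundary (join_chain c p) =
    join_chain (simpl_boundary c) p + scale_chain ((- 1) ^ n) c"
proof
  fix \<tau>
  have fin': "finite {x \<in> Q. x < p}" using fin by auto
  define W where "W = {x \<in> Q. x < p}"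
  have finW: "finite W" and cW: "c \<in> chains_of W n" using fin' c by (auto simp: W_def)
  have pW: "p \<notin> W" by (auto simp: W_def)
  have supp: "\<sigma> \<subseteq> W" "card \<sigma> = n" if "c \<sigma> \<noteq> 0" for \<sigma>
    using that cW chains_of_iff[OF finW] by blast+
  have bj: "simpl_boundary (join_chain c p) \<tau> =
      (\<Sum>v\<in>insert p W - \<tau>. (- 1) ^ card {u \<in> \<tau>. u < v} * join_chain c p (insert v \<tau>))"
  proof (rule simpl_boundary_support)
    fix \<sigma> assume "join_chain c p \<sigma> \<noteq> 0"
    then have "c (\<sigma> - {p}) \<noteq> 0" by (auto simp: join_chain_def split: if_splits)
    then show "\<sigma> \<subseteq> insert p W" using supp by blast
  qed (use finW in simp)
  show "simpl_boundary (join_chain c p) \<tau> =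
    (join_chain (simpl_boundary c) p + scale_chain ((- 1) ^ n) c) \<tau>"
  proof (cases "p \<in> \<tau>")
    case True
    have "c \<tau> = 0" using supp(1)[of \<tau>] True pW by auto
    moreover have "insert p W - \<tau> = W - (\<tau> - {p})" using True pW by auto
    moreover have "{u \<in> \<tau>. u < v} = {u \<in> \<tau> - {p}. u < v}" if "v \<in> W" for v
      using that by (auto simp: W_def)
    moreover have "insert v \<tau> - {p} = insert v (\<tau> - {p})" if "v \<in> W" for v
      using that pW by auto
    ultimately show ?thesis
      unfolding bj using True
      by (auto simp: join_chain_def simpl_boundary_chain[OF finW cW] intro!: sum.cong)
  next
    case False
    have "(\<Sum>v\<in>insert p W - \<tau>. (- 1) ^ card {u \<in> \<tau>. u < v} * join_chain c p (insert v \<tau>)) =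
       (\<Sum>v\<in>{p}. (- 1) ^ card {u \<in> \<tau>. u < v} * join_chain c p (insert v \<tau>))"
      by (rule sum.mono_neutral_right) (use finW False in \<open>auto simp: join_chain_def\<close>)
    also have "\<dots> = (- 1) ^ card {u \<in> \<tau>. u < p} * c \<tau>"
      using False by (simp add: join_chain_def)
    also have "\<dots> = (- 1) ^ n * c \<tau>"
    proof (cases "c \<tau> = 0")
      case False
      then have "{u \<in> \<tau>. u < p} = \<tau>" using supp(1) by (auto simp: W_def)
      then show ?thesis using supp(2)[OF False] by simp
    qed simp
    finally show ?thesis unfolding bj using False by (simp add: join_chain_def)
  qed
qed

text \<open>The elimination device: subtracting the boundary of \<open>join_chain w p\<close> from a
  chain changes its link at \<open>p\<close> by the boundary of \<open>w\<close>, so a link that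
  bounds can be removed.\<close>

lemma link_boundary_join:
  assumes fin: "finite Q" and p: "p \<in> Q" "\<And>x. x \<in> Q \<Longrightarrow> \<not> p < x"
    and w: "w \<in> chains_of {x \<in> Q. x < p} n"
  shows "link_chain p (simpl_boundary (join_chain w p)) = simpl_boundary w"
  using link_boundary[OF fin p(2) join_chains_of[OF fin p(1) w]] link_join_below[OF fin w] by simp

lemma chains_of_remove:
  assumes fin: "finite Q" and c: "c \<in> chains_of Q n" and l: "link_chain p c = 0"
  shows "c \<in> chains_of (Q - {p}) n"
proof -
  have fin': "finite (Q - {p})" using fin by simp
  have "p \<notin> \<sigma>" if "c \<sigma> \<noteq> 0" for \<sigma>
    using that fun_cong[OF l, of "\<sigma> - {p}"] by (auto simp: link_chain_def insert_absorb)
  then show ?thesis using c unfolding chains_of_iff[OF fin] chains_of_iff[OF fin'] by blast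
qed

text \<open>Reduced acyclicity: for \<open>n = 0\<close> the empty face must bound, so the empty
  poset is not acyclic.\<close>

definition acyclic_poset :: "'k::field itself \<Rightarrow> 'a::order set \<Rightarrow> bool" where
  "acyclic_poset _ Q \<longleftrightarrow> (\<forall>n. \<forall>c\<in>chains_of Q n. simpl_boundary c = 0 \<longrightarrow>
     (\<exists>e\<in>chains_of Q (Suc n). (c :: 'a set \<Rightarrow> 'k) = simpl_boundary e))"

text \<open>Coning off the faces that avoid \<open>t\<close> leaves a cycle with \<open>t\<close> in
  every face. Such a cycle is the join of its link, itself a cycle, so by
  \<open>boundary_join\<close> its boundary is the link up to sign; the link therefore
  vanishes.\<close>

lemma acyclic_cone:
  assumes fin: "finite Q" and t: "t \<in> Q" "\<And>x. x \<in> Q \<Longrightarrow> x \<le> t"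
  shows "acyclic_poset TYPE('k::field) Q"
  unfolding acyclic_poset_def
proof (intro allI ballI impI)
  fix n and c :: "'a set \<Rightarrow> 'k"
  assume c: "c \<in> chains_of Q n" and cyc: "simpl_boundary c = 0"
  define W where "W = {x \<in> Q. x < t}"
  have finW: "finite W" using fin by (auto simp: W_def)
  have nt: "\<not> t < x" if "x \<in> Q" for x using t(2)[OF that] by auto
  have Q: "Q = insert t W" using t by (auto simp: W_def order.order_iff_strict)
  define a where "a = (\<lambda>\<sigma>. if t \<in> \<sigma> then 0 else c \<sigma>)"
  have a: "a \<in> chains_of W n"
    unfolding chains_of_iff[OF finW] using c chains_of_iff[OF fin] Q by (auto simp: a_def)
  \<comment> \<open>The sign undoes the one that \<open>boundary_join\<close> puts on
    \<open>a\<close>, so that the boundary of \<open>f\<close> agrees with \<open>c\<close> on the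
    faces avoiding \<open>t\<close>.\<close>
  define f where "f = scale_chain ((- 1) ^ n) (join_chain a t)"
  have ja: "join_chain a t \<in> chains_of Q (Suc n)"
    using join_chains_of[OF fin t(1)] a by (simp add: W_def)
  have f: "f \<in> chains_of Q (Suc n)" unfolding f_def by (rule scale_chains_of[OF ja])
  have bf: "simpl_boundary f = scale_chain ((- 1) ^ n) (join_chain (simpl_boundary a) t) + a"
    unfolding f_def simpl_boundary_scale boundary_join[OF fin t(1) a[unfolded W_def]]
    by (auto simp: algebra_simps power_mult_distrib[symmetric] simp flip: mult.assoc)
  define b where "b = c - simpl_boundary f"
  have b: "b \<in> chains_of Q n"
    unfolding b_def using c boundary_chains_of[OF fin f] by (rule diff_chains_of)
  have bt: "t \<in> \<sigma>" if "b \<sigma> \<noteq> 0" for \<sigma>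
    using that by (auto simp: b_def bf a_def join_chain_def split: if_splits)
  have bcyc: "simpl_boundary b = 0"
    unfolding b_def boundary_diff[OF c boundary_chains_of[OF fin f]]
    using cyc boundary_boundary[OF fin f] by simp
  have "b = 0"
  proof (cases n)
    case 0
    then show ?thesis using b bt finite_subset[OF _ fin] unfolding chains_of_iff[OF fin]
      by (metis card_eq_0_iff empty_iff ext zero_fun_apply)
  next
    case (Suc m)
    have l: "link_chain t b \<in> chains_of {x \<in> Q. x < t} m"
      using link_chains_of[OF fin nt] b Suc by blast
    have "b = join_chain (link_chain t b) t"
    proof
      show "b \<sigma> = join_chain (link_chain t b) t \<sigma>" for \<sigma>
        using bt[of \<sigma>] by (auto simp: join_chain_def link_chain_def insert_absorb)
    qed
    then have "join_chain (simpl_boundary (link_chain t b)) t + scale_chain ((- 1) ^ m) (link_chain t b) = 0"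
      using boundary_join[OF fin t(1) l] bcyc by simp
    moreover have "simpl_boundary (link_chain t b) = link_chain t (simpl_boundary b)"
      using link_boundary[OF fin nt b] by simp
    ultimately have "scale_chain ((- 1) ^ m) (link_chain t b) = 0"
      using bcyc by (simp add: link_chain_def join_chain_def zero_fun_def plus_fun_def cong: if_cong)
    then have "link_chain t b \<sigma> = 0" for \<sigma> by (simp add: fun_eq_iff)
    then have "join_chain (link_chain t b) t = 0" by (auto simp: join_chain_def)
    then show ?thesis using \<open>b = join_chain (link_chain t b) t\<close> by simp
  qed
  then show "\<exists>e\<in>chains_of Q (Suc n). c = simpl_boundary e" using f by (auto simp: b_def)
qed

section \<open>Acyclicity and cellular chains\<close>

lemma boundary_support_subset:
  assumes fin: "finite Q" and c: "c \<in> chains_of Q n" and B: "\<And>\<sigma>. c \<sigma> \<noteq> 0 \<Longrightarrow> \<sigma> \<subseteq> B"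
    and \<tau>: "simpl_boundary c \<tau> \<noteq> 0"
  shows "\<tau> \<subseteq> B"
proof -
  obtain v where "c (insert v \<tau>) \<noteq> 0"
    using \<tau> unfolding simpl_boundary_chain[OF fin c]
    by (metis (no_types, lifting) mult_zero_right sum.neutral)
  then show ?thesis using B by blast
qed

lemma chains_of_restrict:
  assumes "finite Q" and "c \<in> chains_of Q n" and "\<And>\<sigma>. c \<sigma> \<noteq> 0 \<Longrightarrow> \<sigma> \<subseteq> B"
  shows "c \<in> chains_of (Q \<inter> B) n"
  using assms by (simp add: chains_of_iff)

lemma chains_ofD:
  assumes "finite Q" and "c \<in> chains_of Q n" and "c \<sigma> \<noteq> 0"
  shows "\<sigma> \<subseteq> Q" and "Complete_Partial_Order.chain (\<le>) \<sigma>" and "card \<sigma> = n"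
  using assms unfolding chains_of_iff[OF assms(1)] by auto

lemma chains_of_0_support:
  assumes "finite Q" and "c \<in> chains_of Q 0" and "c \<sigma> \<noteq> 0"
  shows "\<sigma> = {}"
proof -
  have "\<sigma> \<subseteq> Q" "card \<sigma> = 0" using assms by (auto simp: chains_of_iff)
  then show ?thesis using finite_subset[OF _ assms(1)] by auto
qed

text \<open>The complex of chains on \<open>U\<close> modulo chains on \<open>U \<inter> B\<close> is acyclic when the elements outside
  \<open>B\<close> have acyclic lower intervals: the elements of \<open>U\<close> are removed from the top, and removing
  \<open>p\<close> changes the relative complex by the relative complex of the interval below \<open>p\<close>.\<close>

lemma relative_acyclic:
  fixes L B U :: "'a::order set" and e :: "'a set \<Rightarrow> 'k::field"
  assumes "finite U" and "U \<subseteq> L" and "\<And>x y. y \<in> U \<Longrightarrow> x \<in> L \<Longrightarrow> x < y \<Longrightarrow> x \<in> U"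
    and acyc: "\<And>p. p \<in> L \<Longrightarrow> p \<notin> B \<Longrightarrow> acyclic_poset TYPE('k) {x \<in> L. x < p}"
    and "e \<in> chains_of U n" and "\<And>\<sigma>. simpl_boundary e \<sigma> \<noteq> 0 \<Longrightarrow> \<sigma> \<subseteq> B"
  shows "\<exists>f\<in>chains_of U (Suc n). \<forall>\<sigma>. (e - simpl_boundary f) \<sigma> \<noteq> 0 \<longrightarrow> \<sigma> \<subseteq> B"
  using assms(1,2,3,5,6)
proof (induction U arbitrary: e n rule: finite_psubset_induct)
  case (psubset U)
  note fin = \<open>finite U\<close>
  show ?case
  proof (cases "n = 0 \<or> U = {}")
    case True
    \<comment> \<open>In both degenerate cases only the empty face can occur, and it lies in
      \<open>B\<close>.\<close>
    then have "\<sigma> = {}" if "e \<sigma> \<noteq> 0" for \<sigma>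
      using that chains_of_0_support[OF fin, of e \<sigma>] psubset.prems(3) chains_of_iff[OF fin, of e n] by auto
    moreover have "e - simpl_boundary 0 = e" by (simp only: simpl_boundary_zero diff_zero)
    ultimately have "\<forall>\<sigma>. (e - simpl_boundary 0) \<sigma> \<noteq> 0 \<longrightarrow> \<sigma> \<subseteq> B" by (metis empty_subsetI)
    then show ?thesis using zero_chains_of by blast
  next
    case False
    then obtain m where n: "n = Suc m" by (cases n) auto
    obtain p where p: "p \<in> U" and m: "\<And>x. x \<in> U \<Longrightarrow> p \<le> x \<Longrightarrow> p = x"
      using finite_has_maximal[OF fin] False by blast
    have max: "\<not> p < x" if "x \<in> U" for x using m[OF that] by (auto simp: less_le)
    define W where "W = {x \<in> U. x < p}"
    have WL: "W = {x \<in> L. x < p}" using psubset.prems(1,2) p by (auto simp: W_def)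
    have W: "W \<subset> U" "finite W" using p fin by (auto simp: W_def)
    define l where "l = link_chain p e"
    have e: "e \<in> chains_of U (Suc m)" using psubset.prems(3) n by simp
    have l: "l \<in> chains_of W m" unfolding l_def W_def using link_chains_of[OF fin max e] by blast
    have dl: "simpl_boundary l = link_chain p (simpl_boundary e)"
      unfolding l_def using link_boundary[OF fin max e] by simp
    \<comment> \<open>The link has to be corrected only up to faces that stay in \<open>B\<close>
      after \<open>p\<close> is put back. For \<open>p\<close> in \<open>B\<close> this is the
      induction hypothesis below \<open>p\<close>; otherwise no face through \<open>p\<close> lies
      in \<open>B\<close>, so the link is a cycle and must bound.\<close>
    have "\<exists>w\<in>chains_of W (Suc m). \<forall>\<sigma>. (l - simpl_boundary w) \<sigma> \<noteq> 0 \<longrightarrow> insert p \<sigma> \<subseteq> B"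
    proof (cases "p \<in> B")
      case True
      have "\<sigma> \<subseteq> B" if "simpl_boundary l \<sigma> \<noteq> 0" for \<sigma>
        using that psubset.prems(4)[of "insert p \<sigma>"] unfolding dl
        by (auto simp: link_chain_def split: if_splits)
      then have "\<exists>w\<in>chains_of W (Suc m). \<forall>\<sigma>. (l - simpl_boundary w) \<sigma> \<noteq> 0 \<longrightarrow> \<sigma> \<subseteq> B"
        using psubset.IH[of W l m] W(1) l WL psubset.prems(1) by force
      then show ?thesis using True by auto
    next
      case False
      have "simpl_boundary l = 0"
      proof
        show "simpl_boundary l \<sigma> = 0 \<sigma>" for \<sigma>
          using psubset.prems(4)[of "insert p \<sigma>"] False unfolding dl by (auto simp: link_chain_def)
      qed
      then obtain w where "w \<in> chains_of W (Suc m)" "l = simpl_boundary w"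
        using acyc[of p] p psubset.prems(1) False l unfolding WL acyclic_poset_def by blast
      then show ?thesis by auto
    qed
    then obtain w where w: "w \<in> chains_of W (Suc m)"
      and wB: "\<And>\<sigma>. (l - simpl_boundary w) \<sigma> \<noteq> 0 \<Longrightarrow> insert p \<sigma> \<subseteq> B" by blast
    define j where "j = join_chain w p"
    have j: "j \<in> chains_of U (Suc n)" unfolding j_def n using join_chains_of[OF fin p] w by (simp add: W_def)
    define g where "g = l - simpl_boundary w"
    have g: "g \<in> chains_of W m" unfolding g_def using l boundary_chains_of[OF W(2) w] by (rule diff_chains_of)
    have jg: "join_chain g p \<in> chains_of U n"
      unfolding n using join_chains_of[OF fin p] g by (simp add: W_def)
    have jgB: "\<sigma> \<subseteq> B" if "join_chain g p \<sigma> \<noteq> 0" for \<sigma>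
      using that wB[of "\<sigma> - {p}"] by (auto simp: join_chain_def g_def insert_absorb split: if_splits)
    \<comment> \<open>What remains after removing the boundary and the part already in
      \<open>B\<close> has no face through \<open>p\<close>, so the induction hypothesis for
      \<open>U - {p}\<close> applies.\<close>
    define e2 where "e2 = e - simpl_boundary j - join_chain g p"
    have dj: "simpl_boundary j \<in> chains_of U n" using boundary_chains_of[OF fin j] .
    have e1: "e - simpl_boundary j \<in> chains_of U n" using psubset.prems(3) dj by (rule diff_chains_of)
    have e2: "e2 \<in> chains_of U n" unfolding e2_def using e1 jg by (rule diff_chains_of)
    have "link_chain p e2 = 0"
      unfolding e2_def link_chain_diff j_def
      using link_boundary_join[OF fin p max w[unfolded W_def]] link_join_below[OF fin g[unfolded W_def]]
      by (simp add: g_def l_def)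
    then have e2': "e2 \<in> chains_of (U - {p}) n" using chains_of_remove[OF fin e2] by blast
    have de2: "simpl_boundary e2 = simpl_boundary e - simpl_boundary (join_chain g p)"
      unfolding e2_def boundary_diff[OF e1 jg] boundary_diff[OF psubset.prems(3) dj]
      using boundary_boundary[OF fin j] by simp
    have "\<sigma> \<subseteq> B" if "simpl_boundary e2 \<sigma> \<noteq> 0" for \<sigma>
    proof -
      have "simpl_boundary e \<sigma> \<noteq> 0 \<or> simpl_boundary (join_chain g p) \<sigma> \<noteq> 0"
        using that unfolding de2 by auto
      then show ?thesis using psubset.prems(4) boundary_support_subset[OF fin jg jgB] by blast
    qed
    moreover have "x \<in> U - {p}" if "y \<in> U - {p}" "x \<in> L" "x < y" for x y
      using that psubset.prems(2)[of y x] max[of y] by auto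
    ultimately have "\<exists>f\<in>chains_of (U - {p}) (Suc n). \<forall>\<sigma>. (e2 - simpl_boundary f) \<sigma> \<noteq> 0 \<longrightarrow> \<sigma> \<subseteq> B"
      using psubset.IH[of "U - {p}" e2 n] p e2' psubset.prems(1) by blast
    then obtain f where f: "f \<in> chains_of (U - {p}) (Suc n)"
      and fB: "\<And>\<sigma>. (e2 - simpl_boundary f) \<sigma> \<noteq> 0 \<Longrightarrow> \<sigma> \<subseteq> B" by blast
    have f': "f \<in> chains_of U (Suc n)" using chains_of_mono[OF fin _ f] by blast
    have eq: "e - simpl_boundary (j + f) = (e2 - simpl_boundary f) + join_chain g p"
      unfolding boundary_add[OF j f'] e2_def by auto
    show ?thesis
    proof (intro bexI allI impI)
      fix \<sigma> assume "(e - simpl_boundary (j + f)) \<sigma> \<noteq> 0"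
      then have "(e2 - simpl_boundary f) \<sigma> \<noteq> 0 \<or> join_chain g p \<sigma> \<noteq> 0"
        unfolding eq by auto
      then show "\<sigma> \<subseteq> B" using fB jgB by blast
    qed (rule add_chains_of[OF j f'])
  qed
qed

text \<open>Injectivity on homology of the inclusion of \<open>U \<inter> B\<close> in
  \<open>U\<close>: a filling of a chain on \<open>B\<close> is a relative cycle, and subtracting a
  suitable boundary moves it into \<open>B\<close> without changing its own boundary.\<close>

lemma boundary_in_subposet:
  fixes L B U :: "'a::order set" and c :: "'a set \<Rightarrow> 'k::field"
  assumes fin: "finite U" and U: "U \<subseteq> L" "\<And>x y. y \<in> U \<Longrightarrow> x \<in> L \<Longrightarrow> x < y \<Longrightarrow> x \<in> U"
    and acyc: "\<And>p. p \<in> L \<Longrightarrow> p \<notin> B \<Longrightarrow> acyclic_poset TYPE('k) {x \<in> L. x < p}"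
    and c: "c \<in> chains_of (U \<inter> B) n" and e: "e \<in> chains_of U (Suc n)" "c = simpl_boundary e"
  shows "\<exists>e'\<in>chains_of (U \<inter> B) (Suc n). c = simpl_boundary e'"
proof -
  have finB: "finite (U \<inter> B)" using fin by simp
  have "\<sigma> \<subseteq> B" if "simpl_boundary e \<sigma> \<noteq> 0" for \<sigma>
    using that c e(2) chains_of_iff[OF finB, of c n] by blast
  then have "\<exists>f\<in>chains_of U (Suc (Suc n)). \<forall>\<sigma>. (e - simpl_boundary f) \<sigma> \<noteq> 0 \<longrightarrow> \<sigma> \<subseteq> B"
    by (intro relative_acyclic[where L = L]) (use assms in auto)
  then obtain f where f: "f \<in> chains_of U (Suc (Suc n))"
    and fB: "\<And>\<sigma>. (e - simpl_boundary f) \<sigma> \<noteq> 0 \<Longrightarrow> \<sigma> \<subseteq> B" by blast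
  have df: "simpl_boundary f \<in> chains_of U (Suc n)" using boundary_chains_of[OF fin f] .
  show ?thesis
  proof
    show "e - simpl_boundary f \<in> chains_of (U \<inter> B) (Suc n)"
      by (rule chains_of_restrict[OF fin diff_chains_of[OF e(1) df] fB])
    show "c = simpl_boundary (e - simpl_boundary f)"
      unfolding boundary_diff[OF e(1) df] boundary_boundary[OF fin f] using e(2) by simp
  qed
qed

text \<open>Surjectivity on homology of the same inclusion: a cycle is in particular a relative
  cycle, and the correction that moves it into \<open>B\<close> is a boundary.\<close>

lemma cycle_in_subposet:
  fixes L B U :: "'a::order set" and b :: "'a set \<Rightarrow> 'k::field"
  assumes fin: "finite U" and U: "U \<subseteq> L" "\<And>x y. y \<in> U \<Longrightarrow> x \<in> L \<Longrightarrow> x < y \<Longrightarrow> x \<in> U"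
    and acyc: "\<And>p. p \<in> L \<Longrightarrow> p \<notin> B \<Longrightarrow> acyclic_poset TYPE('k) {x \<in> L. x < p}"
    and b: "b \<in> chains_of U n" "simpl_boundary b = 0"
  shows "\<exists>z\<in>chains_of (U \<inter> B) n. \<exists>f\<in>chains_of U (Suc n). simpl_boundary z = 0 \<and> b - z = simpl_boundary f"
proof -
  have "\<sigma> \<subseteq> B" if "simpl_boundary b \<sigma> \<noteq> 0" for \<sigma> using that b(2) by simp
  then have "\<exists>f\<in>chains_of U (Suc n). \<forall>\<sigma>. (b - simpl_boundary f) \<sigma> \<noteq> 0 \<longrightarrow> \<sigma> \<subseteq> B"
    by (intro relative_acyclic[where L = L]) (use assms in auto)
  then obtain f where f: "f \<in> chains_of U (Suc n)"
    and fB: "\<And>\<sigma>. (b - simpl_boundary f) \<sigma> \<noteq> 0 \<Longrightarrow> \<sigma> \<subseteq> B" by blast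
  have df: "simpl_boundary f \<in> chains_of U n" using boundary_chains_of[OF fin f] .
  have "b - simpl_boundary f \<in> chains_of (U \<inter> B) n"
    by (rule chains_of_restrict[OF fin diff_chains_of[OF b(1) df] fB])
  moreover have "simpl_boundary (b - simpl_boundary f) = 0"
    unfolding boundary_diff[OF b(1) df] boundary_boundary[OF fin f] using b(2) by simp
  moreover have "b - (b - simpl_boundary f) = simpl_boundary f" by simp
  ultimately show ?thesis using f by blast
qed

lemma acyclic_subposet:
  fixes L B U :: "'a::order set"
  assumes fin: "finite U" and U: "U \<subseteq> L" "\<And>x y. y \<in> U \<Longrightarrow> x \<in> L \<Longrightarrow> x < y \<Longrightarrow> x \<in> U"
    and acyc: "\<And>p. p \<in> L \<Longrightarrow> p \<notin> B \<Longrightarrow> acyclic_poset TYPE('k::field) {x \<in> L. x < p}"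
    and "acyclic_poset TYPE('k) U"
  shows "acyclic_poset TYPE('k) (U \<inter> B)"
  unfolding acyclic_poset_def
proof (intro allI ballI impI)
  fix n and c :: "'a set \<Rightarrow> 'k" assume c: "c \<in> chains_of (U \<inter> B) n" "simpl_boundary c = 0"
  then have "c \<in> chains_of U n" using chains_of_mono[OF fin] by blast
  then obtain e where "e \<in> chains_of U (Suc n)" "c = simpl_boundary e"
    using c(2) assms(5) unfolding acyclic_poset_def by blast
  then show "\<exists>e\<in>chains_of (U \<inter> B) (Suc n). c = simpl_boundary e"
    by (intro boundary_in_subposet[where L = L]) (use assms c(1) in auto)
qed

text \<open>The pigeonhole principle of the development: ranks are distinct along a chain, so
  \<open>m\<close> elements with ranks in \<open>{1..m}\<close> use every rank.\<close>

lemma chain_ranks: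
  fixes r :: "'a::order \<Rightarrow> nat"
  assumes "finite \<sigma>" and "Complete_Partial_Order.chain (\<le>) \<sigma>"
    and "\<And>x y. x \<in> \<sigma> \<Longrightarrow> y \<in> \<sigma> \<Longrightarrow> x < y \<Longrightarrow> r x < r y"
    and "\<And>x. x \<in> \<sigma> \<Longrightarrow> 0 < r x \<and> r x \<le> m"
  shows "card \<sigma> \<le> m" and "card \<sigma> = m \<Longrightarrow> r ` \<sigma> = {1..m}"
proof -
  have inj: "inj_on r \<sigma>"
  proof (rule inj_onI)
    fix x y assume "x \<in> \<sigma>" "y \<in> \<sigma>" "r x = r y"
    moreover then have "x \<le> y \<or> y \<le> x" using assms(2) by (auto simp: chain_def)
    ultimately show "x = y" using assms(3)[of x y] assms(3)[of y x] by (auto simp: order.order_iff_strict)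
  qed
  have sub: "r ` \<sigma> \<subseteq> {1..m}" using assms(4) by force
  show "card \<sigma> \<le> m" using card_mono[OF _ sub] card_image[OF inj] by simp
  show "r ` \<sigma> = {1..m}" if "card \<sigma> = m"
    using card_subset_eq[OF _ sub] card_image[OF inj] that by simp
qed

section \<open>Cell posets and cellular chains\<close>

lemma sum_fun_apply: "(\<Sum>q\<in>A. f q) x = (\<Sum>q\<in>A. f q x)"
  by (induction A rule: infinite_finite_induct) auto

text \<open>The face poset of a complex in which the boundary of the cell \<open>p\<close>, of
  dimension \<open>r p - 1\<close>, has the homology of a sphere, with fundamental cycle
  \<open>z p\<close>. \<open>cycle_multiple\<close> equates chains and not classes, because no chain
  below \<open>p\<close> has \<open>r p\<close> elements and so nothing bounds in that degree.
  \<open>bot\<close> stays outside \<open>Q\<close>: it is the index of rank 0 for the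
  augmentation.\<close>

locale cell_poset =
  fixes bot :: "'a::order" and Q :: "'a set" and r :: "'a \<Rightarrow> nat" and z :: "'a \<Rightarrow> 'a set \<Rightarrow> 'k::field"
  assumes finite_poset: "finite Q"
    and bot: "bot \<notin> Q" "r bot = 0" "\<And>q. q \<in> Q \<Longrightarrow> bot < q"
    and rank_mono: "\<And>p q. p \<in> Q \<Longrightarrow> q \<in> Q \<Longrightarrow> p < q \<Longrightarrow> r p < r q"
    and rank_pos: "\<And>p. p \<in> Q \<Longrightarrow> 0 < r p"
    and fund_cycle: "\<And>p. p \<in> Q \<Longrightarrow> z p \<in> chains_of {x \<in> Q. x < p} (r p - 1)"
      "\<And>p. p \<in> Q \<Longrightarrow> simpl_boundary (z p) = 0" "\<And>p. p \<in> Q \<Longrightarrow> z p \<noteq> 0"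
    and cycle_multiple: "\<And>p c. p \<in> Q \<Longrightarrow> c \<in> chains_of {x \<in> Q. x < p} (r p - 1) \<Longrightarrow>
      simpl_boundary c = 0 \<Longrightarrow> \<exists>a. c = scale_chain a (z p)"
    and other_cycles: "\<And>p n c. p \<in> Q \<Longrightarrow> n \<noteq> r p - 1 \<Longrightarrow> c \<in> chains_of {x \<in> Q. x < p} n \<Longrightarrow>
      simpl_boundary c = (0 :: 'a set \<Rightarrow> 'k) \<Longrightarrow> \<exists>e\<in>chains_of {x \<in> Q. x < p} (Suc n). c = simpl_boundary e"
begin

text \<open>The factor by which the link of \<open>z q\<close> at \<open>p\<close> multiplies
  \<open>z p\<close>; the sign is the one that the Mayer-Vietoris connecting map produces. It is
  meaningful for consecutive ranks. At \<open>bot\<close> the role of \<open>z p\<close> is taken by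
  the empty face, of which \<open>z q\<close> is a multiple when \<open>q\<close> has rank
  1.\<close>

definition incidence :: "'a \<Rightarrow> 'a \<Rightarrow> 'k" where
  "incidence q p = (if p = bot then z q {}
     else SOME a. scale_chain ((- 1) ^ r q) (link_chain p (z q)) = scale_chain a (z p))"

lemma finite_below [simp]: "finite {x \<in> Q. x < p}"
  using finite_poset by simp

lemma scale_fund_cycle_eq: "p \<in> Q \<Longrightarrow> scale_chain a (z p) = scale_chain b (z p) \<Longrightarrow> a = b"
  using fund_cycle(3)[of p] by (metis ext mult_cancel_right zero_fun_apply)

text \<open>With consecutive ranks nothing lies strictly between \<open>p\<close> and
  \<open>q\<close>, so \<open>p\<close> is maximal below \<open>q\<close> and taking links commutes
  with the boundary. The link is then a cycle in the one degree where all cycles below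
  \<open>p\<close> are multiples of \<open>z p\<close>.\<close>

lemma link_fund_cycle:
  assumes "p \<in> Q" "q \<in> Q" "p < q" "r q = Suc (r p)"
  shows "scale_chain ((- 1) ^ r q) (link_chain p (z q)) = scale_chain (incidence q p) (z p)"
proof -
  let ?W = "{x \<in> Q. x < q}"
  have max: "\<not> p < x" if "x \<in> ?W" for x
    using rank_mono[of p x] rank_mono[of x q] that assms by force
  have W: "{x \<in> ?W. x < p} = {x \<in> Q. x < p}" using assms(3) by auto
  have zq: "z q \<in> chains_of ?W (Suc (r p - 1))"
    using fund_cycle(1)[OF assms(2)] rank_pos[OF assms(1)] assms(4) by simp
  have l: "link_chain p (z q) \<in> chains_of {x \<in> Q. x < p} (r p - 1)"
    using link_chains_of[OF _ max zq] W by simp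
  moreover have "simpl_boundary (link_chain p (z q)) = 0"
  proof -
    have "simpl_boundary (link_chain p (z q)) = link_chain p (simpl_boundary (z q))"
      using link_boundary[OF _ max zq] by simp
    also have "\<dots> = 0" using fund_cycle(2)[OF assms(2)] by (auto simp: link_chain_def)
    finally show ?thesis .
  qed
  ultimately obtain a where "link_chain p (z q) = scale_chain a (z p)"
    using cycle_multiple[OF assms(1)] by blast
  then have "scale_chain ((- 1) ^ r q) (link_chain p (z q)) = scale_chain ((- 1) ^ r q * a) (z p)"
    by (simp add: mult.assoc)
  then have ex: "\<exists>a. scale_chain ((- 1) ^ r q) (link_chain p (z q)) = scale_chain a (z p)" by blast
  have "p \<noteq> bot" using assms(1) bot(1) by blast
  show ?thesis unfolding incidence_def if_not_P[OF \<open>p \<noteq> bot\<close>] by (rule someI_ex[OF ex])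
qed

lemma link_fund_cycle_not_below:
  assumes "q \<in> Q" "\<not> p < q"
  shows "link_chain p (z q) = 0"
proof
  fix \<tau>
  have "z q (insert p \<tau>) = 0"
    using fund_cycle(1)[OF assms(1)] assms(2) chains_of_iff[OF finite_below, of "z q" q] by blast
  then show "link_chain p (z q) \<tau> = 0 \<tau>" by (simp add: link_chain_def)
qed

text \<open>The cell \<open>q\<close> is realised as the cone with apex \<open>q\<close> over its
  boundary sphere. This places cellular chains among the simplicial chains of the poset.\<close>

definition cell_chain :: "'a set \<Rightarrow> ('a \<Rightarrow> 'k) \<Rightarrow> 'a set \<Rightarrow> 'k" where
  "cell_chain A x = (\<Sum>q\<in>A. scale_chain (x q) (join_chain (z q) q))"

text \<open>The cellular boundary on coefficients; \<open>i\<close> is the rank of the source cells.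
  Only the values of \<open>x\<close> at elements of \<open>D\<close> of that rank enter.\<close>

definition incidence_map :: "'a set \<Rightarrow> nat \<Rightarrow> ('a \<Rightarrow> 'k) \<Rightarrow> 'a \<Rightarrow> 'k" where
  "incidence_map D i x p = (\<Sum>q | q \<in> D \<and> r q = i \<and> p < q. x q * incidence q p)"

end

text \<open>A subcomplex: lower intervals of elements of \<open>D\<close> are the same in
  \<open>D\<close> as in \<open>Q\<close>, so the fundamental cycles restrict. Later
  \<open>D\<close> consists of the elements dividing a fixed multidegree.\<close>

locale lower_set = cell_poset bot Q r z
  for bot :: "'a::order" and Q r and z :: "'a \<Rightarrow> 'a set \<Rightarrow> 'k::field" +
  fixes D :: "'a set"
  assumes lower_subset: "D \<subseteq> Q" and lower: "\<And>x y. y \<in> D \<Longrightarrow> x \<in> Q \<Longrightarrow> x < y \<Longrightarrow> x \<in> D"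
begin

lemma finite_lower [simp]: "finite D"
  using lower_subset finite_poset finite_subset by blast

lemma below_lower: "q \<in> D \<Longrightarrow> {x \<in> D. x < q} = {x \<in> Q. x < q}"
  using lower_subset lower by auto

abbreviation level :: "nat \<Rightarrow> 'a set" where
  "level i \<equiv> {q \<in> D. r q = i}"

lemma finite_sublevel: "finite {q \<in> D. r q \<le> i}"
  by simp

lemma join_fund_cycle:
  assumes "q \<in> D" "r q = i" "i \<noteq> 0"
  shows "join_chain (z q) q \<in> chains_of {x \<in> D. r x \<le> i} i"
proof -
  have "{x \<in> {x \<in> D. r x \<le> i}. x < q} = {x \<in> Q. x < q}"
    using below_lower[OF assms(1)] rank_mono[of _ q] lower_subset assms by force
  then have "z q \<in> chains_of {x \<in> {x \<in> D. r x \<le> i}. x < q} (i - 1)"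
    using fund_cycle(1)[of q] assms lower_subset by auto
  from join_chains_of[OF _ _ this] show ?thesis using assms by simp
qed

lemma cell_chain_chains_of:
  assumes "i \<noteq> 0"
  shows "cell_chain (level i) x \<in> chains_of {x \<in> D. r x \<le> i} i"
  unfolding cell_chain_def
  by (intro sum_chains_of scale_chains_of join_fund_cycle) (use assms in auto)

text \<open>Distinct elements of equal rank are incomparable, so among the cones only the one with
  apex \<open>p\<close> has faces through \<open>p\<close>. Links thus recover the coefficients of a
  cellular chain.\<close>

lemma link_cell_chain:
  assumes "p \<in> level i"
  shows "link_chain p (cell_chain (level i) x) = scale_chain (x p) (z p)"
proof -
  have ne: "link_chain p (join_chain (z q) q) = 0" if "q \<in> level i" "q \<noteq> p" for q
  proof
    fix \<tau>
    have "z q (insert p \<tau> - {q}) = 0"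
    proof (rule ccontr)
      assume "z q (insert p \<tau> - {q}) \<noteq> 0"
      then have "insert p \<tau> - {q} \<subseteq> {x \<in> Q. x < q}"
        using fund_cycle(1)[of q] lower_subset that(1) chains_of_iff[OF finite_below, of "z q" q] by blast
      then have "p < q" "p \<in> Q" using that(2) by auto
      then show False using rank_mono[of p q] that(1) assms lower_subset by auto
    qed
    then show "link_chain p (join_chain (z q) q) \<tau> = 0 \<tau>"
      by (simp add: link_chain_def join_chain_def)
  qed
  have "link_chain p (cell_chain (level i) x) = (\<Sum>q\<in>level i. scale_chain (x q) (link_chain p (join_chain (z q) q)))"
    unfolding cell_chain_def link_chain_sum link_chain_scale ..
  also have "\<dots> = (\<Sum>q\<in>{p}. scale_chain (x q) (link_chain p (join_chain (z q) q)))"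
    by (rule sum.mono_neutral_right) (use assms ne in auto)
  also have "\<dots> = scale_chain (x p) (z p)"
    using link_join_below[OF finite_poset fund_cycle(1)[of p]] assms lower_subset by auto
  finally show ?thesis .
qed

lemma top_rank:
  assumes "c \<in> chains_of {x \<in> D. r x \<le> i} i" "i \<noteq> 0" "c \<sigma> \<noteq> 0"
  shows "\<exists>p\<in>\<sigma>. p \<in> level i"
proof -
  have \<sigma>: "\<sigma> \<subseteq> {x \<in> D. r x \<le> i}" "Complete_Partial_Order.chain (\<le>) \<sigma>" "card \<sigma> = i"
    using chains_ofD[OF finite_sublevel assms(1,3)] by auto
  moreover have "finite \<sigma>" by (rule finite_subset[OF \<sigma>(1) finite_sublevel])
  moreover have "r x < r y" if "x \<in> \<sigma>" "y \<in> \<sigma>" "x < y" for x y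
    using that \<sigma>(1) lower_subset by (intro rank_mono) auto
  moreover have "0 < r x \<and> r x \<le> i" if "x \<in> \<sigma>" for x
    using that \<sigma>(1) lower_subset rank_pos by auto
  ultimately have "r ` \<sigma> = {1..i}" by (intro chain_ranks(2))
  then have "i \<in> r ` \<sigma>" using assms(2) by auto
  then show ?thesis using \<sigma>(1) by auto
qed

text \<open>The recognition principle for cellular chains: by \<open>top_rank\<close> every face of
  an \<open>i\<close>-vertex chain on ranks up to \<open>i\<close> passes through rank
  \<open>i\<close>, so such a chain is determined by its links there.\<close>

lemma eq_cell_chain:
  assumes c: "c \<in> chains_of {x \<in> D. r x \<le> i} i" and i: "i \<noteq> 0"
    and l: "\<And>p. p \<in> level i \<Longrightarrow> link_chain p c = scale_chain (x p) (z p)"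
  shows "c = cell_chain (level i) x"
proof
  fix \<sigma>
  define d where "d = c - cell_chain (level i) x"
  have d: "d \<in> chains_of {x \<in> D. r x \<le> i} i"
    unfolding d_def by (rule diff_chains_of[OF c cell_chain_chains_of[OF i]])
  have "d \<sigma> = 0"
  proof (rule ccontr)
    assume "d \<sigma> \<noteq> 0"
    then obtain p where p: "p \<in> \<sigma>" "p \<in> level i" using top_rank[OF d i] by blast
    have "link_chain p d = 0" unfolding d_def link_chain_diff l[OF p(2)] link_cell_chain[OF p(2)] by simp
    then have "link_chain p d (\<sigma> - {p}) = 0" by simp
    then show False using \<open>d \<sigma> \<noteq> 0\<close> p(1) by (simp add: link_chain_def insert_absorb)
  qed
  then show "c \<sigma> = cell_chain (level i) x \<sigma>" by (simp add: d_def)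
qed

text \<open>The base of each cone is a cycle, so only the deletion of the apex survives; it is the
  last vertex after \<open>i\<close> others.\<close>

lemma boundary_cell_chain:
  "simpl_boundary (cell_chain (level (Suc i)) x) =
    (\<Sum>q\<in>level (Suc i). scale_chain (x q * (- 1) ^ i) (z q))"
proof -
  have "simpl_boundary (join_chain (z q) q) = scale_chain ((- 1) ^ i) (z q)" if "q \<in> level (Suc i)" for q
  proof -
    have q: "q \<in> Q" "r q - 1 = i" using that lower_subset by auto
    have "simpl_boundary (join_chain (z q) q) = join_chain (simpl_boundary (z q)) q + scale_chain ((- 1) ^ i) (z q)"
      using boundary_join[OF finite_poset q(1) fund_cycle(1)[OF q(1)]] q(2) by simp
    then show ?thesis unfolding fund_cycle(2)[OF q(1)] by (auto simp: join_chain_def)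
  qed
  then show ?thesis
    unfolding cell_chain_def
    by (subst boundary_sum[of _ _ "{x \<in> D. r x \<le> Suc i}" "Suc i"])
      (auto simp: simpl_boundary_scale mult.assoc intro!: scale_chains_of join_fund_cycle sum.cong)
qed

text \<open>The minus sign compares two conventions: deleting the apex gives
  \<open>(- 1) ^ i\<close>, while \<open>incidence\<close> was normalised with
  \<open>(- 1) ^ r q\<close> for \<open>r q = Suc i\<close>.\<close>

lemma link_boundary_cell_chain:
  assumes p: "p \<in> level i" and i: "i \<noteq> 0"
  shows "link_chain p (simpl_boundary (cell_chain (level (Suc i)) x)) =
    scale_chain (- incidence_map D (Suc i) x p) (z p)"
proof -
  have pQ: "p \<in> Q" using p lower_subset by auto
  have "link_chain p (simpl_boundary (cell_chain (level (Suc i)) x)) =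
    (\<Sum>q\<in>level (Suc i). scale_chain (x q * (- 1) ^ i) (link_chain p (z q)))"
    unfolding boundary_cell_chain link_chain_sum link_chain_scale ..
  also have "\<dots> = (\<Sum>q | q \<in> D \<and> r q = Suc i \<and> p < q. scale_chain (x q * (- 1) ^ i) (link_chain p (z q)))"
  proof (rule sum.mono_neutral_right)
    show "\<forall>q\<in>level (Suc i) - {q \<in> D. r q = Suc i \<and> p < q}.
        scale_chain (x q * (- 1) ^ i) (link_chain p (z q)) = 0"
    proof
      fix q assume "q \<in> level (Suc i) - {q \<in> D. r q = Suc i \<and> p < q}"
      then have "link_chain p (z q) = 0"
        using link_fund_cycle_not_below[of q p] lower_subset by auto
      then show "scale_chain (x q * (- 1) ^ i) (link_chain p (z q)) = 0" by auto
    qed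
  qed auto
  also have "\<dots> = (\<Sum>q | q \<in> D \<and> r q = Suc i \<and> p < q. scale_chain (- (x q * incidence q p)) (z p))"
  proof (rule sum.cong[OF refl])
    fix q assume q: "q \<in> {q \<in> D. r q = Suc i \<and> p < q}"
    then have l: "scale_chain ((- 1) ^ r q) (link_chain p (z q)) = scale_chain (incidence q p) (z p)"
      using link_fund_cycle[of p q] p lower_subset by auto
    show "scale_chain (x q * (- 1) ^ i) (link_chain p (z q)) = scale_chain (- (x q * incidence q p)) (z p)"
    proof
      fix \<tau>
      have "x q * (- 1) ^ i * link_chain p (z q) \<tau> = - x q * ((- 1) ^ r q * link_chain p (z q) \<tau>)"
        using q by simp
      also have "\<dots> = - x q * (incidence q p * z p \<tau>)" using fun_cong[OF l, of \<tau>] by simp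
      finally show "x q * (- 1) ^ i * link_chain p (z q) \<tau> = - (x q * incidence q p) * z p \<tau>" by simp
    qed
  qed
  also have "\<dots> = scale_chain (- incidence_map D (Suc i) x p) (z p)"
  proof -
    have "(\<Sum>q\<in>A. scale_chain (f q) (z p)) = scale_chain (\<Sum>q\<in>A. f q) (z p)" for A and f :: "'a \<Rightarrow> 'k"
    proof (induction A rule: infinite_finite_induct)
      case (insert q A)
      then show ?case by (auto simp: algebra_simps)
    qed auto
    then show ?thesis by (simp only: incidence_map_def sum_negf)
  qed
  finally show ?thesis .
qed

text \<open>Up to sign \<open>incidence_map\<close> is the simplicial boundary restricted to
  cellular chains, which turns its exactness into a question about simplicial fillings. Rank 0 has
  no cells in \<open>Q\<close> and is treated at the empty face instead.\<close>

lemma boundary_cell_chain_eq: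
  assumes i: "i \<noteq> 0"
  shows "simpl_boundary (cell_chain (level (Suc i)) x) =
    cell_chain (level i) (\<lambda>p. - incidence_map D (Suc i) x p)"
proof (rule eq_cell_chain[OF _ i])
  show "simpl_boundary (cell_chain (level (Suc i)) x) \<in> chains_of {x \<in> D. r x \<le> i} i"
    unfolding boundary_cell_chain
  proof (intro sum_chains_of scale_chains_of)
    fix q assume q: "q \<in> level (Suc i)"
    then have "z q \<in> chains_of {x \<in> Q. x < q} i" using fund_cycle(1)[of q] lower_subset by auto
    moreover have "{x \<in> Q. x < q} \<subseteq> {x \<in> D. r x \<le> i}"
      using q lower[of q] rank_mono[of _ q] lower_subset by force
    ultimately show "z q \<in> chains_of {x \<in> D. r x \<le> i} i" using chains_of_mono[OF finite_sublevel] by blast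
  qed
qed (rule link_boundary_cell_chain[OF _ i])

lemma cell_chain_eq_0:
  assumes "cell_chain (level i) x = 0" "p \<in> level i"
  shows "x p = 0"
proof -
  have "scale_chain (x p) (z p) = 0"
    unfolding link_cell_chain[OF assms(2), symmetric] assms(1) by (auto simp: link_chain_def)
  then have "scale_chain (x p) (z p) = scale_chain 0 (z p)" by auto
  then show ?thesis using scale_fund_cycle_eq assms(2) lower_subset by blast
qed

text \<open>The augmentation: a boundary of vertices is supported on the empty face. No sign
  appears, since \<open>incidence\<close> at \<open>bot\<close> carries none.\<close>

lemma boundary_cell_chain_1:
  "simpl_boundary (cell_chain (level 1) x) {} = incidence_map D 1 x bot"
proof -
  have "{q \<in> D. r q = Suc 0 \<and> bot < q} = level (Suc 0)" using lower_subset bot by auto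
  then show ?thesis
    using boundary_cell_chain[of 0 x] by (simp add: incidence_map_def incidence_def sum_fun_apply)
qed


text \<open>Cells of rank above \<open>i + 1\<close> can be avoided when filling an \<open>i\<close>-element cycle, since the spheres
  to which they are attached have no homology in that degree.\<close>

lemma boundary_in_skeleton:
  fixes e :: "'a set \<Rightarrow> 'k"
  assumes "U \<subseteq> D" "\<And>x y. y \<in> U \<Longrightarrow> x \<in> Q \<Longrightarrow> x < y \<Longrightarrow> x \<in> U"
    and "e \<in> chains_of U (Suc i)" "simpl_boundary e \<in> chains_of {x \<in> D. r x \<le> i} i"
  shows "\<exists>e'\<in>chains_of {x \<in> D. r x \<le> Suc i} (Suc i). simpl_boundary e' = simpl_boundary e"
  using finite_subset[OF assms(1) finite_lower] assms
proof (induction U arbitrary: e rule: finite_psubset_induct)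
  case (psubset U)
  note fin = \<open>finite U\<close>
  show ?case
  proof (cases "\<exists>x\<in>U. Suc i < r x")
    case False
    then have "U \<subseteq> {x \<in> D. r x \<le> Suc i}" using psubset.prems(1) by force
    then show ?thesis using psubset.prems(3) chains_of_mono[OF finite_sublevel] by blast
  next
    case True
    then obtain x where x: "x \<in> U" "Suc i < r x" by blast
    obtain p where p: "p \<in> U" "x \<le> p" and m: "\<And>y. y \<in> U \<Longrightarrow> p \<le> y \<Longrightarrow> p = y"
      using finite_has_maximal2[OF fin x(1)] by blast
    have max: "\<not> p < y" if "y \<in> U" for y using m[OF that] by (auto simp: less_le)
    have UQ: "U \<subseteq> Q" using psubset.prems(1) lower_subset by blast
    have rp: "Suc i < r p"
    proof (cases "x = p")
      case False
      then have "r x < r p" using p x(1) UQ by (intro rank_mono) auto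
      then show ?thesis using x(2) by simp
    qed (use x(2) in simp)
    have W: "{y \<in> U. y < p} = {y \<in> Q. y < p}" using psubset.prems(2) p(1) UQ by blast
    have l: "link_chain p e \<in> chains_of {y \<in> Q. y < p} i"
      using link_chains_of[OF fin max psubset.prems(3)] W by simp
    \<comment> \<open>The boundary lives in ranks up to \<open>i\<close>, so none of its faces
      contains \<open>p\<close>, and the link of \<open>e\<close> at \<open>p\<close> is a
      cycle.\<close>
    have "link_chain p (simpl_boundary e) = 0"
    proof
      fix \<tau>
      have "simpl_boundary e (insert p \<tau>) = 0"
        using chains_ofD(1)[OF finite_sublevel psubset.prems(4), of "insert p \<tau>"] rp by auto
      then show "link_chain p (simpl_boundary e) \<tau> = 0 \<tau>" by (simp add: link_chain_def)
    qed
    then have "simpl_boundary (link_chain p e) = 0"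
      using link_boundary[OF fin max psubset.prems(3)] by simp
    \<comment> \<open>As \<open>r p\<close> exceeds \<open>i + 1\<close>, this cycle is not in the
      top degree of the sphere below \<open>p\<close> and therefore bounds.\<close>
    then obtain w where w: "w \<in> chains_of {y \<in> Q. y < p} (Suc i)" "link_chain p e = simpl_boundary w"
    proof -
      have "p \<in> Q" "i \<noteq> r p - 1" using p(1) UQ rp by auto
      from other_cycles[OF this l \<open>simpl_boundary (link_chain p e) = 0\<close>] show ?thesis using that by blast
    qed
    have j: "join_chain w p \<in> chains_of U (Suc (Suc i))"
      using join_chains_of[OF fin p(1)] w(1) W by simp
    have dj: "simpl_boundary (join_chain w p) \<in> chains_of U (Suc i)"
      by (rule boundary_chains_of[OF fin j])
    define e1 where "e1 = e - simpl_boundary (join_chain w p)"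
    have "e1 \<in> chains_of U (Suc i)"
      unfolding e1_def by (rule diff_chains_of[OF psubset.prems(3) dj])
    moreover have "link_chain p e1 = 0"
      unfolding e1_def link_chain_diff
      using link_boundary_join[OF fin p(1) max, of w "Suc i"] w W by simp
    ultimately have e1: "e1 \<in> chains_of (U - {p}) (Suc i)" using chains_of_remove[OF fin] by blast
    have de1: "simpl_boundary e1 = simpl_boundary e"
      unfolding e1_def boundary_diff[OF psubset.prems(3) dj] boundary_boundary[OF fin j] by simp
    have "\<exists>e'\<in>chains_of {x \<in> D. r x \<le> Suc i} (Suc i). simpl_boundary e' = simpl_boundary e1"
    proof (rule psubset.IH[of "U - {p}" e1])
      show "x \<in> U - {p}" if "y \<in> U - {p}" "x \<in> Q" "x < y" for x y
        using that psubset.prems(2)[of y x] max[of y] by auto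
      show "simpl_boundary e1 \<in> chains_of {x \<in> D. r x \<le> i} i"
        unfolding de1 by (rule psubset.prems(4))
    qed (use p(1) psubset.prems(1) e1 in auto)
    then show ?thesis using de1 by simp
  qed
qed

text \<open>Inherited from the simplicial boundary, because \<open>cell_chain\<close> is injective
  on coefficients; the lowest case is read at the empty face.\<close>

lemma incidence_map_incidence_map:
  assumes p: "p \<in> insert bot D" "r p = i"
  shows "incidence_map D (Suc i) (incidence_map D (Suc (Suc i)) x) p = 0"
proof -
  let ?c = "cell_chain (level (Suc (Suc i))) x"
  let ?y = "\<lambda>p. - incidence_map D (Suc (Suc i)) x p"
  have "?c \<in> chains_of {x \<in> D. r x \<le> Suc (Suc i)} (Suc (Suc i))" by (rule cell_chain_chains_of) simp
  then have dd: "simpl_boundary (simpl_boundary ?c) = 0" using boundary_boundary[OF finite_sublevel] by blast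
  have dc: "simpl_boundary ?c = cell_chain (level (Suc i)) ?y" by (rule boundary_cell_chain_eq) simp
  have "incidence_map D (Suc i) ?y p = 0"
  proof (cases "i = 0")
    case True
    then have "p = bot" using p rank_pos lower_subset by force
    then show ?thesis using boundary_cell_chain_1[of ?y] dd dc True by simp
  next
    case False
    then have "p \<in> D" using p bot by auto
    moreover have "cell_chain (level i) (\<lambda>p. - incidence_map D (Suc i) ?y p) = 0"
      using boundary_cell_chain_eq[OF False, of ?y] dd dc by simp
    ultimately show ?thesis using cell_chain_eq_0[of i _ p] p(2) by fastforce
  qed
  then show ?thesis by (simp add: incidence_map_def sum_negf)
qed

text \<open>A cellular cycle is a simplicial cycle and has a simplicial filling. Once the filling is
  pushed into ranks up to \<open>i + 2\<close>, its links at elements of top rank are cycles, hence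
  multiples of fundamental cycles, and \<open>eq_cell_chain\<close> shows that the filling is itself
  cellular.\<close>

lemma incidence_map_exact:
  assumes acyc: "acyclic_poset TYPE('k) D"
    and ker: "\<And>p. p \<in> insert bot D \<Longrightarrow> r p = i \<Longrightarrow> incidence_map D (Suc i) x p = 0"
  shows "\<exists>y. \<forall>p\<in>level (Suc i). incidence_map D (Suc (Suc i)) y p = x p"
proof -
  let ?c = "cell_chain (level (Suc i)) x"
  have c: "?c \<in> chains_of {x \<in> D. r x \<le> Suc i} (Suc i)" by (rule cell_chain_chains_of) simp
  have cD: "?c \<in> chains_of D (Suc i)" by (rule chains_of_mono[OF _ _ c]) auto
  have "simpl_boundary ?c = 0"
  proof (cases "i = 0")
    case True
    have "simpl_boundary ?c \<in> chains_of D 0" using boundary_chains_of[OF _ cD] True by simp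
    then have "simpl_boundary ?c \<sigma> = 0" if "\<sigma> \<noteq> {}" for \<sigma>
      using chains_of_0_support[OF finite_lower, of "simpl_boundary ?c" \<sigma>] that by blast
    moreover have "simpl_boundary ?c {} = 0"
      using boundary_cell_chain_1[of x] ker[of bot] bot True by simp
    ultimately have "simpl_boundary ?c \<sigma> = 0" for \<sigma> by (cases "\<sigma> = {}") auto
    then show ?thesis by auto
  next
    case False
    then have "simpl_boundary ?c = cell_chain (level i) (\<lambda>p. - incidence_map D (Suc i) x p)"
      by (rule boundary_cell_chain_eq)
    also have "\<dots> = 0" unfolding cell_chain_def by (rule sum.neutral) (use ker in auto)
    finally show ?thesis .
  qed
  then obtain e0 where e0: "e0 \<in> chains_of D (Suc (Suc i))" "?c = simpl_boundary e0"
    using acyc cD unfolding acyclic_poset_def by blast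
  have "\<exists>e\<in>chains_of {x \<in> D. r x \<le> Suc (Suc i)} (Suc (Suc i)). simpl_boundary e = simpl_boundary e0"
    by (rule boundary_in_skeleton[OF subset_refl lower e0(1)]) (use c e0(2) in auto)
  then obtain e where e: "e \<in> chains_of {x \<in> D. r x \<le> Suc (Suc i)} (Suc (Suc i))" "simpl_boundary e = ?c"
    using e0(2) by auto
  have "\<exists>a. link_chain q e = scale_chain a (z q)" if q: "q \<in> level (Suc (Suc i))" for q
  proof (rule cycle_multiple)
    let ?S = "{x \<in> D. r x \<le> Suc (Suc i)}"
    show "q \<in> Q" using q lower_subset by auto
    have max: "\<not> q < y" if "y \<in> ?S" for y
      using that q rank_mono[of q y] lower_subset by auto
    have "{y \<in> ?S. y < q} = {y \<in> Q. y < q}"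
      using q lower[of q] rank_mono[of _ q] lower_subset by force
    then show "link_chain q e \<in> chains_of {x \<in> Q. x < q} (r q - 1)"
      using link_chains_of[OF finite_sublevel max e(1)] q by simp
    \<comment> \<open>The filled cycle has ranks up to \<open>i + 1\<close> only, so no face of it
      passes through \<open>q\<close>.\<close>
    have "simpl_boundary (link_chain q e) = link_chain q ?c"
      using link_boundary[OF finite_sublevel max e(1)] e(2) by simp
    also have "\<dots> = 0"
    proof
      fix \<tau>
      have "?c (insert q \<tau>) = 0"
        using chains_ofD(1)[OF finite_sublevel c, of "insert q \<tau>"] q by auto
      then show "link_chain q ?c \<tau> = 0 \<tau>" by (simp add: link_chain_def)
    qed
    finally show "simpl_boundary (link_chain q e) = 0" .
  qed
  then obtain y where y: "\<And>q. q \<in> level (Suc (Suc i)) \<Longrightarrow> link_chain q e = scale_chain (y q) (z q)"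
    by metis
  have "e = cell_chain (level (Suc (Suc i))) y" by (rule eq_cell_chain[OF e(1) _ y]) auto
  then have eq: "?c = cell_chain (level (Suc i)) (\<lambda>p. - incidence_map D (Suc (Suc i)) y p)"
    using e(2) boundary_cell_chain_eq[of "Suc i" y] by simp
  have "x p = - incidence_map D (Suc (Suc i)) y p" if p: "p \<in> level (Suc i)" for p
  proof (rule scale_fund_cycle_eq)
    show "p \<in> Q" using p lower_subset by auto
    show "scale_chain (x p) (z p) = scale_chain (- incidence_map D (Suc (Suc i)) y p) (z p)"
      using link_cell_chain[OF p, of x] unfolding eq link_cell_chain[OF p] by simp
  qed
  \<comment> \<open>Negating the coefficients absorbs the sign from
    \<open>boundary_cell_chain_eq\<close>.\<close>
  then have "\<forall>p\<in>level (Suc i). incidence_map D (Suc (Suc i)) (\<lambda>q. - y q) p = x p"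
    by (simp add: incidence_map_def sum_negf)
  then show ?thesis by blast
qed

end

section \<open>Reduced homology as a vector space\<close>

lemma cring_class_ring: "cring (class_ring :: 'a::comm_ring_1 ring)"
proof (intro cringI abelian_groupI comm_monoidI)
  fix x :: 'a
  show "\<exists>y\<in>carrier class_ring. y \<oplus>\<^bsub>class_ring\<^esub> x = \<zero>\<^bsub>class_ring\<^esub>"
    by (intro bexI[of _ "- x"]) auto
qed (auto simp: algebra_simps)

text \<open>The axioms are equations together with the existence of negatives, so they pass along
  any surjection that respects the operations. This spares checking them directly on cosets and on
  tensor modules.\<close>

lemma module_image:
  fixes A :: "('r, 'a, 'm) module_scheme" and B :: "('r, 'b, 'n) module_scheme"
  assumes A: "module R A" and surj: "h ` carrier A = carrier B"
    and add: "\<And>x y. x \<in> carrier A \<Longrightarrow> y \<in> carrier A \<Longrightarrow> h (x \<oplus>\<^bsub>A\<^esub> y) = h x \<oplus>\<^bsub>B\<^esub> h y"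
    and smult: "\<And>a x. a \<in> carrier R \<Longrightarrow> x \<in> carrier A \<Longrightarrow> h (a \<odot>\<^bsub>A\<^esub> x) = a \<odot>\<^bsub>B\<^esub> h x"
    and zero: "h \<zero>\<^bsub>A\<^esub> = \<zero>\<^bsub>B\<^esub>"
  shows "module R B"
proof -
  interpret A: Module.module R A by (rule A)
  have pre: "\<exists>y\<in>carrier A. x = h y" if "x \<in> carrier B" for x using that surj by auto
  have cl: "h x \<in> carrier B" if "x \<in> carrier A" for x using that surj by auto
  show ?thesis
  proof (rule moduleI)
    show "cring R" by (rule A.R.cring_axioms)
    show "abelian_group B"
    proof (rule abelian_groupI)
      show "x \<oplus>\<^bsub>B\<^esub> y \<in> carrier B" if "x \<in> carrier B" "y \<in> carrier B" for x y
        using pre[OF that(1)] pre[OF that(2)] by (auto simp flip: add intro!: cl)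
      show "\<zero>\<^bsub>B\<^esub> \<in> carrier B" using cl[of "\<zero>\<^bsub>A\<^esub>"] zero by simp
      show "(x \<oplus>\<^bsub>B\<^esub> y) \<oplus>\<^bsub>B\<^esub> w = x \<oplus>\<^bsub>B\<^esub> (y \<oplus>\<^bsub>B\<^esub> w)"
        if "x \<in> carrier B" "y \<in> carrier B" "w \<in> carrier B" for x y w
        using pre[OF that(1)] pre[OF that(2)] pre[OF that(3)] by (auto simp: A.a_assoc simp flip: add)
      show "x \<oplus>\<^bsub>B\<^esub> y = y \<oplus>\<^bsub>B\<^esub> x" if "x \<in> carrier B" "y \<in> carrier B" for x y
        using pre[OF that(1)] pre[OF that(2)] by (auto simp: A.a_comm simp flip: add)
      show "\<zero>\<^bsub>B\<^esub> \<oplus>\<^bsub>B\<^esub> x = x" if "x \<in> carrier B" for x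
        using pre[OF that] by (auto simp flip: add zero)
      show "\<exists>y\<in>carrier B. y \<oplus>\<^bsub>B\<^esub> x = \<zero>\<^bsub>B\<^esub>" if x: "x \<in> carrier B" for x
      proof -
        obtain y where y: "y \<in> carrier A" "x = h y" using pre[OF x] by blast
        have "h (\<ominus>\<^bsub>A\<^esub> y) \<oplus>\<^bsub>B\<^esub> x = \<zero>\<^bsub>B\<^esub>"
          using y add[of "\<ominus>\<^bsub>A\<^esub> y" y] zero by (simp add: A.l_neg)
        then show ?thesis using cl[of "\<ominus>\<^bsub>A\<^esub> y"] y by auto
      qed
    qed
    show "a \<odot>\<^bsub>B\<^esub> x \<in> carrier B" if "a \<in> carrier R" "x \<in> carrier B" for a x
      using pre[OF that(2)] that(1) by (auto simp flip: smult intro!: cl)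
    show "(a \<oplus>\<^bsub>R\<^esub> b) \<odot>\<^bsub>B\<^esub> x = (a \<odot>\<^bsub>B\<^esub> x) \<oplus>\<^bsub>B\<^esub> (b \<odot>\<^bsub>B\<^esub> x)"
      if "a \<in> carrier R" "b \<in> carrier R" "x \<in> carrier B" for a b x
      using pre[OF that(3)] that(1,2) by (auto simp: A.smult_l_distr simp flip: smult add)
    show "a \<odot>\<^bsub>B\<^esub> (x \<oplus>\<^bsub>B\<^esub> y) = (a \<odot>\<^bsub>B\<^esub> x) \<oplus>\<^bsub>B\<^esub> (a \<odot>\<^bsub>B\<^esub> y)"
      if "a \<in> carrier R" "x \<in> carrier B" "y \<in> carrier B" for a x y
      using pre[OF that(2)] pre[OF that(3)] that(1) by (auto simp: A.smult_r_distr simp flip: smult add)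
    show "(a \<otimes>\<^bsub>R\<^esub> b) \<odot>\<^bsub>B\<^esub> x = a \<odot>\<^bsub>B\<^esub> (b \<odot>\<^bsub>B\<^esub> x)"
      if "a \<in> carrier R" "b \<in> carrier R" "x \<in> carrier B" for a b x
      using pre[OF that(3)] that(1,2) by (auto simp: A.smult_assoc1 simp flip: smult)
    show "\<one>\<^bsub>R\<^esub> \<odot>\<^bsub>B\<^esub> x = x" if "x \<in> carrier B" for x
      using pre[OF that] by (auto simp flip: smult)
  qed
qed

section \<open>Cosets and quotient modules\<close>

lemma a_r_coset_plus:
  fixes x :: "'b::ab_group_add"
  assumes "add N = (+)"
  shows "K +>\<^bsub>N\<^esub> x = (\<lambda>k. k + x) ` K"
  unfolding a_r_coset_def' using assms by auto

lemma carrier_quot_module: "carrier (quot_module N K) = (\<lambda>x. K +>\<^bsub>N\<^esub> x) ` carrier N"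
  by (auto simp: quot_module_def A_RCOSETS_def')

lemma a_r_coset_eq_iff:
  fixes x y :: "'b::ab_group_add"
  assumes N: "add N = (+)" and K: "0 \<in> K" "\<And>a b. a \<in> K \<Longrightarrow> b \<in> K \<Longrightarrow> a - b \<in> K"
  shows "K +>\<^bsub>N\<^esub> x = K +>\<^bsub>N\<^esub> y \<longleftrightarrow> x - y \<in> K"
proof
  assume "K +>\<^bsub>N\<^esub> x = K +>\<^bsub>N\<^esub> y"
  then have "x \<in> (\<lambda>k. k + y) ` K" unfolding a_r_coset_plus[OF N] using K(1) by force
  then show "x - y \<in> K" by auto
next
  assume xy: "x - y \<in> K"
  have yx: "y - x \<in> K" using K(2)[OF K(1) xy] by simp
  have "k + x \<in> (\<lambda>k. k + y) ` K" if "k \<in> K" for k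
    by (rule image_eqI[of _ _ "k - (y - x)"]) (use K(2)[OF that yx] in auto)
  moreover have "k + y \<in> (\<lambda>k. k + x) ` K" if "k \<in> K" for k
    by (rule image_eqI[of _ _ "k - (x - y)"]) (use K(2)[OF that xy] in auto)
  ultimately show "K +>\<^bsub>N\<^esub> x = K +>\<^bsub>N\<^esub> y" unfolding a_r_coset_plus[OF N] by auto
qed

lemma quot_module_add:
  fixes x y :: "'b::ab_group_add"
  assumes N: "add N = (+)" and K: "0 \<in> K" "\<And>a b. a \<in> K \<Longrightarrow> b \<in> K \<Longrightarrow> a + b \<in> K"
  shows "(K +>\<^bsub>N\<^esub> x) \<oplus>\<^bsub>quot_module N K\<^esub> (K +>\<^bsub>N\<^esub> y) = K +>\<^bsub>N\<^esub> (x + y)"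
proof -
  have "(K +>\<^bsub>N\<^esub> x) <+>\<^bsub>N\<^esub> (K +>\<^bsub>N\<^esub> y) = K +>\<^bsub>N\<^esub> (x + y)"
    unfolding set_add_def' a_r_coset_plus[OF N] N
  proof safe
    fix a b assume "a \<in> K" "b \<in> K"
    then show "a + x + (b + y) \<in> (\<lambda>k. k + (x + y)) ` K"
      by (intro image_eqI[of _ _ "a + b"]) (auto simp: K algebra_simps)
  next
    fix k assume "k \<in> K"
    then show "k + (x + y) \<in> (\<Union>h\<in>(\<lambda>k. k + x) ` K. \<Union>k\<in>(\<lambda>k. k + y) ` K. {h + k})"
      using K(1) by (intro UN_I[of "k + x"] UN_I[of "0 + y"]) (auto simp: algebra_simps)
  qed
  then show ?thesis by (simp add: quot_module_def)
qed

text \<open>Multiplying a coset pointwise by 0 collapses it to a point; this is why the definition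
  adds \<open>K\<close> back. Since \<open>K\<close> is closed under addition and scalars, the
  result is always a full coset.\<close>

lemma quot_module_smult:
  fixes x :: "'b::ab_group_add"
  assumes N: "add N = (+)" and K: "0 \<in> K" "\<And>a b. a \<in> K \<Longrightarrow> b \<in> K \<Longrightarrow> a + b \<in> K"
    "\<And>k. k \<in> K \<Longrightarrow> a \<odot>\<^bsub>N\<^esub> k \<in> K" "a \<odot>\<^bsub>N\<^esub> 0 = 0"
    and distrib: "\<And>k. k \<in> K \<Longrightarrow> a \<odot>\<^bsub>N\<^esub> (k + x) = (a \<odot>\<^bsub>N\<^esub> k) + (a \<odot>\<^bsub>N\<^esub> x)"
  shows "a \<odot>\<^bsub>quot_module N K\<^esub> (K +>\<^bsub>N\<^esub> x) = K +>\<^bsub>N\<^esub> (a \<odot>\<^bsub>N\<^esub> x)"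
proof -
  have "K <+>\<^bsub>N\<^esub> (\<lambda>y. a \<odot>\<^bsub>N\<^esub> y) ` (K +>\<^bsub>N\<^esub> x) = K +>\<^bsub>N\<^esub> (a \<odot>\<^bsub>N\<^esub> x)"
    unfolding set_add_def' a_r_coset_plus[OF N] N
  proof safe
    fix h k assume "h \<in> K" "k \<in> K"
    then show "h + a \<odot>\<^bsub>N\<^esub> (k + x) \<in> (\<lambda>k. k + (a \<odot>\<^bsub>N\<^esub> x)) ` K"
      by (intro image_eqI[of _ _ "h + a \<odot>\<^bsub>N\<^esub> k"]) (auto simp: K distrib algebra_simps)
  next
    fix k assume "k \<in> K"
    then show "k + a \<odot>\<^bsub>N\<^esub> x \<in> (\<Union>h\<in>K. \<Union>k\<in>(\<lambda>y. a \<odot>\<^bsub>N\<^esub> y) ` (\<lambda>k. k + x) ` K. {h + k})"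
      using K(1) by (intro UN_I[of k] UN_I[of "a \<odot>\<^bsub>N\<^esub> (0 + x)"]) auto
  qed
  then show ?thesis by (simp add: quot_module_def)
qed

text \<open>Mayer-Vietoris involves unions of order complexes, which need not be order complexes;
  the finite ambient poset \<open>V\<close> keeps vertices and orientations under control.\<close>

definition subcomplex :: "'a::order set \<Rightarrow> 'a set set \<Rightarrow> bool" where
  "subcomplex V D \<longleftrightarrow> finite V \<and> D \<subseteq> order_complex V \<and> (\<forall>\<tau>\<in>D. \<forall>\<sigma>\<subseteq>\<tau>. \<sigma> \<in> D)"

lemma subcomplex_order_complex: "finite V \<Longrightarrow> Q \<subseteq> V \<Longrightarrow> subcomplex V (order_complex Q)"
  by (auto simp: subcomplex_def intro: order_complex_subset) (auto simp: order_complex_def)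

lemma subcomplex_Int: "subcomplex V A \<Longrightarrow> subcomplex V B \<Longrightarrow> subcomplex V (A \<inter> B)"
  by (auto simp: subcomplex_def)

lemma subcomplex_Un: "subcomplex V A \<Longrightarrow> subcomplex V B \<Longrightarrow> subcomplex V (A \<union> B)"
  by (auto simp: subcomplex_def)

lemma subcomplex_UN: "finite V \<Longrightarrow> (\<And>b. b \<in> I \<Longrightarrow> subcomplex V (A b)) \<Longrightarrow> subcomplex V (\<Union>b\<in>I. A b)"
  unfolding subcomplex_def by blast

lemma simpl_chains_mono: "A \<subseteq> B \<Longrightarrow> c \<in> simpl_chains A i \<Longrightarrow> c \<in> simpl_chains B i"
  by (auto simp: simpl_chains_def)

lemma subcomplex_chains: "subcomplex V D \<Longrightarrow> c \<in> simpl_chains D i \<Longrightarrow> c \<in> simpl_chains (order_complex V) i"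
  by (auto simp: subcomplex_def intro: simpl_chains_mono)

text \<open>Degrees are integers here. A nonzero chain determines its degree through the size of a
  face, which brings it back to \<open>chains_of\<close>.\<close>

lemma subcomplex_boundary_boundary:
  assumes "subcomplex V D" and "c \<in> simpl_chains D i"
  shows "simpl_boundary (simpl_boundary c) = 0"
proof (cases "c = 0")
  case False
  then obtain \<sigma> where "c \<sigma> \<noteq> 0" by (auto simp: fun_eq_iff)
  then have "int (card \<sigma>) = i + 1" using assms(2) by (auto simp: simpl_chains_def)
  then have "c \<in> chains_of V (card \<sigma>)"
    using subcomplex_chains[OF assms] by (simp add: chains_of_def)
  then show ?thesis using boundary_boundary assms(1) subcomplex_def by blast
qed simp

lemma subcomplex_boundary:
  assumes D: "subcomplex V D" and c: "c \<in> simpl_chains D i"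
  shows "simpl_boundary c \<in> simpl_chains D (i - 1)"
proof -
  have fin: "finite V" using D by (simp add: subcomplex_def)
  have supp: "\<sigma> \<in> D" "int (card \<sigma>) = i + 1" "\<sigma> \<subseteq> V" if "c \<sigma> \<noteq> 0" for \<sigma>
    using that c D by (auto simp: simpl_chains_def subcomplex_def order_complex_def)
  have *: "\<tau> \<in> D \<and> int (card \<tau>) = i \<and> \<tau> \<subseteq> V" if "simpl_boundary c \<tau> \<noteq> 0" for \<tau>
  proof -
    have "\<exists>v\<in>V - \<tau>. (- 1) ^ card {u \<in> \<tau>. u < v} * c (insert v \<tau>) \<noteq> 0"
    proof (rule ccontr)
      assume "\<not> ?thesis"
      then have "(\<Sum>v\<in>V - \<tau>. (- 1) ^ card {u \<in> \<tau>. u < v} * c (insert v \<tau>)) = 0"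
        by (intro sum.neutral) blast
      then show False using that simpl_boundary_support[of V c \<tau>, OF fin supp(3)] by simp
    qed
    then obtain v where v: "v \<in> V - \<tau>" "c (insert v \<tau>) \<noteq> 0" by auto
    have "finite (insert v \<tau>)" by (rule finite_subset[OF supp(3)[OF v(2)] fin])
    then have "finite \<tau>" by simp
    then show ?thesis using supp[OF v(2)] v(1) D by (auto simp: subcomplex_def)
  qed
  moreover have "finite {\<tau>. simpl_boundary c \<tau> \<noteq> 0}"
    by (rule finite_subset[of _ "Pow V"]) (use * fin in auto)
  ultimately show ?thesis by (auto simp: simpl_chains_def)
qed

context
  fixes V :: "'a::order set" and D :: "'a set set"
  assumes D: "subcomplex V D"
begin

lemma subcomplex_boundary_add:
  "c \<in> simpl_chains D i \<Longrightarrow> d \<in> simpl_chains D i \<Longrightarrow> simpl_boundary (c + d) = simpl_boundary c + simpl_boundary d"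
  using simpl_boundary_add subcomplex_chains[OF D] by blast

lemma subcomplex_boundary_diff:
  "c \<in> simpl_chains D i \<Longrightarrow> d \<in> simpl_chains D i \<Longrightarrow> simpl_boundary (c - d) = simpl_boundary c - simpl_boundary d"
  using simpl_boundary_diff subcomplex_chains[OF D] by blast

lemma cycles_zero: "0 \<in> simpl_cycles D i"
  by (simp add: simpl_cycles_def)

lemma cycles_add: "c \<in> simpl_cycles D i \<Longrightarrow> d \<in> simpl_cycles D i \<Longrightarrow> c + d \<in> simpl_cycles D i"
  by (simp add: simpl_cycles_def add_chain subcomplex_boundary_add[of c i d])

lemma cycles_scale: "c \<in> simpl_cycles D i \<Longrightarrow> scale_chain a c \<in> simpl_cycles D i"
  by (auto simp: simpl_cycles_def scale_chain simpl_boundary_scale)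

lemma boundaries_zero: "0 \<in> simpl_boundaries D i"
  unfolding simpl_boundaries_def by (rule image_eqI[of _ _ 0]) auto

lemma boundaries_add: "c \<in> simpl_boundaries D i \<Longrightarrow> d \<in> simpl_boundaries D i \<Longrightarrow> c + d \<in> simpl_boundaries D i"
  unfolding simpl_boundaries_def
  by (auto simp: subcomplex_boundary_add[symmetric] intro!: imageI add_chain)

lemma boundaries_diff: "c \<in> simpl_boundaries D i \<Longrightarrow> d \<in> simpl_boundaries D i \<Longrightarrow> c - d \<in> simpl_boundaries D i"
  unfolding simpl_boundaries_def
  by (auto simp: subcomplex_boundary_diff[symmetric] intro!: imageI diff_chain)

lemma boundaries_scale: "c \<in> simpl_boundaries D i \<Longrightarrow> scale_chain a c \<in> simpl_boundaries D i"
  unfolding simpl_boundaries_def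
  by (auto simp: simpl_boundary_scale[symmetric] intro!: imageI scale_chain)

lemma homology_class_eq_iff:
  "homology_class D i x = homology_class D i y \<longleftrightarrow> x - y \<in> simpl_boundaries D i"
  unfolding homology_class_def
  by (rule a_r_coset_eq_iff) (auto simp: cycle_space_def boundaries_zero boundaries_diff)

lemma homology_class_zero_iff:
  "homology_class D i x = homology_class D i 0 \<longleftrightarrow> x \<in> simpl_boundaries D i"
  unfolding homology_class_eq_iff by simp

lemma mem_homology_class: "y \<in> homology_class D i x \<longleftrightarrow> y - x \<in> simpl_boundaries D i"
  unfolding homology_class_def
  by (subst a_r_coset_plus) (auto simp: cycle_space_def image_iff, metis add.commute diff_add_cancel)

lemma carrier_homology: "carrier (reduced_homology D i) = homology_class D i ` simpl_cycles D i"
  unfolding reduced_homology_def carrier_quot_module homology_class_def by (simp add: cycle_space_def)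

lemma homology_add:
  "homology_class D i x \<oplus>\<^bsub>reduced_homology D i\<^esub> homology_class D i y = homology_class D i (x + y)"
  unfolding homology_class_def reduced_homology_def
  by (rule quot_module_add) (auto simp: cycle_space_def boundaries_zero boundaries_add)

lemma homology_smult:
  "a \<odot>\<^bsub>reduced_homology D i\<^esub> homology_class D i x = homology_class D i (scale_chain a x)"
proof -
  have "a \<odot>\<^bsub>reduced_homology D i\<^esub> homology_class D i x =
    simpl_boundaries D i +>\<^bsub>cycle_space D i\<^esub> (a \<odot>\<^bsub>cycle_space D i\<^esub> x)"
    unfolding homology_class_def reduced_homology_def
    by (rule quot_module_smult)
      (auto simp: cycle_space_def boundaries_zero boundaries_add boundaries_scale algebra_simps)
  then show ?thesis by (simp add: homology_class_def cycle_space_def)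
qed

lemma homology_zero: "\<zero>\<^bsub>reduced_homology D i\<^esub> = homology_class D i 0"
  unfolding homology_class_def reduced_homology_def
  by (subst a_r_coset_plus) (auto simp: cycle_space_def quot_module_def)

lemma cycle_space_module: "module (class_ring :: 'k::field ring) (cycle_space D i)"
proof (rule moduleI)
  show "cring (class_ring :: 'k ring)" by (rule cring_class_ring)
  show "abelian_group (cycle_space D i :: ('k, 'a set \<Rightarrow> 'k) module)"
  proof (rule abelian_groupI)
    fix x :: "'a set \<Rightarrow> 'k" assume "x \<in> carrier (cycle_space D i)"
    then show "\<exists>y\<in>carrier (cycle_space D i). y \<oplus>\<^bsub>cycle_space D i\<^esub> x = \<zero>\<^bsub>cycle_space D i\<^esub>"
      using cycles_scale[of x i "-1"] by (auto simp: cycle_space_def intro!: bexI[of _ "scale_chain (-1) x"])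
  qed (auto simp: cycle_space_def cycles_zero algebra_simps cycles_add)
qed (auto simp: cycle_space_def cycles_scale algebra_simps)

lemma homology_module: "module (class_ring :: 'k::field ring) (reduced_homology D i)"
proof (rule module_image[OF cycle_space_module])
  show "homology_class D i ` carrier (cycle_space D i) = carrier (reduced_homology D i)"
    by (simp add: carrier_homology cycle_space_def)
qed (auto simp: homology_add homology_smult homology_zero cycle_space_def)

lemma homology_vectorspace: "vectorspace (class_ring :: 'k::field ring) (reduced_homology D i)"
  unfolding vectorspace_def using homology_module class_field by blast

end

text \<open>Induction on the support set: the functions vanishing at \<open>s\<close> are handled by
  the hypothesis, and one function that does not vanish there completes the generators. Spanning is
  expressed through closed sets \<open>T\<close>, so that the preimage of a span under the passage
  to homology classes can be taken for \<open>T\<close>.\<close>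

lemma finitely_generated_functions:
  fixes W :: "('b \<Rightarrow> 'k::field) set"
  assumes "finite S" and "\<And>w s. w \<in> W \<Longrightarrow> w s \<noteq> 0 \<Longrightarrow> s \<in> S"
    and "0 \<in> W" and "\<And>v w. v \<in> W \<Longrightarrow> w \<in> W \<Longrightarrow> v + w \<in> W" and "\<And>a w. w \<in> W \<Longrightarrow> scale_chain a w \<in> W"
  shows "\<exists>A\<subseteq>W. finite A \<and> (\<forall>T. A \<subseteq> T \<longrightarrow> 0 \<in> T \<longrightarrow> (\<forall>v\<in>T. \<forall>w\<in>T. v + w \<in> T) \<longrightarrow>
    (\<forall>a. \<forall>w\<in>T. scale_chain a w \<in> T) \<longrightarrow> W \<subseteq> T)"
  using assms
proof (induction S arbitrary: W rule: finite_induct)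
  case empty
  then have "w = 0" if "w \<in> W" for w using that by (auto simp: fun_eq_iff)
  then have "W \<subseteq> {0}" by blast
  then show ?case by (intro exI[of _ "{}"]) blast
next
  case (insert s S)
  define W0 where "W0 = {w \<in> W. w s = 0}"
  have "\<exists>A\<subseteq>W0. finite A \<and> (\<forall>T. A \<subseteq> T \<longrightarrow> 0 \<in> T \<longrightarrow> (\<forall>v\<in>T. \<forall>w\<in>T. v + w \<in> T) \<longrightarrow>
    (\<forall>a. \<forall>w\<in>T. scale_chain a w \<in> T) \<longrightarrow> W0 \<subseteq> T)"
  proof (rule insert.IH)
    show "t \<in> S" if "w \<in> W0" "w t \<noteq> 0" for w t
      using that insert.prems(1)[of w t] by (auto simp: W0_def)
  qed (use insert.prems in \<open>auto simp: W0_def\<close>)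
  then obtain A where A: "A \<subseteq> W0" "finite A"
    and gen: "\<And>T. A \<subseteq> T \<Longrightarrow> 0 \<in> T \<Longrightarrow> \<forall>v\<in>T. \<forall>w\<in>T. v + w \<in> T \<Longrightarrow>
      \<forall>a. \<forall>w\<in>T. scale_chain a w \<in> T \<Longrightarrow> W0 \<subseteq> T" by blast
  show ?case
  proof (cases "W = W0")
    case True
    then show ?thesis using A gen by blast
  next
    case False
    then obtain w1 where w1: "w1 \<in> W" "w1 s \<noteq> 0" by (auto simp: W0_def)
    show ?thesis
    proof (intro exI[of _ "insert w1 A"] conjI allI impI)
      fix T assume T: "insert w1 A \<subseteq> T" "0 \<in> T" "\<forall>v\<in>T. \<forall>w\<in>T. v + w \<in> T" "\<forall>a. \<forall>w\<in>T. scale_chain a w \<in> T"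
      have W0: "W0 \<subseteq> T" using gen[of T] T by blast
      show "W \<subseteq> T"
      proof
        fix w assume w: "w \<in> W"
        \<comment> \<open>Elimination with pivot \<open>w1 s\<close>.\<close>
        let ?u = "w + scale_chain (- (w s / w1 s)) w1"
        have "?u \<in> W" by (intro insert.prems(3,4) w w1(1))
        then have "?u \<in> W0" using w1(2) by (simp add: W0_def)
        then have "?u + scale_chain (w s / w1 s) w1 \<in> T" using W0 T by blast
        moreover have "?u + scale_chain (w s / w1 s) w1 = w" by auto
        ultimately show "w \<in> T" by (simp only:)
      qed
    qed (use A w1 W0_def in auto)
  qed
qed

lemma homology_finite_gen:
  assumes D: "subcomplex V D"
  shows "\<exists>A. finite A \<and> A \<subseteq> carrier (reduced_homology D i :: ('k::field, _) module) \<and>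
    LinearCombinations.module.span class_ring (reduced_homology D i :: ('k, _) module) A = carrier (reduced_homology D i)"
proof -
  let ?H = "reduced_homology D i :: ('k, ('a set \<Rightarrow> 'k) set) module"
  interpret H: Module.module class_ring ?H by (rule homology_module[OF D])
  have "\<exists>A\<subseteq>simpl_cycles D i. finite A \<and> (\<forall>T::('a set \<Rightarrow> 'k) set. A \<subseteq> T \<longrightarrow> 0 \<in> T \<longrightarrow> (\<forall>v\<in>T. \<forall>w\<in>T. v + w \<in> T) \<longrightarrow>
    (\<forall>a. \<forall>w\<in>T. scale_chain a w \<in> T) \<longrightarrow> simpl_cycles D i \<subseteq> T)"
  proof (rule finitely_generated_functions[of "Pow V"])
    show "finite (Pow V)" using D by (simp add: subcomplex_def)
    show "\<sigma> \<in> Pow V" if "w \<in> simpl_cycles D i" "w \<sigma> \<noteq> 0" for w :: "'a set \<Rightarrow> 'k" and \<sigma>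
      using that D by (auto simp: simpl_cycles_def simpl_chains_def subcomplex_def order_complex_def)
  qed (simp_all add: cycles_zero[OF D] cycles_add[OF D] cycles_scale[OF D])
  then obtain A :: "('a set \<Rightarrow> 'k) set" where A: "A \<subseteq> simpl_cycles D i" "finite A"
    and gen: "\<And>T. A \<subseteq> T \<Longrightarrow> 0 \<in> T \<Longrightarrow> \<forall>v\<in>T. \<forall>w\<in>T. v + w \<in> T \<Longrightarrow>
      \<forall>a. \<forall>w\<in>T. scale_chain a w \<in> T \<Longrightarrow> simpl_cycles D i \<subseteq> T" by blast
  let ?A = "homology_class D i ` A"
  have AH: "?A \<subseteq> carrier ?H" using A(1) by (auto simp: carrier_homology[OF D])
  interpret S: LinearCombinations.submodule class_ring "H.span ?A" ?H by (rule H.span_is_submodule[OF AH])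
  have "simpl_cycles D i \<subseteq> {w. homology_class D i w \<in> H.span ?A}"
  proof (rule gen)
    show "A \<subseteq> {w. homology_class D i w \<in> H.span ?A}" using H.in_own_span[OF AH] by auto
    show "0 \<in> {w. homology_class D i w \<in> H.span ?A}"
      using S.zero_closed by (simp add: homology_zero[OF D])
    show "\<forall>v\<in>{w. homology_class D i w \<in> H.span ?A}. \<forall>w\<in>{w. homology_class D i w \<in> H.span ?A}.
        v + w \<in> {w. homology_class D i w \<in> H.span ?A}"
    proof (intro ballI CollectI)
      fix v w assume "v \<in> {w. homology_class D i w \<in> H.span ?A}" "w \<in> {w. homology_class D i w \<in> H.span ?A}"
      then have "homology_class D i v \<oplus>\<^bsub>?H\<^esub> homology_class D i w \<in> H.span ?A"
        by (intro S.m_closed) auto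
      then show "homology_class D i (v + w) \<in> H.span ?A" by (simp only: homology_add[OF D])
    qed
    show "\<forall>a. \<forall>w\<in>{w. homology_class D i w \<in> H.span ?A}. scale_chain a w \<in> {w. homology_class D i w \<in> H.span ?A}"
    proof (intro allI ballI CollectI)
      fix a w assume "w \<in> {w. homology_class D i w \<in> H.span ?A}"
      then have "a \<odot>\<^bsub>?H\<^esub> homology_class D i w \<in> H.span ?A"
        by (intro S.smult_closed) auto
      then show "homology_class D i (scale_chain a w) \<in> H.span ?A" by (simp only: homology_smult[OF D])
    qed
  qed
  then have "carrier ?H \<subseteq> H.span ?A" by (auto simp: carrier_homology[OF D])
  moreover have "H.span ?A \<subseteq> carrier ?H" by (rule H.span_is_subset2[OF AH])
  ultimately show ?thesis using A(2) AH by blast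
qed

text \<open>The dimension is a least cardinality over finite generating sets, so it says something
  only once one such set is known to exist.\<close>

lemma hdim_gen:
  assumes D: "subcomplex V D"
  shows "\<exists>A. finite A \<and> card A = hdim TYPE('k::field) D i \<and> A \<subseteq> carrier (reduced_homology D i :: ('k, _) module) \<and>
    LinearCombinations.module.span class_ring (reduced_homology D i :: ('k, _) module) A = carrier (reduced_homology D i)"
proof -
  let ?H = "reduced_homology D i :: ('k, ('a set \<Rightarrow> 'k) set) module"
  let ?P = "\<lambda>n. \<exists>A. finite A \<and> card A = n \<and> A \<subseteq> carrier ?H \<and>
    LinearCombinations.module.span class_ring ?H A = carrier ?H"
  obtain A where "finite A \<and> A \<subseteq> carrier ?H \<and> LinearCombinations.module.span class_ring ?H A = carrier ?H"
    using homology_finite_gen[OF D, where 'k = 'k] by blast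
  then have "?P (card A)" by (intro exI[of _ A]) auto
  then have "?P (LEAST n. ?P n)" by (rule LeastI)
  then show ?thesis
    unfolding hdim_def vectorspace.dim_def[OF homology_vectorspace[OF D, where 'k = 'k]] .
qed

lemma hdim_eq_0_iff:
  assumes D: "subcomplex V D"
  shows "hdim TYPE('k::field) D i = 0 \<longleftrightarrow> (simpl_cycles D i :: ('a::order set \<Rightarrow> 'k) set) \<subseteq> simpl_boundaries D i"
proof -
  let ?H = "reduced_homology D i :: ('k, ('a set \<Rightarrow> 'k) set) module"
  interpret H: Module.module class_ring ?H by (rule homology_module[OF D])
  have span0: "H.span {} = {\<zero>\<^bsub>?H\<^esub>}" by (auto simp: H.span_def H.lincomb_def)
  show ?thesis
  proof
    assume "hdim TYPE('k) D i = 0"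
    then have "carrier ?H = {\<zero>\<^bsub>?H\<^esub>}" using hdim_gen[OF D, where 'k = 'k, of i] span0 by auto
    then have "homology_class D i c = homology_class D i 0" if "c \<in> simpl_cycles D i" for c :: "'a set \<Rightarrow> 'k"
    proof -
      have "homology_class D i c \<in> carrier ?H" using that unfolding carrier_homology[OF D] by (rule imageI)
      then show ?thesis unfolding \<open>carrier ?H = {\<zero>\<^bsub>?H\<^esub>}\<close> homology_zero[OF D] by (rule singletonD)
    qed
    then show "(simpl_cycles D i :: ('a set \<Rightarrow> 'k) set) \<subseteq> simpl_boundaries D i"
      using homology_class_zero_iff[OF D] by blast
  next
    assume *: "(simpl_cycles D i :: ('a set \<Rightarrow> 'k) set) \<subseteq> simpl_boundaries D i"
    have "homology_class D i c = homology_class D i 0" if "c \<in> simpl_cycles D i" for c :: "'a set \<Rightarrow> 'k"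
      using that * homology_class_zero_iff[OF D] by blast
    then have "carrier ?H = {\<zero>\<^bsub>?H\<^esub>}"
      unfolding carrier_homology[OF D] homology_zero[OF D] using cycles_zero[OF D] by blast
    then have "hdim TYPE('k) D i \<le> 0"
      unfolding hdim_def vectorspace.dim_def[OF homology_vectorspace[OF D]]
      by (intro Least_le exI[of _ "{}"]) (use span0 in auto)
    then show "hdim TYPE('k) D i = 0" by simp
  qed
qed

text \<open>Chain-level form of one-dimensionality: a representative of the class that spans
  homology. Were it a boundary, all cycles would be, and the dimension would be 0.\<close>

lemma hdim_1D:
  assumes D: "subcomplex V D" and h: "hdim TYPE('k::field) D i = 1"
  shows "\<exists>b\<in>simpl_cycles D i. b \<notin> simpl_boundaries D i \<and>
    (\<forall>c\<in>simpl_cycles D i. \<exists>a. c - scale_chain a (b :: 'a::order set \<Rightarrow> 'k) \<in> simpl_boundaries D i)"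
proof -
  let ?H = "reduced_homology D i :: ('k, ('a set \<Rightarrow> 'k) set) module"
  interpret H: Module.module class_ring ?H by (rule homology_module[OF D])
  obtain v where v: "v \<in> carrier ?H" "H.span {v} = carrier ?H"
    using hdim_gen[OF D, where 'k = 'k, of i] h by (auto simp: card_1_singleton_iff)
  then obtain b where b: "b \<in> simpl_cycles D i" "v = homology_class D i b" by (auto simp: carrier_homology[OF D])
  have gen: "\<exists>a. c - scale_chain a b \<in> simpl_boundaries D i" if "c \<in> simpl_cycles D i" for c
  proof -
    have "homology_class D i c \<in> H.span {v}" using that v(2) by (auto simp: carrier_homology[OF D])
    then obtain a where "homology_class D i c = H.lincomb a {v}"
      using H.finite_in_span[of "{v}" "homology_class D i c"] v(1) by auto
    also have "\<dots> = a v \<odot>\<^bsub>?H\<^esub> v"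
    proof -
      have "a v \<odot>\<^bsub>?H\<^esub> v \<in> carrier ?H" using v(1) by (intro H.smult_closed) auto
      then show ?thesis by (simp add: H.lincomb_def H.M.finsum_insert)
    qed
    also have "\<dots> = homology_class D i (scale_chain (a v) b)"
      unfolding b(2) homology_smult[OF D] ..
    finally show ?thesis using homology_class_eq_iff[OF D] by blast
  qed
  have "b \<notin> simpl_boundaries D i"
  proof
    assume bb: "b \<in> simpl_boundaries D i"
    have "simpl_cycles D i \<subseteq> (simpl_boundaries D i :: ('a set \<Rightarrow> 'k) set)"
    proof
      fix c :: "'a set \<Rightarrow> 'k" assume "c \<in> simpl_cycles D i"
      then obtain a where "c - scale_chain a b \<in> simpl_boundaries D i" using gen by blast
      then have "c - scale_chain a b + scale_chain a b \<in> simpl_boundaries D i"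
        using boundaries_add[OF D] boundaries_scale[OF D bb] by blast
      then show "c \<in> simpl_boundaries D i" by (simp only: diff_add_cancel)
    qed
    then show False using hdim_eq_0_iff[OF D] h by (metis zero_neq_one)
  qed
  then show ?thesis using b(1) gen by blast
qed

section \<open>The connecting maps\<close>

lemma restricted_chain:
  assumes "c \<in> simpl_chains D i" and "\<And>\<sigma>. d \<sigma> \<noteq> 0 \<Longrightarrow> c \<sigma> \<noteq> 0 \<and> \<sigma> \<in> E"
  shows "d \<in> simpl_chains E i"
  using assms unfolding simpl_chains_def by (auto intro: finite_subset[of _ "{\<sigma>. c \<sigma> \<noteq> 0}"])

text \<open>Independence of the splitting. If two splittings differ by the boundary of
  \<open>w\<close>, then \<open>w\<close> itself splits along \<open>A\<close> and \<open>B\<close>,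
  and the two \<open>A\<close>-parts differ by the boundary of \<open>wA\<close> plus a chain
  \<open>t\<close> that lies in both subcomplexes; the boundary of \<open>t\<close> is the
  difference of the two values.\<close>

lemma mv_connecting_eq:
  assumes A: "subcomplex V A" and B: "subcomplex V B"
    and z': "z' \<in> simpl_chains A i" and z'': "z'' \<in> simpl_chains B i"
  shows "mv_connecting A B i (homology_class (A \<union> B) i (z' + z'')) =
    homology_class (A \<inter> B) (i - 1) (simpl_boundary z')"
  unfolding mv_connecting_def
proof (rule the_equality)
  note AB = subcomplex_Un[OF A B] and AiB = subcomplex_Int[OF A B]
  show "\<exists>y'\<in>simpl_chains A i. \<exists>y''\<in>simpl_chains B i. y' + y'' \<in> homology_class (A \<union> B) i (z' + z'') \<and>
    homology_class (A \<inter> B) (i - 1) (simpl_boundary z') = homology_class (A \<inter> B) (i - 1) (simpl_boundary y')"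
    by (rule bexI[OF _ z'], rule bexI[OF _ z'']) (simp add: mem_homology_class[OF AB] boundaries_zero[OF AB])
  fix \<eta>
  assume "\<exists>y'\<in>simpl_chains A i. \<exists>y''\<in>simpl_chains B i. y' + y'' \<in> homology_class (A \<union> B) i (z' + z'') \<and>
    \<eta> = homology_class (A \<inter> B) (i - 1) (simpl_boundary y')"
  then obtain y' y'' where y': "y' \<in> simpl_chains A i" and y'': "y'' \<in> simpl_chains B i"
    and y: "y' + y'' - (z' + z'') \<in> simpl_boundaries (A \<union> B) i"
    and \<eta>: "\<eta> = homology_class (A \<inter> B) (i - 1) (simpl_boundary y')"
    by (auto simp: mem_homology_class[OF AB])
  obtain w where w: "w \<in> simpl_chains (A \<union> B) (i + 1)" and dw: "y' + y'' - (z' + z'') = simpl_boundary w"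
    using y by (auto simp: simpl_boundaries_def)
  define wA where "wA = (\<lambda>\<sigma>. if \<sigma> \<in> A then w \<sigma> else 0)"
  define wB where "wB = (\<lambda>\<sigma>. if \<sigma> \<in> A then 0 else w \<sigma>)"
  have wA: "wA \<in> simpl_chains A (i + 1)" and wB: "wB \<in> simpl_chains B (i + 1)"
    by (rule restricted_chain[OF w]; use w in \<open>auto simp: simpl_chains_def wA_def wB_def split: if_splits\<close>)+
  have dwA: "simpl_boundary wA \<in> simpl_chains A i" and dwB: "simpl_boundary wB \<in> simpl_chains B i"
    using subcomplex_boundary[OF A wA] subcomplex_boundary[OF B wB] by auto
  have "w = wA + wB" by (auto simp: wA_def wB_def)
  then have dw': "simpl_boundary w = simpl_boundary wA + simpl_boundary wB"
    using subcomplex_boundary_add[OF AB simpl_chains_mono[OF Un_upper1 wA] simpl_chains_mono[OF Un_upper2 wB]]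
    by (simp only:)
  define t where "t = y' - z' - simpl_boundary wA"
  have tA: "t \<in> simpl_chains A i" unfolding t_def by (intro diff_chain y' z' dwA)
  have "t = simpl_boundary wB - y'' + z''"
    using dw unfolding dw' t_def by (simp add: algebra_simps)
  then have tB: "t \<in> simpl_chains B i" by (simp only: add_chain diff_chain dwB y'' z'')
  have t: "t \<in> simpl_chains (A \<inter> B) i" using tA tB by (auto simp: simpl_chains_def)
  have "simpl_boundary t = simpl_boundary y' - simpl_boundary z'"
    unfolding t_def using subcomplex_boundary_diff[OF A diff_chain[OF y' z'] dwA]
      subcomplex_boundary_diff[OF A y' z'] subcomplex_boundary_boundary[OF A wA] by simp
  then have "simpl_boundary y' - simpl_boundary z' \<in> simpl_boundaries (A \<inter> B) (i - 1)"
    unfolding simpl_boundaries_def using t by (intro image_eqI[of _ _ t]) auto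
  then show "\<eta> = homology_class (A \<inter> B) (i - 1) (simpl_boundary z')"
    unfolding \<eta> homology_class_eq_iff[OF AiB] .
qed

lemma incl_homology_eq:
  assumes X: "subcomplex V X" and Y: "subcomplex V Y" and XY: "X \<subseteq> Y"
  shows "incl_homology Y j (homology_class X j x) = homology_class Y j x"
  unfolding incl_homology_def
proof (rule the_equality)
  show "\<exists>z\<in>homology_class X j x. homology_class Y j x = homology_class Y j z"
    using boundaries_zero[OF X] by (intro bexI[of _ x]) (auto simp: mem_homology_class[OF X])
  fix \<eta> assume "\<exists>z\<in>homology_class X j x. \<eta> = homology_class Y j z"
  then obtain z where z: "z - x \<in> simpl_boundaries X j" "\<eta> = homology_class Y j z"
    by (auto simp: mem_homology_class[OF X])
  moreover have "simpl_boundaries X j \<subseteq> simpl_boundaries Y j"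
    using simpl_chains_mono[OF XY] by (auto simp: simpl_boundaries_def)
  ultimately show "\<eta> = homology_class Y j x" using homology_class_eq_iff[OF Y] by blast
qed

section \<open>The maps of the sequence as links\<close>

lemma cover_above:
  assumes "finite P" and "t \<in> P" and "t < q" and "q \<in> P"
  shows "\<exists>b. covered_by P b q \<and> t \<le> b"
proof -
  obtain b where b: "b \<in> {x \<in> P. x < q}" "t \<le> b" "\<And>x. x \<in> {x \<in> P. x < q} \<Longrightarrow> b \<le> x \<Longrightarrow> b = x"
    using finite_has_maximal2[of "{x \<in> P. x < q}" t] assms by auto
  then have "covered_by P b q" using assms(4) by (auto simp: covered_by_def less_le)
  then show ?thesis using b(2) by blast
qed

lemma finite_chain_has_greatest:
  fixes \<sigma> :: "'a::order set"
  assumes "finite \<sigma>" and "\<sigma> \<noteq> {}" and "Complete_Partial_Order.chain (\<le>) \<sigma>"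
  shows "\<exists>t\<in>\<sigma>. \<forall>x\<in>\<sigma>. x \<le> t"
proof -
  obtain t where "t \<in> \<sigma>" "\<And>x. x \<in> \<sigma> \<Longrightarrow> t \<le> x \<Longrightarrow> t = x" using finite_has_maximal[OF assms(1,2)] by blast
  then show ?thesis using assms(3) by (metis chainD order_refl)
qed

text \<open>A nonempty face is a chain with a greatest vertex; this vertex lies under some element
  covered by \<open>q\<close>, and with it the whole face.\<close>

lemma open_complex_cover:
  assumes fin: "finite P" and q: "q \<in> P" and p: "covered_by P p q"
  shows "open_complex P q =
    half_closed_complex P p \<union> (\<Union>b \<in> {b. covered_by P b q \<and> b \<noteq> p}. half_closed_complex P b)"
proof (intro equalityI subsetI)
  fix \<sigma> assume s: "\<sigma> \<in> open_complex P q"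
  then have \<sigma>: "finite \<sigma>" "Complete_Partial_Order.chain (\<le>) \<sigma>"
    and sub: "\<And>x. x \<in> \<sigma> \<Longrightarrow> x \<in> P \<and> zero_hat P < x \<and> x < q"
    by (auto simp: open_complex_def order_complex_def)
  show "\<sigma> \<in> half_closed_complex P p \<union> (\<Union>b \<in> {b. covered_by P b q \<and> b \<noteq> p}. half_closed_complex P b)"
  proof (cases "\<sigma> = {}")
    case True
    then show ?thesis by (auto simp: half_closed_complex_def order_complex_def chain_empty)
  next
    case False
    then obtain t where t: "t \<in> \<sigma>" "\<forall>x\<in>\<sigma>. x \<le> t" using finite_chain_has_greatest[OF \<sigma>(1)] \<sigma>(2) by blast
    obtain b where b: "covered_by P b q" "t \<le> b" using cover_above[OF fin] sub[OF t(1)] q by blast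
    have "x \<le> b" if "x \<in> \<sigma>" for x using t(2) that b(2) by (meson order_trans)
    then have "\<sigma> \<in> half_closed_complex P b"
      using \<sigma> sub by (auto simp: half_closed_complex_def order_complex_def)
    then show ?thesis using b(1) by blast
  qed
next
  fix \<sigma> assume "\<sigma> \<in> half_closed_complex P p \<union> (\<Union>b \<in> {b. covered_by P b q \<and> b \<noteq> p}. half_closed_complex P b)"
  then obtain b where b: "covered_by P b q" "\<sigma> \<in> half_closed_complex P b" using p by blast
  then have "x < q" if "x \<in> \<sigma>" for x
    using that by (auto simp: half_closed_complex_def order_complex_def covered_by_def)
  then show "\<sigma> \<in> open_complex P q"
    using b(2) by (auto simp: half_closed_complex_def open_complex_def order_complex_def)
qed

text \<open>Every face of \<open>z\<close> through \<open>p\<close> lies in the first subcomplex,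
  because \<open>p\<close> is maximal below \<open>q\<close>. The part of \<open>z\<close> on that
  subcomplex is therefore the join of \<open>p\<close> with the link plus a chain \<open>a\<close>
  strictly below \<open>p\<close>; the boundary of the join is the link up to sign, and the boundary
  of \<open>a\<close> vanishes in homology below \<open>p\<close>.\<close>

lemma seq_map_class:
  assumes fin: "finite P" and least: "\<And>x. x \<in> P \<Longrightarrow> zero_hat P \<le> x" and i: "2 \<le> i"
    and pq: "covered_by P p q" and p0: "p \<noteq> zero_hat P"
    and z: "z \<in> simpl_cycles (open_complex P q) (int i - 2)"
  shows "seq_map P i q p (homology_class (open_complex P q) (int i - 2) z) =
    homology_class (open_complex P p) (int i - 3) (scale_chain ((- 1) ^ i) (link_chain p z))"
proof -
  define A where "A = half_closed_complex P p"
  define B where "B = (\<Union>b \<in> {b. covered_by P b q \<and> b \<noteq> p}. half_closed_complex P b)"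
  define Q where "Q = {x \<in> P. zero_hat P < x \<and> x < q}"
  define W where "W = {x \<in> P. zero_hat P < x \<and> x < p}"
  have pP: "p \<in> P" "q \<in> P" "p < q" using pq by (auto simp: covered_by_def)
  have zp: "zero_hat P < p" using least[OF pP(1)] p0 by (auto simp: less_le)
  have A: "subcomplex P A" unfolding A_def half_closed_complex_def by (rule subcomplex_order_complex[OF fin]) auto
  have B: "subcomplex P B" unfolding B_def half_closed_complex_def
    by (intro subcomplex_UN subcomplex_order_complex fin) auto
  have Y: "subcomplex P (open_complex P p)" unfolding open_complex_def by (rule subcomplex_order_complex[OF fin]) auto
  have un: "open_complex P q = A \<union> B" unfolding A_def B_def by (rule open_complex_cover[OF fin pP(2) pq])
  have int: "A \<inter> B \<subseteq> open_complex P p"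
  proof
    fix \<sigma> assume s: "\<sigma> \<in> A \<inter> B"
    then obtain b where b: "covered_by P b q" "b \<noteq> p" "\<sigma> \<in> half_closed_complex P b" by (auto simp: B_def)
    have "p \<notin> \<sigma>"
    proof
      assume "p \<in> \<sigma>"
      then have "p \<le> b" using b(3) by (auto simp: half_closed_complex_def order_complex_def)
      then show False using b(1,2) pq by (auto simp: covered_by_def less_le)
    qed
    then show "\<sigma> \<in> open_complex P p"
      using s by (auto simp: A_def half_closed_complex_def open_complex_def order_complex_def less_le)
  qed
  have finQ: "finite Q" using fin by (simp add: Q_def)
  have pQ: "p \<in> Q" using pP zp by (simp add: Q_def)
  have W: "{x \<in> Q. x < p} = W" using pP by (auto simp: Q_def W_def)
  \<comment> \<open>Faces of \<open>z\<close> have \<open>i - 1 = n + 1\<close> vertices and those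
    of its link \<open>n\<close>, and \<open>(- 1) ^ n = (- 1) ^ i\<close>.\<close>
  obtain n where n: "i = Suc (Suc n)" using i by (metis add_2_eq_Suc le_Suc_ex)
  have zc: "z \<in> simpl_chains (order_complex Q) (int i - 2)" and dz: "simpl_boundary z = 0"
    using z by (auto simp: simpl_cycles_def open_complex_def Q_def)
  have zQ: "z \<in> chains_of Q (Suc n)" using zc by (simp add: chains_of_def n)
  have max: "\<not> p < x" if "x \<in> Q" for x using that pq by (auto simp: covered_by_def Q_def)
  \<comment> \<open>Any splitting computes the connecting map; faces lying in both subcomplexes are
    assigned to the first.\<close>
  define z' where "z' = (\<lambda>\<sigma>. if \<sigma> \<in> A then z \<sigma> else 0)"
  define z'' where "z'' = (\<lambda>\<sigma>. if \<sigma> \<in> A then 0 else z \<sigma>)"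
  have zAB: "z \<in> simpl_chains (A \<union> B) (int i - 2)" using z un by (simp add: simpl_cycles_def)
  have z': "z' \<in> simpl_chains A (int i - 2)" and z'': "z'' \<in> simpl_chains B (int i - 2)"
    by (rule restricted_chain[OF zAB]; use zAB in \<open>auto simp: simpl_chains_def z'_def z''_def split: if_splits\<close>)+
  have "z = z' + z''" by (auto simp: z'_def z''_def)
  then have mv: "mv_connecting A B (int i - 2) (homology_class (open_complex P q) (int i - 2) z) =
      homology_class (A \<inter> B) (int i - 3) (simpl_boundary z')"
    using mv_connecting_eq[OF A B z' z''] un by (simp add: algebra_simps)
  have "seq_map P i q p (homology_class (open_complex P q) (int i - 2) z) =
      incl_homology (open_complex P p) (int i - 3) (homology_class (A \<inter> B) (int i - 3) (simpl_boundary z'))"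
    using i mv unfolding seq_map_def A_def[symmetric] B_def[symmetric] by simp
  also have "\<dots> = homology_class (open_complex P p) (int i - 3) (simpl_boundary z')"
    by (rule incl_homology_eq[OF subcomplex_Int[OF A B] Y int])
  also have "\<dots> = homology_class (open_complex P p) (int i - 3) (scale_chain ((- 1) ^ i) (link_chain p z))"
    unfolding homology_class_eq_iff[OF Y]
  proof -
    define a where "a = (\<lambda>\<sigma>. if p \<in> \<sigma> then 0 else z' \<sigma>)"
    have l: "link_chain p z \<in> chains_of {x \<in> Q. x < p} n" by (rule link_chains_of[OF finQ max zQ])
    have mem: "\<sigma> \<in> A" if "z \<sigma> \<noteq> 0" "p \<in> \<sigma>" for \<sigma>
    proof -
      have s: "\<sigma> \<subseteq> Q" "Complete_Partial_Order.chain (\<le>) \<sigma>" using chains_ofD[OF finQ zQ that(1)] by auto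
      moreover have "x \<le> p" if "x \<in> \<sigma>" for x
        using chainD[OF s(2) that \<open>p \<in> \<sigma>\<close>] max[of x] s(1) that by (auto simp: less_le)
      moreover have "finite \<sigma>" using s(1) finQ finite_subset by blast
      ultimately show ?thesis by (auto simp: A_def half_closed_complex_def order_complex_def Q_def)
    qed
    have z'eq: "z' = join_chain (link_chain p z) p + a"
    proof
      fix \<sigma>
      show "z' \<sigma> = (join_chain (link_chain p z) p + a) \<sigma>"
        using mem[of \<sigma>] by (auto simp: join_chain_def link_chain_def a_def z'_def insert_absorb)
    qed
    have aW: "a \<in> chains_of W (Suc n)"
    proof -
      have finW: "finite W" using fin by (simp add: W_def)
      have "\<sigma> \<subseteq> W" if "a \<sigma> \<noteq> 0" for \<sigma>
      proof -
        have "p \<notin> \<sigma>" "\<sigma> \<in> A" using that by (auto simp: a_def z'_def split: if_splits)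
        then show ?thesis by (auto simp: A_def half_closed_complex_def order_complex_def W_def less_le)
      qed
      moreover have "z \<sigma> \<noteq> 0" if "a \<sigma> \<noteq> 0" for \<sigma> using that by (auto simp: a_def z'_def split: if_splits)
      ultimately show ?thesis
        unfolding chains_of_iff[OF finW] using chains_ofD[OF finQ zQ] by blast
    qed
    then have aQ: "a \<in> chains_of Q (Suc n)" using chains_of_mono[OF finQ, of W] W by blast
    have j: "join_chain (link_chain p z) p \<in> chains_of Q (Suc n)" by (rule join_chains_of[OF finQ pQ l])
    have "simpl_boundary (link_chain p z) = link_chain p (simpl_boundary z)"
      using link_boundary[OF finQ max zQ] by simp
    also have "\<dots> = 0" unfolding dz by (auto simp: link_chain_def)
    finally have "simpl_boundary (join_chain (link_chain p z) p) = scale_chain ((- 1) ^ n) (link_chain p z)"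
      using boundary_join[OF finQ pQ l] by (auto simp: join_chain_def)
    then have "simpl_boundary z' = scale_chain ((- 1) ^ n) (link_chain p z) + simpl_boundary a"
      unfolding z'eq boundary_add[OF j aQ] by simp
    then have "simpl_boundary z' - scale_chain ((- 1) ^ i) (link_chain p z) = simpl_boundary a"
      by (auto simp: n)
    moreover have "a \<in> simpl_chains (open_complex P p) (int i - 3 + 1)"
      using aW by (simp add: chains_of_def open_complex_def W_def n)
    ultimately show "simpl_boundary z' - scale_chain ((- 1) ^ i) (link_chain p z) \<in> simpl_boundaries (open_complex P p) (int i - 3)"
      unfolding simpl_boundaries_def by blast
  qed
  finally show ?thesis .
qed

section \<open>Transport of graded modules\<close>

lemma hom_finsum_abelian:
  assumes "abelian_monoid N" and "abelian_monoid N'"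
    and "\<And>x. x \<in> carrier N \<Longrightarrow> h x \<in> carrier N'"
    and "\<And>x y. x \<in> carrier N \<Longrightarrow> y \<in> carrier N \<Longrightarrow> h (x \<oplus>\<^bsub>N\<^esub> y) = h x \<oplus>\<^bsub>N'\<^esub> h y"
    and "h \<zero>\<^bsub>N\<^esub> = \<zero>\<^bsub>N'\<^esub>" and "\<And>a. a \<in> A \<Longrightarrow> c a \<in> carrier N"
  shows "h (finsum N c A) = finsum N' (\<lambda>a. h (c a)) A"
proof -
  interpret N: abelian_monoid N by fact
  interpret N': abelian_monoid N' by fact
  show ?thesis using assms(6)
  proof (induction A rule: infinite_finite_induct)
    case (infinite A)
    then show ?case using assms(5) by (simp add: N.finsum_infinite N'.finsum_infinite)
  next
    case empty
    then show ?case using assms(5) by simp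
  next
    case (insert a A)
    then have "h (c a \<oplus>\<^bsub>N\<^esub> finsum N c A) = h (c a) \<oplus>\<^bsub>N'\<^esub> h (finsum N c A)"
      by (intro assms(4) N.finsum_closed) auto
    moreover have "finsum N c (insert a A) = c a \<oplus>\<^bsub>N\<^esub> finsum N c A"
      using insert by (intro N.finsum_insert) auto
    moreover have "finsum N' (\<lambda>a. h (c a)) (insert a A) = h (c a) \<oplus>\<^bsub>N'\<^esub> finsum N' (\<lambda>a. h (c a)) A"
      using insert assms(3) by (intro N'.finsum_insert) auto
    ultimately show ?case using insert by simp
  qed
qed

lemma finsum_eq_sum:
  fixes c :: "'i \<Rightarrow> 'b::ab_group_add"
  assumes "abelian_monoid N" and "add N = (+)" and "zero N = 0" and "\<And>a. a \<in> A \<Longrightarrow> c a \<in> carrier N"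
  shows "finsum N c A = sum c A"
proof -
  interpret N: abelian_monoid N by fact
  show ?thesis using assms(4)
  proof (induction A rule: infinite_finite_induct)
    case (insert a A)
    then have "finsum N c (insert a A) = c a \<oplus>\<^bsub>N\<^esub> finsum N c A" by (intro N.finsum_insert) auto
    then show ?case using insert assms(2) by simp
  qed (auto simp: N.finsum_infinite assms(3))
qed

text \<open>Only \<open>N\<close> is assumed to be a module; the structure on \<open>N'\<close> is
  inherited along \<open>h\<close>. This suits a target whose operations are awkward to handle
  directly.\<close>

locale graded_iso =
  fixes N :: "('x::finite, 'k::field, 'b) multigraded" and N' :: "('x, 'k, 'c) multigraded" and h
  assumes N: "module class_ring N"
    and bij: "bij_betw h (carrier N) (carrier N')"
    and h_add: "\<And>x y. x \<in> carrier N \<Longrightarrow> y \<in> carrier N \<Longrightarrow> h (x \<oplus>\<^bsub>N\<^esub> y) = h x \<oplus>\<^bsub>N'\<^esub> h y"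
    and h_smult: "\<And>a x. x \<in> carrier N \<Longrightarrow> h (a \<odot>\<^bsub>N\<^esub> x) = a \<odot>\<^bsub>N'\<^esub> h x"
    and h_zero: "h \<zero>\<^bsub>N\<^esub> = \<zero>\<^bsub>N'\<^esub>"
    and h_hcomp: "\<And>u. h ` hcomp N u = hcomp N' u"
begin

lemma N': "module class_ring N'"
  by (rule module_image[OF N, where h = h]) (use bij h_add h_smult h_zero in \<open>auto simp: bij_betw_def\<close>)

sublocale N: Module.module class_ring N by (rule N)
sublocale N': Module.module class_ring N' by (rule N')

lemma h_closed: "x \<in> carrier N \<Longrightarrow> h x \<in> carrier N'"
  using bij by (auto simp: bij_betw_def)

lemma h_inj: "x \<in> carrier N \<Longrightarrow> y \<in> carrier N \<Longrightarrow> h x = h y \<longleftrightarrow> x = y"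
  using bij by (auto simp: bij_betw_def inj_on_def)

lemma h_surj: "x \<in> carrier N' \<Longrightarrow> \<exists>y\<in>carrier N. x = h y"
  using bij by (auto simp: bij_betw_def)

lemma h_eq_zero: "x \<in> carrier N \<Longrightarrow> h x = \<zero>\<^bsub>N'\<^esub> \<longleftrightarrow> x = \<zero>\<^bsub>N\<^esub>"
  using h_inj[of x "\<zero>\<^bsub>N\<^esub>"] h_zero by simp

lemma h_finsum: "(\<And>a. a \<in> A \<Longrightarrow> c a \<in> carrier N) \<Longrightarrow> h (finsum N c A) = finsum N' (\<lambda>a. h (c a)) A"
  by (rule hom_finsum_abelian) (auto intro: N.M.abelian_monoid_axioms N'.M.abelian_monoid_axioms h_closed h_add h_zero)

lemma h_lincomb:
  assumes "A \<subseteq> carrier N"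
  shows "h (N.lincomb (\<lambda>v. a (h v)) A) = N'.lincomb a (h ` A)"
proof -
  have inj: "inj_on h A" using bij assms by (meson bij_betw_def inj_on_subset)
  have "h (N.lincomb (\<lambda>v. a (h v)) A) = (\<Oplus>\<^bsub>N'\<^esub>v\<in>A. a (h v) \<odot>\<^bsub>N'\<^esub> h v)"
    unfolding N.lincomb_def using assms
    by (subst h_finsum) (auto simp: h_smult subset_iff intro!: N'.M.finsum_cong' N.smult_closed N'.smult_closed h_closed)
  also have "\<dots> = N'.lincomb a (h ` A)"
  proof -
    have "(\<lambda>v. a v \<odot>\<^bsub>N'\<^esub> v) \<in> h ` A \<rightarrow> carrier N'"
      using assms h_closed N'.smult_closed by auto
    then show ?thesis
      unfolding N'.lincomb_def using N'.M.add.finprod_reindex[OF _ inj, of "\<lambda>v. a v \<odot>\<^bsub>N'\<^esub> v"] by simp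
  qed
  finally show ?thesis .
qed

text \<open>Decompositions and bases are pushed forward along \<open>h\<close>; for uniqueness and
  independence, data on \<open>N'\<close> are lifted to \<open>N\<close>, and injectivity of
  \<open>h\<close> carries the relation back.\<close>

lemma is_graded_free_iso:
  assumes free: "is_graded_free N"
  shows "is_graded_free N'"
proof -
  from free have gm: "is_graded_module N" by (simp add: is_graded_free_def)
  have sub: "additive_subgroup (hcomp N u) N" for u using gm by (simp add: is_graded_module_def)
  have hc: "hcomp N u \<subseteq> carrier N" for u using additive_subgroup.a_subset[OF sub] .
  have hc': "hcomp N' u \<subseteq> carrier N'" for u unfolding h_hcomp[symmetric] using hc h_closed by blast
  have decomp: "\<exists>!c. (\<forall>u. c u \<in> hcomp N u) \<and> finite {u. c u \<noteq> \<zero>\<^bsub>N\<^esub>} \<and> x = finsum N c {u. c u \<noteq> \<zero>\<^bsub>N\<^esub>}"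
    if "x \<in> carrier N" for x
    using gm that by (simp add: is_graded_module_def)
  have "is_graded_module N'"
    unfolding is_graded_module_def
  proof (intro conjI allI ballI impI)
    show "module class_ring N'" by (rule N')
    show "additive_subgroup (hcomp N' u) N'" for u
    proof (rule additive_subgroup.intro, rule subgroup.intro)
      show "hcomp N' u \<subseteq> carrier (add_monoid N')" using hc' by simp
      show "\<one>\<^bsub>add_monoid N'\<^esub> \<in> hcomp N' u"
        using additive_subgroup.zero_closed[OF sub, of u] h_zero unfolding h_hcomp[symmetric] by force
      show "x \<otimes>\<^bsub>add_monoid N'\<^esub> y \<in> hcomp N' u" if "x \<in> hcomp N' u" "y \<in> hcomp N' u" for x y
      proof -
        obtain x0 y0 where "x0 \<in> hcomp N u" "y0 \<in> hcomp N u" "x = h x0" "y = h y0"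
          using \<open>x \<in> hcomp N' u\<close> \<open>y \<in> hcomp N' u\<close> unfolding h_hcomp[symmetric] by auto
        moreover then have "h (x0 \<oplus>\<^bsub>N\<^esub> y0) = x \<oplus>\<^bsub>N'\<^esub> y" using h_add hc by blast
        ultimately show ?thesis
          using additive_subgroup.a_closed[OF sub, of x0 u y0] unfolding h_hcomp[symmetric]
          by (metis imageI monoid.select_convs(1))
      qed
      show "inv\<^bsub>add_monoid N'\<^esub> x \<in> hcomp N' u" if "x \<in> hcomp N' u" for x
      proof -
        obtain x0 where x0: "x0 \<in> hcomp N u" "x = h x0" using \<open>x \<in> hcomp N' u\<close> unfolding h_hcomp[symmetric] by auto
        then have c: "x0 \<in> carrier N" using hc by blast
        have "h (\<ominus>\<^bsub>N\<^esub> x0) \<oplus>\<^bsub>N'\<^esub> h x0 = \<zero>\<^bsub>N'\<^esub>"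
          using h_add[of "\<ominus>\<^bsub>N\<^esub> x0" x0] c h_zero by (simp add: N.M.l_neg)
        then have "\<ominus>\<^bsub>N'\<^esub> x = h (\<ominus>\<^bsub>N\<^esub> x0)"
          using N'.M.minus_equality c h_closed x0(2) by simp
        moreover have "\<ominus>\<^bsub>N\<^esub> x0 \<in> hcomp N u"
          using additive_subgroup.a_inv_closed[OF sub x0(1)] N.M.abelian_group_axioms by simp
        ultimately show ?thesis unfolding h_hcomp[symmetric] by (simp add: a_inv_def)
      qed
    qed
    show "\<exists>!c. (\<forall>u. c u \<in> hcomp N' u) \<and> finite {u. c u \<noteq> \<zero>\<^bsub>N'\<^esub>} \<and> x = finsum N' c {u. c u \<noteq> \<zero>\<^bsub>N'\<^esub>}"
      if x: "x \<in> carrier N'" for x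
    proof -
      obtain y where y: "y \<in> carrier N" "x = h y" using h_surj[OF x] by blast
      obtain c where c: "\<forall>u. c u \<in> hcomp N u" "finite {u. c u \<noteq> \<zero>\<^bsub>N\<^esub>}" "y = finsum N c {u. c u \<noteq> \<zero>\<^bsub>N\<^esub>}"
        using decomp[OF y(1)] by blast
      have set: "{u. h (c u) \<noteq> \<zero>\<^bsub>N'\<^esub>} = {u. c u \<noteq> \<zero>\<^bsub>N\<^esub>}" if "\<forall>u. c u \<in> hcomp N u" for c
        using h_eq_zero hc that by blast
      show ?thesis
      proof (rule ex1I[of _ "\<lambda>u. h (c u)"])
        show "(\<forall>u. h (c u) \<in> hcomp N' u) \<and> finite {u. h (c u) \<noteq> \<zero>\<^bsub>N'\<^esub>} \<and> x = finsum N' (\<lambda>u. h (c u)) {u. h (c u) \<noteq> \<zero>\<^bsub>N'\<^esub>}"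
          unfolding set[OF c(1)] using c hc y(2) h_finsum[of "{u. c u \<noteq> \<zero>\<^bsub>N\<^esub>}" c] h_hcomp by blast
        fix d assume d: "(\<forall>u. d u \<in> hcomp N' u) \<and> finite {u. d u \<noteq> \<zero>\<^bsub>N'\<^esub>} \<and> x = finsum N' d {u. d u \<noteq> \<zero>\<^bsub>N'\<^esub>}"
        then have "\<forall>u. \<exists>e. e \<in> hcomp N u \<and> d u = h e" using h_hcomp by (metis imageE)
        then obtain e where e: "\<And>u. e u \<in> hcomp N u" "\<And>u. d u = h (e u)" by metis
        have de: "d = (\<lambda>u. h (e u))" using e(2) by auto
        have "x = h (finsum N e {u. e u \<noteq> \<zero>\<^bsub>N\<^esub>})"
          using d e(1) hc unfolding de set[of e, OF allI, OF e(1)] by (subst h_finsum) auto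
        then have "y = finsum N e {u. e u \<noteq> \<zero>\<^bsub>N\<^esub>}"
          using y e(1) hc by (subst h_inj[symmetric]) (auto intro!: N.M.finsum_closed)
        moreover have "finite {u. e u \<noteq> \<zero>\<^bsub>N\<^esub>}" using d unfolding de set[of e, OF allI, OF e(1)] by blast
        ultimately have "e = c" using decomp[OF y(1)] c e(1) by blast
        then show "d = (\<lambda>u. h (c u))" using de by simp
      qed
    qed
    show "r \<odot>\<^bsub>N'\<^esub> x \<in> hcomp N' (v + u)"
      if r: "\<forall>m\<in>Poly_Mapping.keys r. mdeg m = v" and x: "x \<in> hcomp N' u" for r u v x
    proof -
      obtain y where y: "y \<in> hcomp N u" "x = h y" using x unfolding h_hcomp[symmetric] by auto
      then have "r \<odot>\<^bsub>N\<^esub> y \<in> hcomp N (v + u)" using gm r by (simp add: is_graded_module_def)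
      then have "h (r \<odot>\<^bsub>N\<^esub> y) \<in> hcomp N' (v + u)" unfolding h_hcomp[symmetric] by blast
      moreover have "y \<in> carrier N" using hc y(1) by blast
      ultimately show ?thesis using h_smult[of y r] y(2) by simp
    qed
  qed
  moreover obtain A where A: "A \<subseteq> (\<Union>u. hcomp N u)" "\<not> N.lin_dep A" "N.span A = carrier N"
    using free by (auto simp: is_graded_free_def)
  have Ac: "A \<subseteq> carrier N" using A(1) hc by blast
  have "h ` A \<subseteq> (\<Union>u. hcomp N' u)" unfolding h_hcomp[symmetric] using A(1) by blast
  moreover have "\<not> N'.lin_dep (h ` A)"
  proof
    assume "N'.lin_dep (h ` A)"
    then obtain A' a v where A': "finite A'" "A' \<subseteq> h ` A" "N'.lincomb a A' = \<zero>\<^bsub>N'\<^esub>" "v \<in> A'" "a v \<noteq> 0"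
      unfolding N'.lin_dep_def by auto
    obtain A0 where A0: "A0 \<subseteq> A" "finite A0" "A' = h ` A0" using finite_subset_image[OF A'(1,2)] by blast
    obtain v0 where v0: "v0 \<in> A0" "v = h v0" using A'(4) A0(3) by blast
    have "h (N.lincomb (\<lambda>v. a (h v)) A0) = \<zero>\<^bsub>N'\<^esub>" using h_lincomb[of A0 a] A0 Ac A'(3) by auto
    then have "N.lincomb (\<lambda>v. a (h v)) A0 = \<zero>\<^bsub>N\<^esub>" using h_eq_zero A0(1) Ac by auto
    then have "N.lin_dep A" using A0 v0 A'(5) by (intro N.lin_dep_crit[of A0 A _ v0]) auto
    then show False using A(2) by blast
  qed
  moreover have "N'.span (h ` A) = carrier N'"
  proof
    show "N'.span (h ` A) \<subseteq> carrier N'" using Ac h_closed by (intro N'.span_is_subset2) auto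
    show "carrier N' \<subseteq> N'.span (h ` A)"
    proof
      fix x assume "x \<in> carrier N'"
      then obtain y where y: "y \<in> carrier N" "x = h y" using h_surj by blast
      have "y \<in> N.span A" using y(1) A(3) by simp
      then obtain a A0 where A0: "finite A0" "A0 \<subseteq> A" "y = N.lincomb a A0"
        unfolding N.span_def by auto
      \<comment> \<open>Coefficients indexed by the images of basis elements, obtained by undoing
        \<open>h\<close>.\<close>
      define b where "b = (\<lambda>w. a (inv_into (carrier N) h w))"
      have "b (h v) = a v" if "v \<in> A0" for v
      proof -
        have "v \<in> carrier N" using that A0(2) Ac by blast
        then show ?thesis using bij by (simp add: b_def bij_betw_def)
      qed
      then have "y = N.lincomb (\<lambda>v. b (h v)) A0"
        unfolding A0(3) using A0(2) Ac by (intro N.lincomb_cong) auto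
      then have "x = N'.lincomb b (h ` A0)" using h_lincomb[of A0 b] A0(2) Ac y(2) by auto
      then show "x \<in> N'.span (h ` A)" unfolding N'.span_def using A0 by auto
    qed
  qed
  ultimately show ?thesis unfolding is_graded_free_def by blast
qed

end

section \<open>Free modules over the polynomial ring\<close>

definition poly_restrict :: "('b \<Rightarrow> bool) \<Rightarrow> ('b \<Rightarrow>\<^sub>0 'k::zero) \<Rightarrow> ('b \<Rightarrow>\<^sub>0 'k)" where
  "poly_restrict P r = Abs_poly_mapping (\<lambda>m. if P m then Poly_Mapping.lookup r m else 0)"

lemma lookup_poly_restrict:
  "Poly_Mapping.lookup (poly_restrict P r) m = (if P m then Poly_Mapping.lookup r m else 0)"
proof -
  have "finite {m. (if P m then Poly_Mapping.lookup r m else 0) \<noteq> 0}"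
    by (rule finite_subset[of _ "{m. Poly_Mapping.lookup r m \<noteq> 0}"]) auto
  then show ?thesis by (simp add: poly_restrict_def)
qed

lemma finite_atMost_fun: "finite {a :: 'x::finite \<Rightarrow> nat. a \<le> m}"
proof (rule finite_subset)
  show "{a. a \<le> m} \<subseteq> Pi\<^sub>E UNIV (\<lambda>x. {..m x})" by (auto simp: le_fun_def)
  show "finite (Pi\<^sub>E UNIV (\<lambda>x. {..m x}))" by (intro finite_PiE) auto
qed

text \<open>Rewrites the convolution as a sum over divisors of \<open>m\<close>, the form in which
  \<open>poly_tensor\<close> defines its scalar multiplication.\<close>

lemma lookup_mult_atMost:
  fixes r s :: "('x::finite, 'k::field) mpoly"
  shows "Poly_Mapping.lookup (r * s) m = (\<Sum>a | a \<le> m. Poly_Mapping.lookup r a * Poly_Mapping.lookup s (m - a))"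
proof -
  have inner: "(\<Sum>q. Poly_Mapping.lookup s q when m = a + q) = (if a \<le> m then Poly_Mapping.lookup s (m - a) else 0)" for a
  proof (cases "a \<le> m")
    case True
    then have "m = a + q \<longleftrightarrow> q = m - a" for q by (auto simp: le_fun_def fun_eq_iff)
    then have "(\<Sum>q. Poly_Mapping.lookup s q when m = a + q) = (\<Sum>q. Poly_Mapping.lookup s q when q = m - a)" by simp
    then show ?thesis using True by simp
  next
    case False
    then have "m \<noteq> a + q" for q by (auto simp: le_fun_def)
    then show ?thesis using False by simp
  qed
  have "Poly_Mapping.lookup (r * s) m = (\<Sum>a. Poly_Mapping.lookup r a * (if a \<le> m then Poly_Mapping.lookup s (m - a) else 0))"
    by (simp only: lookup_mult inner)
  also have "\<dots> = (\<Sum>a | a \<le> m. Poly_Mapping.lookup r a * (if a \<le> m then Poly_Mapping.lookup s (m - a) else 0))"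
    by (rule Sum_any.expand_superset[OF finite_atMost_fun]) auto
  finally show ?thesis by simp
qed

lemma lookup_single_mult:
  fixes s :: "('x::finite, 'k::field) mpoly"
  shows "Poly_Mapping.lookup (Poly_Mapping.single n a * s) m = (if n \<le> m then a * Poly_Mapping.lookup s (m - n) else 0)"
proof -
  have "Poly_Mapping.lookup (Poly_Mapping.single n a * s) m =
      (\<Sum>b | b \<le> m. if b = n then a * Poly_Mapping.lookup s (m - n) else 0)"
    unfolding lookup_mult_atMost by (intro sum.cong) (auto simp: lookup_single)
  then show ?thesis using finite_atMost_fun[of m] by simp
qed

text \<open>A coordinate model of the sum of the shifted modules R(-deg q) for \<open>q\<close> in
  \<open>S\<close>. Vectors vanish outside \<open>S\<close> instead of being undefined there, so
  addition, zero and finite sums are those of the function type.\<close>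

definition free_module :: "'x::finite mon set \<Rightarrow> ('x, 'k::field, 'x mon \<Rightarrow> ('x, 'k) mpoly) multigraded" where
  "free_module S =
     \<lparr>carrier = {g. \<forall>q. q \<notin> S \<longrightarrow> g q = 0}, mult = undefined, one = undefined, zero = 0, add = (+),
      smult = (\<lambda>r g q. r * g q),
      hcomp = (\<lambda>u. {g. (\<forall>q. q \<notin> S \<longrightarrow> g q = 0) \<and> (\<forall>q. \<forall>m\<in>Poly_Mapping.keys (g q). mdeg m + mdeg q = u)})\<rparr>"

lemma free_module_module: "module class_ring (free_module S :: ('x::finite, 'k::field, _) multigraded)"
proof (rule moduleI)
  show "cring (class_ring :: ('x, 'k) mpoly ring)" by (rule cring_class_ring)
  show "abelian_group (free_module S :: ('x::finite, 'k::field, _) multigraded)"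
  proof (rule abelian_groupI)
    fix x :: "'x mon \<Rightarrow> ('x, 'k) mpoly" assume "x \<in> carrier (free_module S)"
    then show "\<exists>y\<in>carrier (free_module S). y \<oplus>\<^bsub>free_module S\<^esub> x = \<zero>\<^bsub>free_module S\<^esub>"
      by (intro bexI[of _ "- x"]) (auto simp: free_module_def)
  qed (auto simp: free_module_def algebra_simps)
qed (auto simp: free_module_def algebra_simps fun_eq_iff)

definition unit_vector :: "'x::finite mon \<Rightarrow> 'x mon \<Rightarrow> ('x, 'k::field) mpoly" where
  "unit_vector q = (\<lambda>p. if p = q then 1 else 0)"

lemma mdeg_add: "mdeg (a + b) = mdeg a + mdeg b"
  by (auto simp: mdeg_def)

lemma mdeg_zero [simp]: "mdeg 0 = 0"
  by (auto simp: mdeg_def)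

lemma free_module_finsum:
  fixes c :: "'i \<Rightarrow> 'x::finite mon \<Rightarrow> ('x, 'k::field) mpoly"
  assumes "\<And>a. a \<in> A \<Longrightarrow> c a \<in> carrier (free_module S)"
  shows "finsum (free_module S) c A = sum c A"
proof (rule finsum_eq_sum)
  interpret Module.module class_ring "free_module S :: ('x, 'k, _) multigraded" by (rule free_module_module)
  show "abelian_monoid (free_module S :: ('x, 'k, _) multigraded)" by (rule M.abelian_monoid_axioms)
qed (use assms in \<open>auto simp: free_module_def\<close>)

text \<open>A term of exponent \<open>m\<close> in coordinate \<open>q\<close> belongs to exactly
  one degree, \<open>mdeg m + mdeg q\<close>. The components are cut out coefficient by coefficient,
  and comparing coefficients gives uniqueness.\<close>

lemma free_module_graded:
  assumes S: "finite S"
  shows "is_graded_module (free_module S :: ('x::finite, 'k::field, _) multigraded)"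
proof -
  let ?N = "free_module S :: ('x, 'k, _) multigraded"
  interpret N: Module.module class_ring ?N by (rule free_module_module)
  have zero: "\<zero>\<^bsub>?N\<^esub> = 0" by (simp add: free_module_def)
  have uminus: "\<ominus>\<^bsub>?N\<^esub> x = - x" if "x \<in> carrier ?N" for x
    by (rule N.M.minus_equality) (use that in \<open>auto simp: free_module_def\<close>)
  show ?thesis
    unfolding is_graded_module_def
  proof (intro conjI allI ballI impI)
    show "module class_ring ?N" by (rule free_module_module)
    show "additive_subgroup (hcomp ?N u) ?N" for u
    proof (rule additive_subgroup.intro, rule subgroup.intro)
      show "inv\<^bsub>add_monoid ?N\<^esub> x \<in> hcomp ?N u" if "x \<in> hcomp ?N u" for x
      proof -
        have "x \<in> carrier ?N" using that by (simp add: free_module_def)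
        then have "inv\<^bsub>add_monoid ?N\<^esub> x = - x" using uminus by (simp add: a_inv_def)
        then show ?thesis using that by (simp add: free_module_def keys_minus)
      qed
      show "x \<otimes>\<^bsub>add_monoid ?N\<^esub> y \<in> hcomp ?N u" if "x \<in> hcomp ?N u" "y \<in> hcomp ?N u" for x y
      proof -
        have "mdeg m + mdeg q = u" if m: "m \<in> Poly_Mapping.keys (x q + y q)" for m q
        proof -
          have "m \<in> Poly_Mapping.keys (x q) \<or> m \<in> Poly_Mapping.keys (y q)" using subsetD[OF keys_add m] by simp
          then show ?thesis using \<open>x \<in> hcomp ?N u\<close> \<open>y \<in> hcomp ?N u\<close> by (auto simp: free_module_def)
        qed
        then show ?thesis using that by (auto simp: free_module_def)
      qed
    qed (auto simp: free_module_def)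
    show "\<exists>!c. (\<forall>u. c u \<in> hcomp ?N u) \<and> finite {u. c u \<noteq> \<zero>\<^bsub>?N\<^esub>} \<and> x = finsum ?N c {u. c u \<noteq> \<zero>\<^bsub>?N\<^esub>}"
      if x: "x \<in> carrier ?N" for x
    proof -
      define c where "c = (\<lambda>u q. poly_restrict (\<lambda>m. mdeg m + mdeg q = u) (x q))"
      show ?thesis
      proof (rule ex1I[of _ c])
        have c: "c u \<in> hcomp ?N u" for u
          using x by (auto simp: c_def free_module_def in_keys_iff lookup_poly_restrict poly_mapping_eq_iff fun_eq_iff split: if_splits)
        have cc: "c u \<in> carrier ?N" for u using c[of u] by (simp add: free_module_def)
        \<comment> \<open>Only the degrees of the finitely many terms of \<open>x\<close> can
          occur.\<close>
        have "{u. c u \<noteq> 0} \<subseteq> (\<lambda>(q, m). mdeg m + mdeg q) ` (SIGMA q:S. Poly_Mapping.keys (x q))"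
        proof
          fix u assume "u \<in> {u. c u \<noteq> 0}"
          then obtain q where "c u q \<noteq> 0" by (auto simp: fun_eq_iff)
          then obtain m where m: "Poly_Mapping.lookup (c u q) m \<noteq> 0" by (auto simp: poly_mapping_eq_iff fun_eq_iff)
          then have "u = mdeg m + mdeg q" "m \<in> Poly_Mapping.keys (x q)"
            by (auto simp: c_def lookup_poly_restrict in_keys_iff split: if_splits)
          moreover then have "q \<in> S" using x by (auto simp: free_module_def)
          ultimately show "u \<in> (\<lambda>(q, m). mdeg m + mdeg q) ` (SIGMA q:S. Poly_Mapping.keys (x q))" by force
        qed
        then have fin: "finite {u. c u \<noteq> 0}" by (rule finite_subset) (use S in auto)
        have "x = (\<Sum>u | c u \<noteq> 0. c u)"
        proof (intro ext poly_mapping_eqI)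
          fix q m
          have "Poly_Mapping.lookup ((\<Sum>u | c u \<noteq> 0. c u) q) m =
            (\<Sum>u | c u \<noteq> 0. if u = mdeg m + mdeg q then Poly_Mapping.lookup (x q) m else 0)"
            by (simp add: sum_fun_apply lookup_sum) (auto simp: c_def lookup_poly_restrict intro!: sum.cong)
          also have "\<dots> = (if c (mdeg m + mdeg q) \<noteq> 0 then Poly_Mapping.lookup (x q) m else 0)"
            using fin by simp
          also have "\<dots> = Poly_Mapping.lookup (x q) m"
          proof (cases "c (mdeg m + mdeg q) = 0")
            case True
            then have "Poly_Mapping.lookup (c (mdeg m + mdeg q) q) m = 0" by simp
            then show ?thesis using True by (simp add: c_def lookup_poly_restrict)
          qed simp
          finally show "Poly_Mapping.lookup (x q) m = Poly_Mapping.lookup ((\<Sum>u | c u \<noteq> 0. c u) q) m" by simp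
        qed
        then show "(\<forall>u. c u \<in> hcomp ?N u) \<and> finite {u. c u \<noteq> \<zero>\<^bsub>?N\<^esub>} \<and> x = finsum ?N c {u. c u \<noteq> \<zero>\<^bsub>?N\<^esub>}"
          using c fin free_module_finsum[of "{u. c u \<noteq> 0}" c S, OF cc] zero by simp
        fix d assume d: "(\<forall>u. d u \<in> hcomp ?N u) \<and> finite {u. d u \<noteq> \<zero>\<^bsub>?N\<^esub>} \<and> x = finsum ?N d {u. d u \<noteq> \<zero>\<^bsub>?N\<^esub>}"
        then have dc: "d u \<in> carrier ?N" for u by (auto simp: free_module_def)
        have fin_d: "finite {u. d u \<noteq> 0}" using d zero by simp
        have d0: "Poly_Mapping.lookup (d u q) m = 0" if "u \<noteq> mdeg m + mdeg q" for u q m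
        proof (rule ccontr)
          assume "Poly_Mapping.lookup (d u q) m \<noteq> 0"
          then have "m \<in> Poly_Mapping.keys (d u q)" by (simp add: in_keys_iff)
          then show False using d that by (auto simp: free_module_def)
        qed
        have xd: "x = (\<Sum>u | d u \<noteq> 0. d u)" using d free_module_finsum[of "{u. d u \<noteq> 0}" d S, OF dc] zero by simp
        show "d = c"
        proof (intro ext poly_mapping_eqI)
          fix u q m
          have "Poly_Mapping.lookup (x q) m = (\<Sum>u | d u \<noteq> 0. Poly_Mapping.lookup (d u q) m)"
            unfolding xd by (simp add: sum_fun_apply lookup_sum)
          also have "\<dots> = (\<Sum>u\<in>insert (mdeg m + mdeg q) {u. d u \<noteq> 0}. Poly_Mapping.lookup (d u q) m)"
            by (rule sum.mono_neutral_left) (use fin_d in auto)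
          also have "\<dots> = (\<Sum>u\<in>{mdeg m + mdeg q}. Poly_Mapping.lookup (d u q) m)"
            by (rule sum.mono_neutral_right) (use fin_d d0 in auto)
          finally have eq: "Poly_Mapping.lookup (x q) m = Poly_Mapping.lookup (d (mdeg m + mdeg q) q) m" by simp
          show "Poly_Mapping.lookup (d u q) m = Poly_Mapping.lookup (c u q) m"
            by (cases "u = mdeg m + mdeg q") (auto simp: c_def lookup_poly_restrict eq d0)
        qed
      qed
    qed
    show "r \<odot>\<^bsub>?N\<^esub> x \<in> hcomp ?N (v + u)"
      if "\<forall>m\<in>Poly_Mapping.keys r. mdeg m = v" "x \<in> hcomp ?N u" for r u v x
    proof -
      have "mdeg m + mdeg q = v + u" if m: "m \<in> Poly_Mapping.keys (r * x q)" for m q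
      proof -
        obtain a b where "m = a + b" "a \<in> Poly_Mapping.keys r" "b \<in> Poly_Mapping.keys (x q)"
          using subsetD[OF keys_mult m] by blast
        then show ?thesis
          using \<open>\<forall>m\<in>Poly_Mapping.keys r. mdeg m = v\<close> \<open>x \<in> hcomp ?N u\<close>
          by (auto simp: free_module_def mdeg_add)
      qed
      then show ?thesis using that by (auto simp: free_module_def)
    qed
  qed
qed

lemma free_module_graded_free:
  assumes S: "finite S"
  shows "is_graded_free (free_module S :: ('x::finite, 'k::field, _) multigraded)"
proof -
  let ?N = "free_module S :: ('x, 'k, _) multigraded"
  interpret N: Module.module class_ring ?N by (rule free_module_module)
  let ?e = "unit_vector :: 'x mon \<Rightarrow> 'x mon \<Rightarrow> ('x, 'k) mpoly"
  have inj: "inj_on ?e T" for T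
  proof (rule inj_onI)
    fix p q assume "?e p = ?e q"
    then have "?e p p = ?e q p" by simp
    then show "p = q" by (simp add: unit_vector_def split: if_splits)
  qed
  have eN: "?e ` S \<subseteq> carrier ?N" by (auto simp: unit_vector_def free_module_def)
  have lincomb: "N.lincomb a (?e ` T) q = (if q \<in> T then a (?e q) else 0)" if T: "T \<subseteq> S" for a T q
  proof -
    have finT: "finite T" using T S finite_subset by blast
    have "N.lincomb a (?e ` T) = (\<Sum>v\<in>?e ` T. a v \<odot>\<^bsub>?N\<^esub> v)"
      unfolding N.lincomb_def
    proof (rule free_module_finsum)
      fix v assume "v \<in> ?e ` T"
      then have "v \<in> carrier ?N" using T eN by blast
      then show "a v \<odot>\<^bsub>?N\<^esub> v \<in> carrier ?N" by (simp add: free_module_def)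
    qed
    also have "\<dots> = (\<Sum>p\<in>T. a (?e p) \<odot>\<^bsub>?N\<^esub> ?e p)"
      using sum.reindex[OF inj, of "\<lambda>v. a v \<odot>\<^bsub>?N\<^esub> v" T] by (simp add: comp_def)
    finally have "N.lincomb a (?e ` T) q = (\<Sum>p\<in>T. a (?e p) * ?e p q)"
      by (simp add: sum_fun_apply free_module_def)
    also have "\<dots> = (\<Sum>p\<in>T. if p = q then a (?e q) else 0)"
      by (intro sum.cong) (auto simp: unit_vector_def)
    finally show ?thesis using finT by simp
  qed
  have "?e ` S \<subseteq> (\<Union>u. hcomp ?N u)"
  proof
    fix v assume "v \<in> ?e ` S"
    then obtain q where "q \<in> S" "v = ?e q" by blast
    then have "v \<in> hcomp ?N (mdeg q)" by (auto simp: free_module_def unit_vector_def mdeg_zero)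
    then show "v \<in> (\<Union>u. hcomp ?N u)" by blast
  qed
  moreover have "\<not> N.lin_dep (?e ` S)"
  proof (rule N.finite_lin_indpt2)
    fix a assume "N.lincomb a (?e ` S) = \<zero>\<^bsub>?N\<^esub>"
    then have "N.lincomb a (?e ` S) q = 0" for q by (simp add: free_module_def)
    then have "a (?e q) = 0" if "q \<in> S" for q using lincomb[of S a q] that by simp
    then show "\<forall>v\<in>?e ` S. a v = \<zero>\<^bsub>class_ring\<^esub>" by auto
  qed (use S eN in auto)
  moreover have "N.span (?e ` S) = carrier ?N"
  proof
    show "N.span (?e ` S) \<subseteq> carrier ?N" by (rule N.span_is_subset2[OF eN])
    show "carrier ?N \<subseteq> N.span (?e ` S)"
    proof
      fix x assume x: "x \<in> carrier ?N"
      define a where "a = (\<lambda>v. x (inv_into S ?e v))"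
      have "x = N.lincomb a (?e ` S)"
      proof
        fix q
        have "a (?e q) = x q" if "q \<in> S" using that inj[of S] by (simp add: a_def)
        moreover have "x q = 0" if "q \<notin> S" using x that by (simp add: free_module_def)
        ultimately show "x q = N.lincomb a (?e ` S) q" by (simp add: lincomb[of S a])
      qed
      then show "x \<in> N.span (?e ` S)" unfolding N.span_def using S by auto
    qed
  qed
  ultimately show ?thesis unfolding is_graded_free_def using free_module_graded[OF S] by blast
qed

section \<open>Tensoring the polynomial ring with a space spanned by one vector\<close>

lemma ring_module_module: "module class_ring (ring_module :: ('x::finite, 'k::field, _) multigraded)"
proof (rule moduleI)
  show "cring (class_ring :: ('x, 'k) mpoly ring)" by (rule cring_class_ring)
  show "abelian_group (ring_module :: ('x, 'k, _) multigraded)"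
  proof (rule abelian_groupI)
    fix x :: "('x, 'k) mpoly"
    show "\<exists>y\<in>carrier ring_module. y \<oplus>\<^bsub>ring_module\<^esub> x = \<zero>\<^bsub>ring_module\<^esub>"
      by (intro bexI[of _ "- x"]) (auto simp: ring_module_def)
  qed (auto simp: ring_module_def algebra_simps)
qed (auto simp: ring_module_def algebra_simps)

text \<open>The tensor of the polynomial \<open>r\<close> with the vector \<open>b\<close>.\<close>

definition coeff_tensor :: "('k::field, 'v) module \<Rightarrow> 'v \<Rightarrow> ('x::finite, 'k) mpoly \<Rightarrow> 'x mon \<Rightarrow> 'v" where
  "coeff_tensor V b r = (\<lambda>m. Poly_Mapping.lookup r m \<odot>\<^bsub>V\<^esub> b)"

text \<open>The generator may be zero, so that vanishing and one-dimensional summands are treated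
  alike.\<close>

locale cyclic_space = V: Module.module "class_ring :: 'k ring" V for V :: "('k::field, 'v) module" +
  fixes b :: 'v
  assumes gen_closed: "b \<in> carrier V" and gen: "carrier V = range (\<lambda>a. a \<odot>\<^bsub>V\<^esub> b)"
begin

lemma smult_gen_closed [simp]: "a \<odot>\<^bsub>V\<^esub> b \<in> carrier V"
  using gen by auto

lemma smult_gen_zero [simp]: "0 \<odot>\<^bsub>V\<^esub> b = \<zero>\<^bsub>V\<^esub>"
  using V.smult_l_null[OF gen_closed] by simp

lemma smult_gen_add: "(a + c) \<odot>\<^bsub>V\<^esub> b = a \<odot>\<^bsub>V\<^esub> b \<oplus>\<^bsub>V\<^esub> c \<odot>\<^bsub>V\<^esub> b"
  using V.smult_l_distr[of a c b] gen_closed by simp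

lemma smult_gen_mult: "(a * c) \<odot>\<^bsub>V\<^esub> b = a \<odot>\<^bsub>V\<^esub> (c \<odot>\<^bsub>V\<^esub> b)"
  using V.smult_assoc1[of a c b] gen_closed by simp

lemma smult_gen_sum: "(\<Sum>i\<in>A. a i) \<odot>\<^bsub>V\<^esub> b = (\<Oplus>\<^bsub>V\<^esub>i\<in>A. a i \<odot>\<^bsub>V\<^esub> b)"
proof (induction A rule: infinite_finite_induct)
  case (insert i A)
  then have "finsum V (\<lambda>i. a i \<odot>\<^bsub>V\<^esub> b) (insert i A) = a i \<odot>\<^bsub>V\<^esub> b \<oplus>\<^bsub>V\<^esub> finsum V (\<lambda>i. a i \<odot>\<^bsub>V\<^esub> b) A"
    by (intro V.M.finsum_insert) auto
  then show ?case using insert by (simp add: smult_gen_add)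
qed (auto simp: V.M.finsum_infinite)

lemma coeff_tensor_closed: "coeff_tensor V b r \<in> carrier (poly_tensor V)"
proof -
  have "finite {m. Poly_Mapping.lookup r m \<odot>\<^bsub>V\<^esub> b \<noteq> \<zero>\<^bsub>V\<^esub>}"
    by (rule finite_subset[of _ "{m. Poly_Mapping.lookup r m \<noteq> 0}"]) auto
  then show ?thesis by (auto simp: poly_tensor_def coeff_tensor_def Let_def)
qed

lemma coeff_tensor_surj:
  assumes "f \<in> carrier (poly_tensor V)"
  shows "\<exists>r. f = coeff_tensor V b r \<and> Poly_Mapping.keys r \<subseteq> {m. f m \<noteq> \<zero>\<^bsub>V\<^esub>}"
proof -
  have f: "\<And>m. f m \<in> carrier V" "finite {m. f m \<noteq> \<zero>\<^bsub>V\<^esub>}"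
    using assms by (auto simp: poly_tensor_def Let_def)
  then have "\<forall>m. \<exists>a. f m = a \<odot>\<^bsub>V\<^esub> b" using gen by auto
  then obtain a where a: "\<And>m. f m = a m \<odot>\<^bsub>V\<^esub> b" by metis
  \<comment> \<open>Where \<open>f\<close> vanishes the chosen scalar is arbitrary if
    \<open>b\<close> is zero; resetting it to 0 keeps the support finite and inside that of
    \<open>f\<close>.\<close>
  define c where "c = (\<lambda>m. if f m = \<zero>\<^bsub>V\<^esub> then 0 else a m)"
  have fc: "finite {m. c m \<noteq> 0}" by (rule finite_subset[OF _ f(2)]) (auto simp: c_def)
  have "f m = c m \<odot>\<^bsub>V\<^esub> b" for m using a[of m] by (auto simp: c_def)
  then have "f = coeff_tensor V b (Abs_poly_mapping c)" using fc by (auto simp: coeff_tensor_def)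
  moreover have "Poly_Mapping.keys (Abs_poly_mapping c) \<subseteq> {m. f m \<noteq> \<zero>\<^bsub>V\<^esub>}"
    using fc by (auto simp: in_keys_iff c_def)
  ultimately show ?thesis by blast
qed

lemma coeff_tensor_add: "coeff_tensor V b (r + s) = coeff_tensor V b r \<oplus>\<^bsub>poly_tensor V\<^esub> coeff_tensor V b s"
  by (auto simp: coeff_tensor_def poly_tensor_def Let_def lookup_add smult_gen_add)

lemma coeff_tensor_zero: "coeff_tensor V b 0 = \<zero>\<^bsub>poly_tensor V\<^esub>"
  by (auto simp: coeff_tensor_def poly_tensor_def Let_def)

lemma coeff_tensor_smult: "coeff_tensor V b (r * s) = r \<odot>\<^bsub>poly_tensor V\<^esub> coeff_tensor V b s"
  by (auto simp: coeff_tensor_def poly_tensor_def Let_def lookup_mult_atMost smult_gen_sum smult_gen_mult)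

lemma poly_tensor_module: "module class_ring (poly_tensor V :: ('x::finite, 'k, 'x mon \<Rightarrow> 'v) multigraded)"
proof (rule module_image[OF ring_module_module, where h = "coeff_tensor V b"])
  show "coeff_tensor V b ` carrier ring_module = carrier (poly_tensor V :: ('x::finite, 'k, 'x mon \<Rightarrow> 'v) multigraded)"
    using coeff_tensor_closed coeff_tensor_surj by (fastforce simp: ring_module_def)
qed (auto simp: ring_module_def coeff_tensor_add coeff_tensor_zero coeff_tensor_smult)

lemma coeff_tensor_hcomp:
  fixes u :: "'x::finite \<Rightarrow> int"
  shows "hcomp (poly_tensor V) u = coeff_tensor V b ` {r. \<forall>m\<in>Poly_Mapping.keys r. mdeg m = u}"
proof (intro equalityI subsetI)
  fix f :: "'x mon \<Rightarrow> 'v" assume "f \<in> hcomp (poly_tensor V) u"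
  then have "f \<in> carrier (poly_tensor V)" and deg: "\<And>m. f m \<noteq> \<zero>\<^bsub>V\<^esub> \<Longrightarrow> mdeg m = u"
    by (auto simp: poly_tensor_def Let_def)
  then show "f \<in> coeff_tensor V b ` {r. \<forall>m\<in>Poly_Mapping.keys r. mdeg m = u}"
    using coeff_tensor_surj by blast
next
  fix f :: "'x mon \<Rightarrow> 'v" assume "f \<in> coeff_tensor V b ` {r. \<forall>m\<in>Poly_Mapping.keys r. mdeg m = u}"
  then obtain r where r: "f = coeff_tensor V b r" "\<forall>m\<in>Poly_Mapping.keys r. mdeg m = u" by blast
  have "mdeg m = u" if "f m \<noteq> \<zero>\<^bsub>V\<^esub>" for m
    using that r by (cases "Poly_Mapping.lookup r m = 0") (auto simp: coeff_tensor_def in_keys_iff)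
  then show "f \<in> hcomp (poly_tensor V) u"
    using coeff_tensor_closed[of r] r(1) by (auto simp: poly_tensor_def Let_def)
qed

lemma finsum_coeff_tensor:
  fixes r :: "'i \<Rightarrow> ('x::finite, 'k) mpoly"
  shows "finsum (poly_tensor V) (\<lambda>i. coeff_tensor V b (r i)) A = coeff_tensor V b (\<Sum>i\<in>A. r i)"
proof -
  interpret T: Module.module class_ring "poly_tensor V :: ('x, 'k, 'x mon \<Rightarrow> 'v) multigraded"
    by (rule poly_tensor_module)
  interpret R: Module.module class_ring "ring_module :: ('x, 'k, ('x, 'k) mpoly) multigraded"
    by (rule ring_module_module)
  have "coeff_tensor V b (finsum ring_module r A) = finsum (poly_tensor V) (\<lambda>i. coeff_tensor V b (r i)) A"
    by (rule hom_finsum_abelian[OF R.M.abelian_monoid_axioms T.M.abelian_monoid_axioms])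
      (auto simp: ring_module_def coeff_tensor_closed coeff_tensor_add coeff_tensor_zero)
  moreover have "finsum ring_module r A = sum r A"
    by (rule finsum_eq_sum[OF R.M.abelian_monoid_axioms]) (auto simp: ring_module_def)
  ultimately show ?thesis by simp
qed

end

text \<open>In coordinates, shifting by \<open>n\<close> and applying a map with matrix entry
  \<open>c\<close> is multiplication by a single term. This turns the homogenized differential into
  a matrix over the polynomial ring.\<close>

lemma tensor_map_coeff_tensor:
  assumes W: "cyclic_space W b'" and \<phi>: "\<And>a. \<phi> (a \<odot>\<^bsub>V\<^esub> b) = (a * c) \<odot>\<^bsub>W\<^esub> b'"
  shows "tensor_map n \<phi> W (coeff_tensor V b r) = coeff_tensor W b' (Poly_Mapping.single n c * r)"
proof
  interpret W: cyclic_space W b' by (rule W)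
  show "tensor_map n \<phi> W (coeff_tensor V b r) m = coeff_tensor W b' (Poly_Mapping.single n c * r) m" for m
    by (simp add: tensor_map_def coeff_tensor_def \<phi> lookup_single_mult mult.commute[of c])
qed

text \<open>\<open>I\<close> indexes all summands and \<open>S\<close> those that survive: outside
  \<open>S\<close> the spanning vector is zero. The tensor sum over \<open>I\<close> is then free on
  \<open>S\<close>.\<close>

locale free_presentation =
  fixes I S :: "'x::finite mon set" and V :: "'x mon \<Rightarrow> ('k::field, 'v) module" and b :: "'x mon \<Rightarrow> 'v"
  assumes finite_index: "finite I" and SI: "S \<subseteq> I"
    and cyclic: "\<And>q. q \<in> I \<Longrightarrow> cyclic_space (V q) (b q)"
    and free: "\<And>q a. q \<in> S \<Longrightarrow> a \<odot>\<^bsub>V q\<^esub> b q = \<zero>\<^bsub>V q\<^esub> \<Longrightarrow> a = 0"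
    and trivial: "\<And>q. q \<in> I - S \<Longrightarrow> b q = \<zero>\<^bsub>V q\<^esub>"
begin

definition Psi :: "('x mon \<Rightarrow> ('x, 'k) mpoly) \<Rightarrow> 'x mon \<Rightarrow> 'x mon \<Rightarrow> 'v" where
  "Psi g = (\<lambda>q\<in>I. coeff_tensor (V q) (b q) (g q))"

abbreviation "tensor_sum \<equiv> graded_dsum I (\<lambda>q. degree_shift (poly_tensor (V q)) (- mdeg q)) ::
  ('x, 'k, 'x mon \<Rightarrow> 'x mon \<Rightarrow> 'v) multigraded"

lemma coeff_tensor_trivial:
  fixes r :: "('x, 'k) mpoly"
  assumes q: "q \<in> I - S"
  shows "coeff_tensor (V q) (b q) r = coeff_tensor (V q) (b q) 0"
proof
  fix m :: "'x mon"
  interpret cyclic_space "V q" "b q" using cyclic q by blast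
  show "coeff_tensor (V q) (b q) r m = coeff_tensor (V q) (b q) 0 m"
    using trivial[OF q] V.smult_r_null by (simp add: coeff_tensor_def)
qed

lemma Psi_iso: "graded_iso (free_module S) tensor_sum Psi"
proof (rule graded_iso.intro)
  have cong: "coeff_tensor (V q) (b q) r \<in> carrier (poly_tensor (V q))" if "q \<in> I" for q and r :: "('x, 'k) mpoly"
    using cyclic_space.coeff_tensor_closed[OF cyclic[OF that]] .
  show "module class_ring (free_module S :: ('x, 'k, _) multigraded)" by (rule free_module_module)
  show "bij_betw Psi (carrier (free_module S)) (carrier tensor_sum)"
    unfolding bij_betw_def
  proof (intro conjI equalityI subsetI)
    show "inj_on Psi (carrier (free_module S))"
    proof (rule inj_onI)
      fix g g' assume g: "g \<in> carrier (free_module S)" "g' \<in> carrier (free_module S)" and eq: "Psi g = Psi g'"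
      show "g = g'"
      proof (intro ext poly_mapping_eqI)
        fix q m
        show "Poly_Mapping.lookup (g q) m = Poly_Mapping.lookup (g' q) m"
        proof (cases "q \<in> S")
          case True
          then interpret cyclic_space "V q" "b q" using cyclic SI by blast
          let ?x = "Poly_Mapping.lookup (g q) m" and ?y = "Poly_Mapping.lookup (g' q) m"
          have "Psi g q m = Psi g' q m" using eq by simp
          then have xy: "?x \<odot>\<^bsub>V q\<^esub> b q = ?y \<odot>\<^bsub>V q\<^esub> b q"
            using True SI by (auto simp: Psi_def coeff_tensor_def)
          have "(?x - ?y) \<odot>\<^bsub>V q\<^esub> b q = ?y \<odot>\<^bsub>V q\<^esub> b q \<oplus>\<^bsub>V q\<^esub> (- ?y) \<odot>\<^bsub>V q\<^esub> b q"
            using smult_gen_add[of ?x "- ?y"] xy by simp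
          also have "\<dots> = \<zero>\<^bsub>V q\<^esub>" using smult_gen_add[of ?y "- ?y"] by simp
          finally have "?x - ?y = 0" by (rule free[OF True])
          then show ?thesis by simp
        next
          case False
          then show ?thesis using g by (simp add: free_module_def)
        qed
      qed
    qed
    fix f assume "f \<in> Psi ` carrier (free_module S)"
    then show "f \<in> carrier tensor_sum"
      using cong finite_index by (auto simp: Psi_def graded_dsum_def degree_shift_def Let_def)
  next
    fix f assume f: "f \<in> carrier tensor_sum"
    have "\<exists>r. f q = coeff_tensor (V q) (b q) r" if q: "q \<in> I" for q
    proof -
      have "f q \<in> carrier (poly_tensor (V q))"
        using f q by (auto simp: graded_dsum_def degree_shift_def Let_def)
      then show ?thesis using cyclic_space.coeff_tensor_surj[OF cyclic[OF q]] by blast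
    qed
    then obtain r where r: "\<And>q. q \<in> I \<Longrightarrow> f q = coeff_tensor (V q) (b q) (r q)" by metis
    \<comment> \<open>Coordinates outside \<open>S\<close> may be discarded, as every polynomial has
      the same image, zero, in such a summand.\<close>
    define g where "g = (\<lambda>q. if q \<in> S then r q else 0)"
    have "f = Psi g"
    proof
      fix q
      show "f q = Psi g q"
      proof (cases "q \<in> I")
        case True
        then show ?thesis using r[OF True] coeff_tensor_trivial[of q "r q"] by (auto simp: Psi_def g_def)
      next
        case False
        moreover have "f \<in> extensional I" using f by (simp add: graded_dsum_def Let_def PiE_def)
        ultimately show ?thesis by (simp add: Psi_def extensional_def)
      qed
    qed
    then show "f \<in> Psi ` carrier (free_module S)" by (auto simp: g_def free_module_def)
  qed
  show "Psi (x \<oplus>\<^bsub>free_module S\<^esub> y) = Psi x \<oplus>\<^bsub>tensor_sum\<^esub> Psi y" for x y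
    by (auto simp: Psi_def graded_dsum_def degree_shift_def free_module_def Let_def
        cyclic_space.coeff_tensor_add[OF cyclic])
  show "Psi (a \<odot>\<^bsub>free_module S\<^esub> x) = a \<odot>\<^bsub>tensor_sum\<^esub> Psi x" for a x
    by (auto simp: Psi_def graded_dsum_def degree_shift_def free_module_def Let_def
        cyclic_space.coeff_tensor_smult[OF cyclic])
  show "Psi \<zero>\<^bsub>free_module S\<^esub> = \<zero>\<^bsub>tensor_sum\<^esub>"
    by (auto simp: Psi_def graded_dsum_def degree_shift_def free_module_def Let_def
        cyclic_space.coeff_tensor_zero[OF cyclic])
  show "Psi ` hcomp (free_module S) u = hcomp tensor_sum u" for u
  proof (intro equalityI subsetI)
    fix f assume "f \<in> Psi ` hcomp (free_module S) u"
    then obtain g where g: "f = Psi g" "\<And>q m. m \<in> Poly_Mapping.keys (g q) \<Longrightarrow> mdeg m + mdeg q = u"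
      by (auto simp: free_module_def)
    have "mdeg m = - mdeg q + u" if "m \<in> Poly_Mapping.keys (g q)" for q m
      using g(2)[OF that] by (auto simp: algebra_simps)
    then have "f q \<in> hcomp (poly_tensor (V q)) (- mdeg q + u)" if q: "q \<in> I" for q
      unfolding cyclic_space.coeff_tensor_hcomp[OF cyclic[OF q]] g(1)
      using q by (auto simp: Psi_def intro!: imageI)
    moreover have "f \<in> carrier tensor_sum"
      unfolding g(1) using cong finite_index by (auto simp: Psi_def graded_dsum_def degree_shift_def Let_def)
    ultimately show "f \<in> hcomp tensor_sum u" by (auto simp: graded_dsum_def degree_shift_def Let_def)
  next
    fix f assume f: "f \<in> hcomp tensor_sum u"
    have "\<exists>r. f q = coeff_tensor (V q) (b q) r \<and> (\<forall>m\<in>Poly_Mapping.keys r. mdeg m = - mdeg q + u)" if q: "q \<in> I" for q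
    proof -
      have "f q \<in> hcomp (poly_tensor (V q)) (- mdeg q + u)"
        using f q by (auto simp: graded_dsum_def degree_shift_def Let_def)
      then show ?thesis unfolding cyclic_space.coeff_tensor_hcomp[OF cyclic[OF q]] by blast
    qed
    then obtain r where r: "\<And>q. q \<in> I \<Longrightarrow> f q = coeff_tensor (V q) (b q) (r q)"
      "\<And>q m. q \<in> I \<Longrightarrow> m \<in> Poly_Mapping.keys (r q) \<Longrightarrow> mdeg m = - mdeg q + u" by metis
    define g where "g = (\<lambda>q. if q \<in> S then r q else 0)"
    have "f = Psi g"
    proof
      fix q
      show "f q = Psi g q"
      proof (cases "q \<in> I")
        case True
        then show ?thesis using r(1)[OF True] coeff_tensor_trivial[of q "r q"] by (auto simp: Psi_def g_def)
      next
        case False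
        moreover have "f \<in> extensional I" using f by (simp add: graded_dsum_def Let_def PiE_def)
        ultimately show ?thesis by (simp add: Psi_def extensional_def)
      qed
    qed
    moreover have "g \<in> hcomp (free_module S) u"
      using r(2) SI by (auto simp: g_def free_module_def)
    ultimately show "f \<in> Psi ` hcomp (free_module S) u" by blast
  qed
qed

end

section \<open>Monomial ideals and the lcm-lattice\<close>

text \<open>A decreasing subsequence stabilises from the place where its minimum is attained, and
  its constant tail also counts as increasing.\<close>

lemma nat_incseq_subseq:
  fixes a :: "nat \<Rightarrow> nat"
  shows "\<exists>s. strict_mono s \<and> incseq (\<lambda>n. a (s n))"
proof -
  obtain t where t: "strict_mono t" "monoseq (\<lambda>n. a (t n))" using seq_monosub by blast
  show ?thesis
  proof (cases "incseq (\<lambda>n. a (t n))")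
    case True
    then show ?thesis using t(1) by blast
  next
    case False
    then have dec: "decseq (\<lambda>n. a (t n))" using t(2) by (auto simp: monoseq_iff)
    obtain N where N: "\<And>n. a (t N) \<le> a (t n)" using ex_has_least_nat[of "\<lambda>_. True" 0 "\<lambda>n. a (t n)"] by auto
    have const: "a (t (N + n)) = a (t N)" for n
      using decseqD[OF dec, of N "N + n"] N[of "N + n"] by simp
    have "strict_mono (\<lambda>n. t (N + n))" using t(1) by (simp add: strict_mono_def)
    moreover have "incseq (\<lambda>n. a (t (N + n)))" by (simp add: const incseq_def)
    ultimately show ?thesis by blast
  qed
qed

lemma incseq_subseq_coordinates:
  fixes f :: "nat \<Rightarrow> 'x \<Rightarrow> nat"
  assumes "finite X"
  shows "\<exists>s. strict_mono s \<and> (\<forall>x\<in>X. incseq (\<lambda>n. f (s n) x))"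
  using assms
proof (induction X rule: finite_induct)
  case empty
  then show ?case using strict_mono_id by auto
next
  case (insert y X)
  then obtain s where s: "strict_mono s" "\<forall>x\<in>X. incseq (\<lambda>n. f (s n) x)" by blast
  obtain t where t: "strict_mono t" "incseq (\<lambda>n. f (s (t n)) y)"
    using nat_incseq_subseq[of "\<lambda>n. f (s n) y"] by blast
  have "incseq (\<lambda>n. f (s (t n)) x)" if "x \<in> X" for x
    using s(2) that t(1) by (auto simp: incseq_def strict_mono_less_eq)
  moreover have "strict_mono (\<lambda>n. s (t n))" using s(1) t(1) by (simp add: strict_mono_def)
  ultimately show ?case using t(2) by blast
qed

text \<open>Dickson's lemma: an infinite antichain would contain a sequence of distinct elements
  that increases in every coordinate, and its first two terms would be comparable.\<close>

lemma dickson_finite_antichain: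
  fixes A :: "('x::finite \<Rightarrow> nat) set"
  assumes "\<And>a b. a \<in> A \<Longrightarrow> b \<in> A \<Longrightarrow> a \<le> b \<Longrightarrow> a = b"
  shows "finite A"
proof (rule ccontr)
  assume "infinite A"
  then obtain f :: "nat \<Rightarrow> 'x \<Rightarrow> nat" where f: "inj f" "range f \<subseteq> A"
    using infinite_countable_subset by blast
  obtain s where s: "strict_mono s" "\<forall>x\<in>UNIV. incseq (\<lambda>n. f (s n) x)"
    using incseq_subseq_coordinates[of UNIV f] by auto
  have "f (s 0) \<le> f (s 1)" using s(2) by (auto simp: le_fun_def incseq_def)
  then have "f (s 0) = f (s 1)" using assms f(2) by blast
  then have "s 0 = s 1" using f(1) by (simp add: inj_eq)
  then show False using s(1) by (simp add: strict_mono_eq)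
qed

section \<open>Membership in a monomial ideal\<close>

lemma sum_single_keys: "(\<Sum>m\<in>Poly_Mapping.keys r. Poly_Mapping.single m (Poly_Mapping.lookup r m)) = r"
proof (rule poly_mapping_eqI)
  fix k
  have "(\<Sum>m\<in>Poly_Mapping.keys r. Poly_Mapping.lookup (Poly_Mapping.single m (Poly_Mapping.lookup r m)) k) =
    (\<Sum>m\<in>Poly_Mapping.keys r. if m = k then Poly_Mapping.lookup r k else 0)"
    by (intro sum.cong) (auto simp: lookup_single when_def)
  then show "Poly_Mapping.lookup (\<Sum>m\<in>Poly_Mapping.keys r. Poly_Mapping.single m (Poly_Mapping.lookup r m)) k = Poly_Mapping.lookup r k"
    by (simp add: lookup_sum in_keys_iff)
qed

lemma ideal_class_ring:
  fixes M :: "'a::comm_ring_1 set"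
  assumes "ideal M class_ring"
  shows "0 \<in> M" and "r \<in> M \<Longrightarrow> s \<in> M \<Longrightarrow> r + s \<in> M" and "r \<in> M \<Longrightarrow> s * r \<in> M" and "r \<in> M \<Longrightarrow> s \<in> M \<Longrightarrow> r - s \<in> M"
proof -
  interpret M: ideal M class_ring by fact
  show zero: "0 \<in> M" using M.zero_closed by simp
  show add: "r + s \<in> M" if "r \<in> M" "s \<in> M" for r s using M.a_closed[OF that] by simp
  show mult: "s * r \<in> M" if "r \<in> M" for r s using M.I_l_closed[OF that, of s] by simp
  show "r - s \<in> M" if "r \<in> M" "s \<in> M" using add[OF that(1) mult[OF that(2), of "- 1"]] by simp
qed

lemma idl_ideal: "ideal (Idl\<^bsub>class_ring\<^esub> S) (class_ring :: 'a::comm_ring_1 ring)"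
  by (rule ring.genideal_ideal[OF cring.axioms(1)[OF cring_class_ring]]) simp

lemma idl_self: "S \<subseteq> Idl\<^bsub>class_ring\<^esub> (S :: 'a::comm_ring_1 set)"
  by (rule ring.genideal_self[OF cring.axioms(1)[OF cring_class_ring]]) simp

lemma single_split:
  fixes s m :: "'x::finite mon"
  assumes "s \<le> m"
  shows "Poly_Mapping.single m (c :: 'k::field) = Poly_Mapping.single (m - s) c * monomial s"
proof -
  have "m - s + s = m" using assms by (auto simp: le_fun_def)
  then show ?thesis by (simp add: monomial_def mult_single)
qed

text \<open>Properness keeps the monomial 1 out of the minimal generators, so that these are
  distinct from the minimum of the lcm-lattice.\<close>

locale proper_monomial_ideal =
  fixes M :: "('x::finite, 'k::field) mpoly set"
  assumes monomial_ideal: "monomial_ideal M" and proper: "M \<noteq> UNIV"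
begin

lemma ideal: "ideal M class_ring"
  using monomial_ideal idl_ideal by (auto simp: monomial_ideal_def)

lemmas ideal_closed = ideal_class_ring[OF ideal]

lemma monomial_up: "monomial s \<in> M \<Longrightarrow> s \<le> m \<Longrightarrow> Poly_Mapping.single m c \<in> M"
  using ideal_closed(3) single_split by metis

lemma sum_closed: "(\<And>a. a \<in> A \<Longrightarrow> f a \<in> M) \<Longrightarrow> sum f A \<in> M"
  by (induction A rule: infinite_finite_induct) (auto intro: ideal_closed)

text \<open>The polynomials whose monomials are all divisible by some element of \<open>S\<close>
  form an ideal containing the generators, hence containing \<open>M\<close>; so each monomial of an
  element of \<open>M\<close> is a multiple of a generator in \<open>M\<close>.\<close>

lemma mem_iff: "r \<in> M \<longleftrightarrow> (\<forall>m\<in>Poly_Mapping.keys r. monomial m \<in> M)"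
proof
  assume "\<forall>m\<in>Poly_Mapping.keys r. monomial m \<in> M"
  then have "(\<Sum>m\<in>Poly_Mapping.keys r. Poly_Mapping.single m (Poly_Mapping.lookup r m)) \<in> M"
    by (intro sum_closed) (auto intro: monomial_up)
  then show "r \<in> M" by (simp add: sum_single_keys)
next
  assume r: "r \<in> M"
  obtain S where S: "M = Idl\<^bsub>class_ring\<^esub> (monomial ` S)" using monomial_ideal by (auto simp: monomial_ideal_def)
  define U where "U = {m :: 'x mon. \<exists>s\<in>S. s \<le> m}"
  define J where "J = {r :: ('x, 'k) mpoly. Poly_Mapping.keys r \<subseteq> U}"
  have up: "a + m \<in> U" if m: "m \<in> U" for a m
  proof -
    obtain s where "s \<in> S" "s \<le> m" using m by (auto simp: U_def)
    moreover then have "s \<le> a + m" by (auto simp: le_fun_def intro: trans_le_add2)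
    ultimately show ?thesis by (auto simp: U_def)
  qed
  have mult: "r * s \<in> J" if s: "s \<in> J" for r s
    using keys_mult[of r s] s up by (fastforce simp: J_def)
  have "ideal J (class_ring :: ('x, 'k) mpoly ring)"
  proof (rule idealI)
    show "ring (class_ring :: ('x, 'k) mpoly ring)" using cring_class_ring cring.axioms(1) by blast
    show "subgroup J (add_monoid class_ring)"
    proof (rule subgroup.intro)
      show "x \<otimes>\<^bsub>add_monoid class_ring\<^esub> y \<in> J" if "x \<in> J" "y \<in> J" for x y
        using that keys_add[of x y] by (auto simp: J_def)
      show "inv\<^bsub>add_monoid class_ring\<^esub> x \<in> J" if "x \<in> J" for x
      proof -
        have "inv\<^bsub>add_monoid class_ring\<^esub> x = \<ominus>\<^bsub>class_ring\<^esub> x" by (simp add: a_inv_def)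
        also have "\<dots> = - x" by (simp add: class_ring_simps)
        finally show ?thesis using that by (simp add: J_def keys_minus)
      qed
    qed (auto simp: J_def)
  qed (use mult in \<open>auto simp: mult.commute\<close>)
  moreover have "monomial ` S \<subseteq> J" by (auto simp: J_def U_def monomial_def)
  ultimately have "M \<subseteq> J" unfolding S genideal_def by blast
  then have "\<exists>s\<in>S. s \<le> m" if "m \<in> Poly_Mapping.keys r" for m using that r by (auto simp: J_def U_def)
  moreover have "monomial s \<in> M" if "s \<in> S" for s using that idl_self[of "monomial ` S"] S by blast
  ultimately show "\<forall>m\<in>Poly_Mapping.keys r. monomial m \<in> M"
    unfolding monomial_def[where 'k = 'k] using monomial_up[unfolded monomial_def] by blast
qed

abbreviation "G \<equiv> min_gens M"
abbreviation "L \<equiv> lcm_lattice M"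

lemma finite_gens: "finite G"
  by (rule dickson_finite_antichain) (auto simp: min_gens_def)

text \<open>A monomial has finitely many divisors, so among those in \<open>M\<close> there is a
  minimal one, and it is minimal in \<open>M\<close> altogether.\<close>

lemma gen_below: "monomial m \<in> M \<longleftrightarrow> (\<exists>g\<in>G. g \<le> m)"
proof
  assume m: "monomial m \<in> M"
  let ?A = "{a. a \<le> m \<and> monomial a \<in> M}"
  have "finite ?A" using finite_atMost_fun[of m] by (rule finite_subset[rotated]) auto
  then obtain g where g: "g \<in> ?A" "\<forall>a\<in>?A. a \<le> g \<longrightarrow> a = g" using finite_has_minimal2[of ?A m] m by auto
  then have "g \<in> G" by (auto simp: min_gens_def intro: order_trans)
  then show "\<exists>g\<in>G. g \<le> m" using g(1) by blast
next
  assume "\<exists>g\<in>G. g \<le> m"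
  then show "monomial m \<in> M" using monomial_up[of _ m 1] by (auto simp: min_gens_def monomial_def)
qed

lemma zero_le_fun: "0 \<le> (m :: 'x mon)"
  by (auto simp: le_fun_def)

lemma zero_not_gen: "0 \<notin> G"
proof
  assume "0 \<in> G"
  then have "monomial m \<in> M" for m using gen_below[of m] zero_le_fun[of m] by blast
  then have "r \<in> M" for r using mem_iff by blast
  then show False using proper by blast
qed

section \<open>The lcm-lattice\<close>

lemma lcm_props:
  assumes "S \<subseteq> G"
  shows "\<And>m. m \<in> S \<Longrightarrow> m \<le> (LEAST u. \<forall>m\<in>S. m \<le> u)"
    and "\<And>u. (\<And>m. m \<in> S \<Longrightarrow> m \<le> u) \<Longrightarrow> (LEAST u. \<forall>m\<in>S. m \<le> u) \<le> u"
proof -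
  have fin: "finite S" using assms finite_gens finite_subset by blast
  \<comment> \<open>The coordinatewise maximum; the inserted 0 makes the empty set have the least
    common multiple 1.\<close>
  define t where "t = (\<lambda>x. Max (insert 0 ((\<lambda>m. m x) ` S)))"
  have ub: "m \<le> t" if "m \<in> S" for m using that fin by (auto simp: t_def le_fun_def)
  have least: "t \<le> u" if "\<forall>m\<in>S. m \<le> u" for u using that fin by (auto simp: t_def le_fun_def)
  have "(LEAST u. \<forall>m\<in>S. m \<le> u) = t" by (rule Least_equality) (use ub least in auto)
  then show "\<And>m. m \<in> S \<Longrightarrow> m \<le> (LEAST u. \<forall>m\<in>S. m \<le> u)"
    and "\<And>u. (\<And>m. m \<in> S \<Longrightarrow> m \<le> u) \<Longrightarrow> (LEAST u. \<forall>m\<in>S. m \<le> u) \<le> u"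
    using ub least by auto
qed

lemma finite_lattice: "finite L"
proof -
  have "L = (\<lambda>S. LEAST u. \<forall>m\<in>S. m \<le> u) ` Pow G" by (auto simp: lcm_lattice_def)
  then show ?thesis using finite_gens by simp
qed

lemma zero_in_lattice: "0 \<in> L"
proof -
  have "(LEAST u. \<forall>m\<in>{}. m \<le> (u :: 'x mon)) = 0"
    using lcm_props(2)[of "{}" 0] zero_le_fun by (auto intro: antisym)
  then show ?thesis unfolding lcm_lattice_def by (intro CollectI exI[of _ "{}"]) auto
qed

lemma gens_in_lattice: "G \<subseteq> L"
proof
  fix g assume g: "g \<in> G"
  have "(LEAST u. \<forall>m\<in>{g}. m \<le> u) = g"
    using lcm_props[of "{g}"] g by (intro antisym) auto
  then show "g \<in> L" using g unfolding lcm_lattice_def by (intro CollectI exI[of _ "{g}"]) auto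
qed

lemma gen_below_lattice:
  assumes "p \<in> L" "p \<noteq> 0"
  shows "\<exists>g\<in>G. g \<le> p"
proof -
  obtain S where S: "S \<subseteq> G" "p = (LEAST u. \<forall>m\<in>S. m \<le> u)" using assms(1) by (auto simp: lcm_lattice_def)
  have "S \<noteq> {}"
  proof
    assume "S = {}"
    then have "p \<le> 0" using lcm_props(2)[of S 0] S by auto
    then show False using assms(2) zero_le_fun[of p] by auto
  qed
  then show ?thesis using lcm_props(1)[OF S(1)] S by blast
qed

text \<open>The least common multiple of the generators dividing \<open>u\<close> serves: an element
  of \<open>L\<close> that divides \<open>u\<close> is built from some of these generators.\<close>

lemma lattice_top_below: "\<exists>t\<in>L. t \<le> u \<and> (\<forall>p\<in>L. p \<le> u \<longrightarrow> p \<le> t)"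
proof -
  define S where "S = {g \<in> G. g \<le> u}"
  define t where "t = (LEAST v. \<forall>m\<in>S. m \<le> v)"
  have SG: "S \<subseteq> G" by (auto simp: S_def)
  have "t \<in> L" using SG by (auto simp: lcm_lattice_def t_def)
  moreover have "t \<le> u" unfolding t_def by (rule lcm_props(2)[OF SG]) (auto simp: S_def)
  moreover have "p \<le> t" if p: "p \<in> L" "p \<le> u" for p
  proof -
    obtain T where T: "T \<subseteq> G" "p = (LEAST v. \<forall>m\<in>T. m \<le> v)" using p(1) by (auto simp: lcm_lattice_def)
    have "T \<subseteq> S" using lcm_props(1)[OF T(1)] T p(2) by (auto simp: S_def intro: order_trans)
    then show ?thesis unfolding T(2) using lcm_props(1)[OF SG] by (intro lcm_props(2)[OF T(1)]) (auto simp: t_def)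
  qed
  ultimately show ?thesis by blast
qed

lemma zero_hat_eq: "0 \<in> P \<Longrightarrow> zero_hat P = (0 :: 'x mon)"
  unfolding zero_hat_def by (rule Least_equality) (auto simp: zero_le_fun)

end

section \<open>The Betti poset of a rigid ideal\<close>

lemma cycles_chains_of: "simpl_cycles (order_complex Q) (int n - 1) = {c \<in> chains_of Q n. simpl_boundary c = 0}"
  by (simp add: simpl_cycles_def chains_of_def)

lemma boundaries_chains_of: "simpl_boundaries (order_complex Q) (int n - 1) = simpl_boundary ` chains_of Q (Suc n)"
  by (simp add: simpl_boundaries_def chains_of_def)

lemma hdim_order_complex_eq_0:
  assumes "finite Q"
  shows "hdim TYPE('k::field) (order_complex Q) (int n - 1) = 0 \<longleftrightarrow>
    (\<forall>c\<in>chains_of Q n. simpl_boundary c = 0 \<longrightarrow> (\<exists>e\<in>chains_of Q (Suc n). (c :: 'a::order set \<Rightarrow> 'k) = simpl_boundary e))"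
  unfolding hdim_eq_0_iff[OF subcomplex_order_complex[OF assms subset_refl]] cycles_chains_of boundaries_chains_of
  by blast

lemma hdim_neg:
  assumes "finite Q" and "i < - 1"
  shows "hdim TYPE('k::field) (order_complex (Q :: 'a::order set)) i = 0"
proof -
  note D = subcomplex_order_complex[OF assms(1) subset_refl]
  have "c = 0" if "c \<in> simpl_cycles (order_complex Q) i" for c :: "'a set \<Rightarrow> 'k"
    using that assms(2) by (auto simp: simpl_cycles_def simpl_chains_def fun_eq_iff)
  then have "simpl_cycles (order_complex Q) i \<subseteq> (simpl_boundaries (order_complex Q) i :: ('a set \<Rightarrow> 'k) set)"
    using boundaries_zero[OF D] by blast
  then show ?thesis using hdim_eq_0_iff[OF D] by blast
qed

locale rigid_monomial_ideal = proper_monomial_ideal M for M :: "('x::finite, 'k::field) mpoly set" +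
  assumes rigid: "rigid M"
begin

abbreviation "B \<equiv> betti_poset M"
abbreviation "L0 \<equiv> L - {0}"
abbreviation "B0 \<equiv> B - {0}"

text \<open>Shifted by one: \<open>n\<close> counts vertices, so \<open>h p 0\<close> is the
  dimension in degree -1.\<close>

abbreviation "h p n \<equiv> hdim TYPE('k) (order_complex {x \<in> L0. x < p}) (int n - 1)"

lemma finite_below_L0 [simp]: "finite {x \<in> L0. x < p}"
  using finite_lattice by simp

lemma pos_iff: "0 < (x :: 'x mon) \<longleftrightarrow> x \<noteq> 0"
  using zero_le_fun[of x] by (auto simp: less_le)

lemma open_complex_lattice: "open_complex L p = order_complex {x \<in> L0. x < p}"
proof -
  have "{x \<in> L. 0 < x \<and> x < p} = {x \<in> L0. x < p}" by (auto simp: pos_iff)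
  then show ?thesis by (simp add: open_complex_def zero_hat_eq[OF zero_in_lattice])
qed

lemma betti_subset: "B \<subseteq> L"
  by (auto simp: betti_poset_def)

lemma finite_betti: "finite B"
  using betti_subset finite_lattice finite_subset by blast

text \<open>Homology vanishes below degree -1, so quantifying over integer degrees and over vertex
  counts is the same.\<close>

lemma mem_betti: "p \<in> B \<longleftrightarrow> p \<in> L \<and> (\<exists>n. h p n \<noteq> 0)"
proof -
  have "(\<exists>i. hdim TYPE('k) (open_complex L p) i \<noteq> 0) \<longleftrightarrow> (\<exists>n. h p n \<noteq> 0)"
  proof
    assume "\<exists>i. hdim TYPE('k) (open_complex L p) i \<noteq> 0"
    then obtain i where i: "hdim TYPE('k) (open_complex L p) i \<noteq> 0" by blast
    then have "- 1 \<le> i" using hdim_neg[OF finite_below_L0, of i p, where 'k = 'k] open_complex_lattice by force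
    then have "h p (nat (i + 1)) \<noteq> 0" using i open_complex_lattice by simp
    then show "\<exists>n. h p n \<noteq> 0" by blast
  next
    assume "\<exists>n. h p n \<noteq> 0"
    then show "\<exists>i. hdim TYPE('k) (open_complex L p) i \<noteq> 0" using open_complex_lattice by auto
  qed
  then show ?thesis by (auto simp: betti_poset_def)
qed

lemma h_unique: "p \<in> L \<Longrightarrow> h p n \<noteq> 0 \<Longrightarrow> h p m \<noteq> 0 \<Longrightarrow> n = m"
  and h_one: "p \<in> L \<Longrightarrow> h p n \<noteq> 0 \<Longrightarrow> h p n = 1"
  and h_incomparable: "p \<in> L0 \<Longrightarrow> q \<in> L0 \<Longrightarrow> h p n = 1 \<Longrightarrow> h q n = 1 \<Longrightarrow> \<not> p < q"
proof -
  have R: "\<forall>p\<in>L. (\<forall>i j. hdim TYPE('k) (open_complex L p) i \<noteq> 0 \<and> hdim TYPE('k) (open_complex L p) j \<noteq> 0 \<longrightarrow> i = j) \<and>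
      (\<forall>i. hdim TYPE('k) (open_complex L p) i \<noteq> 0 \<longrightarrow> hdim TYPE('k) (open_complex L p) i = 1)"
    "\<forall>p\<in>L0. \<forall>q\<in>L0. p \<noteq> q \<and> (\<exists>i. hdim TYPE('k) (open_complex L p) i = 1 \<and> hdim TYPE('k) (open_complex L q) i = 1) \<longrightarrow>
      \<not> p \<le> q \<and> \<not> q \<le> p"
    using rigid unfolding rigid_def Let_def zero_hat_eq[OF zero_in_lattice] by blast+
  show "n = m" if "p \<in> L" "h p n \<noteq> 0" "h p m \<noteq> 0"
  proof -
    have "int n - 1 = int m - 1" using R(1)[rule_format, OF that(1)] that(2,3) unfolding open_complex_lattice by blast
    then show ?thesis by simp
  qed
  show "h p n = 1" if "p \<in> L" "h p n \<noteq> 0"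
    using R(1)[rule_format, OF that(1)] that(2) unfolding open_complex_lattice by blast
  show "\<not> p < q" if "p \<in> L0" "q \<in> L0" "h p n = 1" "h q n = 1"
  proof
    assume pq: "p < q"
    have "p \<noteq> q \<and> (\<exists>i. hdim TYPE('k) (open_complex L p) i = 1 \<and> hdim TYPE('k) (open_complex L q) i = 1)"
      using that(3,4) pq unfolding open_complex_lattice by (intro conjI exI[of _ "int n - 1"]) auto
    then have "\<not> p \<le> q \<and> \<not> q \<le> p" by (rule R(2)[THEN bspec, OF that(1), THEN bspec, OF that(2), THEN mp])
    then show False using less_imp_le[OF pq] by blast
  qed
qed

text \<open>Provides the hypothesis under which elements of the lcm-lattice outside the Betti poset
  may be discarded.\<close>

lemma acyclic_non_betti:
  assumes "p \<in> L0" "p \<notin> B"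
  shows "acyclic_poset TYPE('k) {x \<in> L0. x < p}"
proof -
  have "h p n = 0" for n using assms mem_betti by blast
  then show ?thesis unfolding acyclic_poset_def hdim_order_complex_eq_0[OF finite_below_L0] by blast
qed

text \<open>The class of the empty face, which puts 1 and the minimal generators into the Betti
  poset.\<close>

lemma empty_not_acyclic: "hdim TYPE('k) (order_complex ({} :: 'x mon set)) (int 0 - 1) \<noteq> 0"
proof -
  define d :: "'x mon set \<Rightarrow> 'k" where "d = (\<lambda>\<sigma>. if \<sigma> = {} then 1 else 0)"
  have d: "d \<in> chains_of {} 0" by (auto simp: chains_of_iff d_def chain_empty)
  have "simpl_boundary d = 0" by (rule boundary_chains_of_0[OF _ d]) simp
  moreover have "d \<noteq> simpl_boundary e" if e: "e \<in> chains_of {} (Suc 0)" for e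
  proof -
    have "e \<sigma> = 0" for \<sigma> using e by (auto simp: chains_of_iff)
    then have "e = 0" by auto
    moreover have "d {} \<noteq> 0" by (simp add: d_def)
    ultimately show ?thesis by auto
  qed
  ultimately show ?thesis using d hdim_order_complex_eq_0[of "{} :: 'x mon set" 0, where 'k = 'k] by auto
qed

lemma zero_in_betti: "0 \<in> B"
proof -
  have "{x \<in> L0. x < 0} = {}" using zero_le_fun by (auto simp: less_le_not_le)
  then show ?thesis using empty_not_acyclic zero_in_lattice mem_betti[of 0] by metis
qed

lemma below_gen: "g \<in> G \<Longrightarrow> {x \<in> L0. x < g} = {}"
proof (rule equals0I)
  fix x assume g: "g \<in> G" and x: "x \<in> {x \<in> L0. x < g}"
  then obtain g' where g': "g' \<in> G" "g' \<le> x" using gen_below_lattice[of x] by blast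
  then have "g' < g" using x by auto
  then show False using g g'(1) by (auto simp: min_gens_def less_le)
qed

lemma gens_in_betti: "G \<subseteq> B0"
proof
  fix g assume g: "g \<in> G"
  have "h g 0 \<noteq> 0" unfolding below_gen[OF g] by (rule empty_not_acyclic)
  then have "g \<in> B" using g gens_in_lattice mem_betti[of g] by blast
  then show "g \<in> B0" using g zero_not_gen by auto
qed

lemma open_complex_betti: "open_complex B p = order_complex {x \<in> B0. x < p}"
proof -
  have "{x \<in> B. 0 < x \<and> x < p} = {x \<in> B0. x < p}" by (auto simp: pos_iff)
  then show ?thesis by (simp add: open_complex_def zero_hat_eq[OF zero_in_betti])
qed

text \<open>On nonzero elements of the Betti poset rigidity makes the degree of the homology below
  \<open>p\<close> unique, so the choice is determined. In terms of dimension the rank is that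
  degree plus 2, which is the position of the sequence at which \<open>p\<close> contributes; the
  minimum gets position 0.\<close>

definition rank :: "'x mon \<Rightarrow> nat" where
  "rank p = (if p = 0 then 0 else Suc (SOME n. h p n \<noteq> 0))"

lemma rank_pos: "p \<in> B0 \<Longrightarrow> 0 < rank p"
  by (simp add: rank_def)

lemma rank_zero: "rank 0 = 0"
  by (simp add: rank_def)

lemma h_rank: "p \<in> B0 \<Longrightarrow> h p (rank p - 1) = 1"
proof -
  assume p: "p \<in> B0"
  then have "\<exists>n. h p n \<noteq> 0" using mem_betti by blast
  then have "h p (SOME n. h p n \<noteq> 0) \<noteq> 0" by (rule someI_ex)
  moreover have "rank p - 1 = (SOME n. h p n \<noteq> 0)" using p by (simp add: rank_def)
  ultimately have "h p (rank p - 1) \<noteq> 0" by simp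
  then show ?thesis using h_one p betti_subset by blast
qed

lemma h_not_rank: "p \<in> B0 \<Longrightarrow> n \<noteq> rank p - 1 \<Longrightarrow> h p n = 0"
  using h_unique[of p n "rank p - 1"] h_rank[of p] betti_subset by auto

lemma rank_incomparable: "p \<in> B0 \<Longrightarrow> q \<in> B0 \<Longrightarrow> rank p = rank q \<Longrightarrow> \<not> p < q"
  using h_incomparable[of p q "rank p - 1"] h_rank[of p] h_rank[of q] betti_subset by auto

lemma below_betti: "{x \<in> B0. x < p} = {x \<in> L0. x < p} \<inter> B"
  using betti_subset by auto

lemma finite_below_betti [simp]: "finite {x \<in> B0. x < p}"
  using finite_betti by simp

section \<open>Fundamental cycles and monotonicity of the rank\<close>

lemma boundary_below_betti:
  fixes c :: "'x mon set \<Rightarrow> 'k"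
  assumes "c \<in> chains_of {x \<in> B0. x < p} n" "e \<in> chains_of {x \<in> L0. x < p} (Suc n)" "c = simpl_boundary e"
  shows "\<exists>e'\<in>chains_of {x \<in> B0. x < p} (Suc n). c = simpl_boundary e'"
  unfolding below_betti
  by (rule boundary_in_subposet[where L = L0, OF finite_below_L0 _ _ acyclic_non_betti])
    (use assms below_betti in auto)

text \<open>A representative of the generating class in the lcm-lattice is moved to a homologous
  cycle on the Betti poset. Other cycles are multiples only modulo boundaries at this stage; that
  these boundaries are zero follows from \<open>rank_mono\<close>, whose proof needs the
  cycles.\<close>

lemma fund_cycle_ex:
  assumes p: "p \<in> B0"
  shows "\<exists>z\<in>chains_of {x \<in> B0. x < p} (rank p - 1). simpl_boundary z = 0 \<and> (z :: 'x mon set \<Rightarrow> 'k) \<noteq> 0 \<and>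
    (\<forall>c\<in>chains_of {x \<in> B0. x < p} (rank p - 1). simpl_boundary c = 0 \<longrightarrow>
      (\<exists>a. \<exists>e\<in>chains_of {x \<in> B0. x < p} (Suc (rank p - 1)). c - scale_chain a z = simpl_boundary e))"
proof -
  let ?U = "{x \<in> L0. x < p}" and ?W = "{x \<in> B0. x < p}" and ?n = "rank p - 1"
  note D = subcomplex_order_complex[OF finite_below_L0 subset_refl, of p]
  obtain b :: "'x mon set \<Rightarrow> 'k" where b: "b \<in> chains_of ?U ?n" "simpl_boundary b = 0" "b \<notin> simpl_boundary ` chains_of ?U (Suc ?n)"
    and gen: "\<And>c. c \<in> chains_of ?U ?n \<Longrightarrow> simpl_boundary c = 0 \<Longrightarrow>
      \<exists>a. c - scale_chain a b \<in> simpl_boundary ` chains_of ?U (Suc ?n)"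
    using hdim_1D[OF D h_rank[OF p]] unfolding cycles_chains_of boundaries_chains_of by blast
  have "\<exists>z\<in>chains_of (?U \<inter> B) ?n. \<exists>f\<in>chains_of ?U (Suc ?n). simpl_boundary z = 0 \<and> b - z = simpl_boundary f"
    by (rule cycle_in_subposet[where L = L0, OF finite_below_L0 _ _ acyclic_non_betti b(1,2)]) auto
  then obtain z f where z: "z \<in> chains_of ?W ?n" "simpl_boundary z = 0"
    and f: "f \<in> chains_of ?U (Suc ?n)" "b - z = simpl_boundary f"
    unfolding below_betti by blast
  have "z \<noteq> 0"
  proof
    assume "z = 0"
    then have "b = simpl_boundary f" using f(2) by simp
    then show False using b(3) f(1) by blast
  qed
  moreover have "\<exists>a. \<exists>e\<in>chains_of ?W (Suc ?n). c - scale_chain a z = simpl_boundary e"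
    if c: "c \<in> chains_of ?W ?n" "simpl_boundary c = 0" for c
  proof -
    have sub: "?W \<subseteq> ?U" unfolding below_betti by blast
    have cU: "c \<in> chains_of ?U ?n" by (rule chains_of_mono[OF finite_below_L0 sub c(1)])
    obtain a e where e: "e \<in> chains_of ?U (Suc ?n)" "c - scale_chain a b = simpl_boundary e"
      using gen[OF cU c(2)] by blast
    have af: "scale_chain a f \<in> chains_of ?U (Suc ?n)" by (rule scale_chains_of[OF f(1)])
    \<comment> \<open>The identity behind this is
      \<open>c - a z = (c - a b) + a (b - z)\<close>.\<close>
    have "simpl_boundary (e + scale_chain a f) = simpl_boundary e + scale_chain a (simpl_boundary f)"
      unfolding boundary_add[OF e(1) af] simpl_boundary_scale ..
    also have "\<dots> = c - scale_chain a z"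
      unfolding e(2)[symmetric] f(2)[symmetric] by (auto simp: algebra_simps)
    finally have "c - scale_chain a z = simpl_boundary (e + scale_chain a f)" by simp
    moreover have "c - scale_chain a z \<in> chains_of ?W ?n"
      by (intro diff_chains_of scale_chains_of c(1) z(1))
    ultimately show ?thesis using boundary_below_betti add_chains_of[OF e(1) af] by blast
  qed
  ultimately show ?thesis using z by blast
qed

definition is_fcycle :: "'x mon \<Rightarrow> ('x mon set \<Rightarrow> 'k) \<Rightarrow> bool" where
  "is_fcycle p z \<longleftrightarrow> z \<in> chains_of {x \<in> B0. x < p} (rank p - 1) \<and> simpl_boundary z = 0 \<and> z \<noteq> 0 \<and>
    (\<forall>c\<in>chains_of {x \<in> B0. x < p} (rank p - 1). simpl_boundary c = 0 \<longrightarrow>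
      (\<exists>a. \<exists>e\<in>chains_of {x \<in> B0. x < p} (Suc (rank p - 1)). c - scale_chain a z = simpl_boundary e))"

definition fcycle :: "'x mon \<Rightarrow> 'x mon set \<Rightarrow> 'k" where
  "fcycle p = (SOME z. is_fcycle p z)"

lemma fcycle:
  assumes "p \<in> B0"
  shows "fcycle p \<in> chains_of {x \<in> B0. x < p} (rank p - 1)" and "simpl_boundary (fcycle p) = 0" and "fcycle p \<noteq> 0"
    and "\<And>c. c \<in> chains_of {x \<in> B0. x < p} (rank p - 1) \<Longrightarrow> simpl_boundary c = 0 \<Longrightarrow>
      \<exists>a. \<exists>e\<in>chains_of {x \<in> B0. x < p} (Suc (rank p - 1)). c - scale_chain a (fcycle p) = simpl_boundary e"
proof -
  have "\<exists>z. is_fcycle p z" using fund_cycle_ex[OF assms] unfolding is_fcycle_def by blast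
  then have "is_fcycle p (fcycle p)" unfolding fcycle_def by (rule someI_ex)
  then show "fcycle p \<in> chains_of {x \<in> B0. x < p} (rank p - 1)" and "simpl_boundary (fcycle p) = 0" and "fcycle p \<noteq> 0"
    and "\<And>c. c \<in> chains_of {x \<in> B0. x < p} (rank p - 1) \<Longrightarrow> simpl_boundary c = 0 \<Longrightarrow>
      \<exists>a. \<exists>e\<in>chains_of {x \<in> B0. x < p} (Suc (rank p - 1)). c - scale_chain a (fcycle p) = simpl_boundary e"
    unfolding is_fcycle_def by blast+
qed

text \<open>Induction on the number of elements below \<open>q\<close>. Strictly below
  \<open>q\<close> ranks are already monotone, and this covers \<open>p\<close> and every vertex of
  its fundamental cycle. A face of that cycle has \<open>rank p - 1\<close> vertices with ranks up
  to \<open>rank p - 1\<close>, so \<open>chain_ranks\<close> finds a vertex of any prescribed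
  positive smaller rank, in particular of rank \<open>rank q\<close> if that is smaller than
  \<open>rank p\<close>.\<close>

lemma rank_mono: "p \<in> B0 \<Longrightarrow> q \<in> B0 \<Longrightarrow> p < q \<Longrightarrow> rank p < rank q"
proof (induction "card {x \<in> B0. x < q}" arbitrary: p q rule: less_induct)
  case less
  have IH: "rank x < rank y" if "x \<in> B0" "y \<in> B0" "x < y" "y < q" for x y
  proof (rule less.hyps[OF _ that(1-3)])
    have "{x \<in> B0. x < y} \<subset> {x \<in> B0. x < q}" using that by (auto intro: less_trans)
    then show "card {x \<in> B0. x < y} < card {x \<in> B0. x < q}" by (rule psubset_card_mono[OF finite_below_betti])
  qed
  show ?case
  proof (rule ccontr)
    assume "\<not> rank p < rank q"
    moreover have "rank p \<noteq> rank q" using rank_incomparable[OF less.prems(1,2)] less.prems(3) by blast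
    ultimately have lt: "rank q < rank p" by simp
    obtain \<sigma> where \<sigma>: "fcycle p \<sigma> \<noteq> 0" using fcycle(3)[OF less.prems(1)] by (auto simp: fun_eq_iff)
    note s = chains_ofD[OF finite_below_betti fcycle(1)[OF less.prems(1)] \<sigma>]
    have "rank ` \<sigma> = {1..rank p - 1}"
    proof (rule chain_ranks(2)[OF _ s(2)])
      show "finite \<sigma>" by (rule finite_subset[OF s(1) finite_below_betti])
      show "rank x < rank y" if "x \<in> \<sigma>" "y \<in> \<sigma>" "x < y" for x y
        using s(1) that less.prems(3) by (intro IH) (auto intro: less_trans)
      show "0 < rank x \<and> rank x \<le> rank p - 1" if "x \<in> \<sigma>" for x
      proof -
        have "x \<in> B0" "x < p" using that s(1) by auto
        then show ?thesis using IH[of x p] less.prems rank_pos[of x] by auto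
      qed
    qed (rule s(3))
    moreover have "rank q \<in> {1..rank p - 1}" using lt rank_pos[OF less.prems(2)] by simp
    ultimately obtain x where x: "x \<in> \<sigma>" "rank x = rank q" by (metis imageE)
    then have "x \<in> B0" "x < q" using s(1) less.prems(3) by (auto intro: less_trans)
    then show False using rank_incomparable[of x q] less.prems(2) x(2) by blast
  qed
qed

text \<open>A chain below \<open>p\<close> uses distinct ranks from \<open>1\<close> to
  \<open>rank p - 1\<close>, too few for \<open>rank p\<close> vertices. Hence nothing bounds in the
  degree of the fundamental cycle, and homology classes there are single cycles.\<close>

lemma no_top_chains:
  assumes p: "p \<in> B0" and e: "e \<in> chains_of {x \<in> B0. x < p} (rank p)"
  shows "e = 0"
proof
  fix \<sigma>
  show "e \<sigma> = 0 \<sigma>"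
  proof (rule ccontr)
    assume "e \<sigma> \<noteq> 0 \<sigma>"
    then have "e \<sigma> \<noteq> 0" by simp
    note s = chains_ofD[OF finite_below_betti e this]
    have "card \<sigma> \<le> rank p - 1"
    proof (rule chain_ranks(1)[OF _ s(2)])
      show "finite \<sigma>" by (rule finite_subset[OF s(1) finite_below_betti])
      show "rank x < rank y" if "x \<in> \<sigma>" "y \<in> \<sigma>" "x < y" for x y
        using s(1) that by (intro rank_mono) auto
      show "0 < rank x \<and> rank x \<le> rank p - 1" if "x \<in> \<sigma>" for x
      proof -
        have "x \<in> B0" "x < p" using that s(1) by auto
        then show ?thesis using rank_mono[of x p] p rank_pos[of x] by auto
      qed
    qed
    then show False using s(3) rank_pos[OF p] by simp
  qed
qed

text \<open>For \<open>cycle_multiple\<close>, the filling of the difference in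
  \<open>fcycle\<close> is a chain too long to be nonzero. \<open>other_cycles\<close> is the
  uniqueness of the homological degree, carried over from the lcm-lattice.\<close>

sublocale cell_poset 0 B0 rank fcycle
proof
  show "finite B0" using finite_betti by simp
  show "0 < q" if "q \<in> B0" for q :: "'x mon" using that pos_iff by blast
  fix p assume p: "p \<in> B0"
  have S: "Suc (rank p - 1) = rank p" using rank_pos[OF p] by simp
  show "fcycle p \<in> chains_of {x \<in> B0. x < p} (rank p - 1)" by (rule fcycle(1)[OF p])
  show "\<exists>a. c = scale_chain a (fcycle p)" if c: "c \<in> chains_of {x \<in> B0. x < p} (rank p - 1)" "simpl_boundary c = 0" for c
  proof -
    obtain a e where "e \<in> chains_of {x \<in> B0. x < p} (rank p)" "c - scale_chain a (fcycle p) = simpl_boundary e"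
      using fcycle(4)[OF p c] S by auto
    moreover then have "e = 0" using no_top_chains[OF p] by blast
    ultimately have "c - scale_chain a (fcycle p) = 0" by simp
    then show ?thesis using eq_iff_diff_eq_0 by blast
  qed
  show "\<exists>e\<in>chains_of {x \<in> B0. x < p} (Suc n). c = simpl_boundary e"
    if n: "n \<noteq> rank p - 1" and c: "c \<in> chains_of {x \<in> B0. x < p} n" "simpl_boundary c = (0 :: 'x mon set \<Rightarrow> 'k)" for n c
  proof -
    have "c \<in> chains_of {x \<in> L0. x < p} n"
      by (rule chains_of_mono[OF finite_below_L0 _ c(1)]) (use betti_subset in auto)
    then obtain e where "e \<in> chains_of {x \<in> L0. x < p} (Suc n)" "c = simpl_boundary e"
      using h_not_rank[OF p n] c(2) unfolding hdim_order_complex_eq_0[OF finite_below_L0] by blast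
    then show ?thesis using boundary_below_betti[OF c(1)] by blast
  qed
qed (auto simp: rank_zero rank_mono rank_pos fcycle)

lemma lower_set_below: "lower_set 0 B0 rank fcycle {x \<in> B0. x \<le> u}"
  by unfold_locales (auto intro: less_imp_le order_trans)

lemma acyclic_below:
  assumes "\<exists>g\<in>G. g \<le> u"
  shows "acyclic_poset TYPE('k) {x \<in> B0. x \<le> u}"
proof -
  let ?U = "{x \<in> L0. x \<le> u}"
  obtain t where t: "t \<in> L" "t \<le> u" "\<forall>p\<in>L. p \<le> u \<longrightarrow> p \<le> t" using lattice_top_below by blast
  obtain g where g: "g \<in> G" "g \<le> u" using assms by blast
  \<comment> \<open>The cone is formed in \<open>L\<close> without its minimum, so the apex must not
    be 0; a generator dividing \<open>u\<close> lies below the apex and ensures this.\<close>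
  have "t \<noteq> 0"
  proof
    assume "t = 0"
    then have "g \<le> 0" using t(3) g gens_in_lattice by auto
    then show False using zero_le_fun[of g] g(1) zero_not_gen by auto
  qed
  have fin: "finite ?U" by (rule finite_subset[OF _ finite_lattice]) auto
  have "acyclic_poset TYPE('k) ?U" by (rule acyclic_cone[OF fin, of t]) (use t \<open>t \<noteq> 0\<close> in auto)
  then have "acyclic_poset TYPE('k) (?U \<inter> B)"
    by (intro acyclic_subposet[where L = L0, OF fin _ _ acyclic_non_betti]) (auto intro: less_imp_le order_trans)
  moreover have "?U \<inter> B = {x \<in> B0. x \<le> u}" using betti_subset by auto
  ultimately show ?thesis by simp
qed

end

section \<open>The resolution\<close>

context rigid_monomial_ideal
begin

section \<open>Summands of the sequence and their generators\<close>

lemma zero_hat_betti: "zero_hat B = 0"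
  by (rule zero_hat_eq[OF zero_in_betti])

text \<open>The indices of the nonvanishing summands in position \<open>i\<close>. The minimum has
  rank 0 and is the single index for \<open>i = 0\<close>.\<close>

definition S :: "nat \<Rightarrow> 'x mon set" where
  "S i = {q \<in> B. rank q = i}"

lemma finite_S: "finite (S i)"
  using finite_betti by (simp add: S_def)

lemma S_0: "S 0 = {0}"
  using rank_pos rank_zero zero_in_betti by (fastforce simp: S_def)

lemma S_Suc: "S (Suc i) = {q \<in> B0. rank q = Suc i}"
  using rank_zero by (auto simp: S_def)

lemma S_subset: "S i \<subseteq> seq_index B i"
  using rank_pos rank_zero by (force simp: S_def seq_index_def zero_hat_betti)

lemma finite_index: "finite (seq_index B i)"
  using finite_betti by (simp add: seq_index_def)

lemma rank_mono':
  assumes "p \<in> B" "q \<in> B" "p < q"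
  shows "rank p < rank q"
proof -
  have "0 < q" using le_less_trans[OF zero_le_fun[of p] assms(3)] .
  then have "q \<in> B0" using assms(2) pos_iff by blast
  then show ?thesis using rank_mono[of p q] rank_pos[of q] rank_zero assms by (cases "p = 0") auto
qed

lemma below_zero: "{x \<in> B0. x < 0} = {}"
  using zero_le_fun by (auto simp: less_le_not_le)

text \<open>Truncated subtraction merges the two cases of \<open>seq_summand\<close>: for
  \<open>i = 0\<close> the degree comes out as -1, and below the minimum the complex is the empty
  face alone.\<close>

definition homol :: "nat \<Rightarrow> 'x mon \<Rightarrow> ('k, ('x mon set \<Rightarrow> 'k) set) module" where
  "homol i q = reduced_homology (order_complex {x \<in> B0. x < q}) (int (i - 1) - 1)"

definition cls :: "nat \<Rightarrow> 'x mon \<Rightarrow> ('x mon set \<Rightarrow> 'k) \<Rightarrow> ('x mon set \<Rightarrow> 'k) set" where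
  "cls i q = homology_class (order_complex {x \<in> B0. x < q}) (int (i - 1) - 1)"

lemma order_complex_empty: "order_complex {} = {{}}"
  by (auto simp: order_complex_def chain_empty)

lemma seq_summand_homol: "q \<in> seq_index B i \<Longrightarrow> seq_summand B i q = homol i q"
proof (cases i)
  case 0
  assume "q \<in> seq_index B i"
  then have "q = 0" using 0 by (simp add: seq_index_def zero_hat_betti)
  then show ?thesis unfolding homol_def seq_summand_def \<open>q = 0\<close> below_zero order_complex_empty using 0 by simp
next
  case (Suc j)
  then show ?thesis by (simp add: seq_summand_def homol_def open_complex_betti)
qed

lemma subcomplex_below: "subcomplex {x \<in> B0. x < q} (order_complex {x \<in> B0. x < q})"
  by (rule subcomplex_order_complex[OF finite_below_betti subset_refl])

lemma cls_eq_iff: "cls i q x = cls i q y \<longleftrightarrow> x - y \<in> simpl_boundary ` chains_of {x \<in> B0. x < q} (Suc (i - 1))"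
  unfolding cls_def homology_class_eq_iff[OF subcomplex_below] boundaries_chains_of ..

lemma homol_carrier: "carrier (homol i q) = cls i q ` {c \<in> chains_of {x \<in> B0. x < q} (i - 1). simpl_boundary c = 0}"
  unfolding homol_def cls_def carrier_homology[OF subcomplex_below] cycles_chains_of ..

lemma homol_smult: "a \<odot>\<^bsub>homol i q\<^esub> cls i q x = cls i q (scale_chain a x)"
  unfolding homol_def cls_def by (rule homology_smult[OF subcomplex_below])

lemma homol_zero: "\<zero>\<^bsub>homol i q\<^esub> = cls i q 0"
  unfolding homol_def cls_def by (rule homology_zero[OF subcomplex_below])

lemma homol_module: "module class_ring (homol i q)"
  unfolding homol_def by (rule homology_module[OF subcomplex_below])

definition empty_face :: "'x mon set \<Rightarrow> 'k" where
  "empty_face = (\<lambda>\<sigma>. if \<sigma> = {} then 1 else 0)"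

text \<open>The minimum is treated as a cell of rank \<open>0\<close> whose fundamental cycle is the empty face.\<close>

definition gcycle :: "nat \<Rightarrow> 'x mon \<Rightarrow> 'x mon set \<Rightarrow> 'k" where
  "gcycle i q = (if rank q = i then if q = 0 then empty_face else fcycle q else 0)"

lemma chains_of_empty:
  fixes c :: "'x mon set \<Rightarrow> 'k"
  assumes "c \<in> chains_of {} n"
  shows "c = scale_chain (c {}) empty_face" and "n \<noteq> 0 \<Longrightarrow> c = 0"
proof -
  have supp: "\<sigma> = {} \<and> n = 0" if "c \<sigma> \<noteq> 0" for \<sigma>
    using chains_ofD(1,3)[OF finite.emptyI assms that] by auto
  show "c = scale_chain (c {}) empty_face"
  proof
    show "c \<sigma> = c {} * empty_face \<sigma>" for \<sigma> using supp[of \<sigma>] by (cases "\<sigma> = {}") (auto simp: empty_face_def)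
  qed
  show "c = 0" if "n \<noteq> 0"
  proof
    show "c \<sigma> = 0 \<sigma>" for \<sigma> using supp[of \<sigma>] that by auto
  qed
qed

lemma gcycle_cycle:
  assumes "q \<in> seq_index B i"
  shows "gcycle i q \<in> chains_of {x \<in> B0. x < q} (i - 1)" and "simpl_boundary (gcycle i q) = 0"
proof -
  have "gcycle i q \<in> chains_of {x \<in> B0. x < q} (i - 1) \<and> simpl_boundary (gcycle i q) = 0"
  proof (cases "rank q = i")
    case False
    then show ?thesis by (simp add: gcycle_def)
  next
    case True
    show ?thesis
    proof (cases "q = 0")
      case q0: True
      have e: "empty_face \<in> chains_of {} 0" by (auto simp: chains_of_iff empty_face_def chain_empty)
      then have "simpl_boundary empty_face = 0" by (rule boundary_chains_of_0[OF finite.emptyI])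
      then show ?thesis using e True rank_zero unfolding q0 below_zero by (simp add: gcycle_def)
    next
      case False
      then have "q \<in> B0" using assms by (auto simp: seq_index_def zero_hat_betti split: if_splits)
      then show ?thesis using fcycle[of q] True False by (simp add: gcycle_def)
    qed
  qed
  then show "gcycle i q \<in> chains_of {x \<in> B0. x < q} (i - 1)" and "simpl_boundary (gcycle i q) = 0" by auto
qed

text \<open>At the minimum only multiples of the empty face exist; in position \<open>rank q\<close>
  the fundamental cycle spans; in every other position a cycle bounds, which matches
  \<open>gcycle\<close> being zero there.\<close>

lemma cycle_class_multiple:
  assumes q: "q \<in> seq_index B i" and c: "c \<in> chains_of {x \<in> B0. x < q} (i - 1)" "simpl_boundary c = 0"
  shows "\<exists>a. cls i q c = cls i q (scale_chain a (gcycle i q))"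
proof (cases "q = 0")
  case True
  then have i: "i = 0" using q by (auto simp: seq_index_def zero_hat_betti split: if_splits)
  have "c = scale_chain (c {}) (gcycle i q)"
    using chains_of_empty(1)[of c "i - 1"] c(1) True i rank_zero unfolding True below_zero by (simp add: gcycle_def)
  then show ?thesis by metis
next
  case False
  then have B: "q \<in> B0" and i: "i \<noteq> 0" using q by (auto simp: seq_index_def zero_hat_betti split: if_splits)
  show ?thesis
  proof (cases "rank q = i")
    case True
    then show ?thesis using cycle_multiple[OF B, of c] c False by (auto simp: gcycle_def)
  next
    case ne: False
    then have "i - 1 \<noteq> rank q - 1" using i rank_pos[OF B] by auto
    from other_cycles[OF B this c] have "cls i q c = cls i q 0" unfolding cls_eq_iff by auto
    moreover have "scale_chain 0 (gcycle i q) = 0" by auto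
    ultimately show ?thesis by metis
  qed
qed

definition gen :: "nat \<Rightarrow> 'x mon \<Rightarrow> ('x mon set \<Rightarrow> 'k) set" where
  "gen i q = cls i q (gcycle i q)"

lemma gen_smult: "a \<odot>\<^bsub>homol i q\<^esub> gen i q = cls i q (scale_chain a (gcycle i q))"
  unfolding gen_def by (rule homol_smult)

lemma homol_cyclic:
  assumes q: "q \<in> seq_index B i"
  shows "cyclic_space (homol i q) (gen i q)"
proof (intro cyclic_space.intro cyclic_space_axioms.intro)
  show "module class_ring (homol i q)" by (rule homol_module)
  have sc: "cls i q (scale_chain a (gcycle i q)) \<in> carrier (homol i q)" for a
    unfolding homol_carrier using gcycle_cycle[OF q]
    by (intro imageI) (auto simp: simpl_boundary_scale intro: scale_chains_of)
  show "gen i q \<in> carrier (homol i q)" using sc[of 1] by (simp add: gen_def)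
  show "carrier (homol i q) = range (\<lambda>a. a \<odot>\<^bsub>homol i q\<^esub> gen i q)"
    unfolding gen_smult
  proof (intro equalityI subsetI)
    fix v assume "v \<in> carrier (homol i q)"
    then obtain c where c: "c \<in> chains_of {x \<in> B0. x < q} (i - 1)" "simpl_boundary c = 0" "v = cls i q c"
      unfolding homol_carrier by blast
    then show "v \<in> range (\<lambda>a. cls i q (scale_chain a (gcycle i q)))"
      using cycle_class_multiple[OF q c(1,2)] by blast
  qed (use sc in auto)
qed

text \<open>Freeness on \<open>S i\<close> comes from the absence of boundaries: a vanishing
  multiple of the generator would be the boundary of a chain with too many vertices below
  \<open>q\<close>, and such chains are zero. Outside \<open>S i\<close> the generator was chosen to
  be zero.\<close>

lemma presentation: "free_presentation (seq_index B i) (S i) (seq_summand B i) (gen i)"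
proof (rule free_presentation.intro)
  show "finite (seq_index B i)" by (rule finite_index)
  show "S i \<subseteq> seq_index B i" by (rule S_subset)
  show "cyclic_space (seq_summand B i q) (gen i q)" if "q \<in> seq_index B i" for q
    using homol_cyclic[OF that] seq_summand_homol[OF that] by simp
  show "gen i q = \<zero>\<^bsub>seq_summand B i q\<^esub>" if q: "q \<in> seq_index B i - S i" for q
  proof -
    have "q \<in> B" using q zero_in_betti by (auto simp: seq_index_def zero_hat_betti split: if_splits)
    then have "rank q \<noteq> i" using q by (simp add: S_def)
    then have "gcycle i q = 0" by (auto simp: gcycle_def)
    then show ?thesis using q seq_summand_homol[of q i] by (simp add: homol_zero gen_def)
  qed
  show "a = 0" if q: "q \<in> S i" and a: "a \<odot>\<^bsub>seq_summand B i q\<^esub> gen i q = \<zero>\<^bsub>seq_summand B i q\<^esub>" for q a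
  proof -
    have qi: "q \<in> seq_index B i" using q S_subset by blast
    have "cls i q (scale_chain a (gcycle i q)) = cls i q 0"
      using a seq_summand_homol[OF qi] by (simp add: gen_smult homol_zero)
    then obtain e where e: "e \<in> chains_of {x \<in> B0. x < q} (Suc (i - 1))" "scale_chain a (gcycle i q) = simpl_boundary e"
      unfolding cls_eq_iff by auto
    have rq: "rank q = i" using q by (simp add: S_def)
    have "e = 0 \<and> gcycle i q \<noteq> 0"
    proof (cases "q = 0")
      case True
      have "e = 0" using chains_of_empty(2)[of e "Suc (i - 1)"] e(1) unfolding True below_zero by simp
      moreover have "empty_face {} \<noteq> 0" by (simp add: empty_face_def)
      ultimately show ?thesis using True rq by (auto simp: gcycle_def)
    next
      case False
      then have B: "q \<in> B0" using q by (simp add: S_def)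
      then have "Suc (i - 1) = rank q" using rank_pos[OF B] rq by simp
      then show ?thesis using no_top_chains[OF B] e(1) fcycle(3)[OF B] False rq by (auto simp: gcycle_def)
    qed
    then have z: "scale_chain a (gcycle i q) = 0" "gcycle i q \<noteq> 0" using e(2) by auto
    then obtain \<sigma> where "gcycle i q \<sigma> \<noteq> 0" by (auto simp: fun_eq_iff)
    then show "a = 0" using fun_cong[OF z(1), of \<sigma>] by simp
  qed
qed

definition coeff :: "nat \<Rightarrow> 'x mon \<Rightarrow> 'x mon \<Rightarrow> 'k" where
  "coeff i q p = (if q \<in> S (Suc i) \<and> p \<in> S i then incidence q p else 0)"

text \<open>For \<open>i = 0\<close> the map is the identity on cosets of the same complex, and the
  entry is the coefficient of the empty face in the fundamental cycle. Otherwise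
  \<open>seq_map_class\<close> reduces it to a signed link, which is a multiple of
  \<open>fcycle p\<close> for consecutive ranks and bounds if \<open>rank p\<close> is not
  \<open>i\<close>.\<close>

lemma seq_map_gen:
  assumes q: "q \<in> seq_index B (Suc i)" and p: "p \<in> seq_index B i" and pq: "covered_by B p q"
  shows "seq_map B (Suc i) q p (a \<odot>\<^bsub>homol (Suc i) q\<^esub> gen (Suc i) q) = (a * coeff i q p) \<odot>\<^bsub>homol i p\<^esub> gen i p"
proof (cases i)
  case 0
  then have p0: "p = 0" using p by (simp add: seq_index_def zero_hat_betti)
  have qB: "q \<in> B0" using q by (simp add: seq_index_def zero_hat_betti)
  \<comment> \<open>An element covering the minimum has an empty open interval below it, which
    forces its rank to be 1.\<close>
  have below: "{x \<in> B0. x < q} = {}" using pq p0 by (auto simp: covered_by_def pos_iff)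
  have f: "fcycle q \<in> chains_of {} (rank q - 1)" using fcycle(1)[OF qB] unfolding below .
  then have "rank q - 1 = 0" using chains_of_empty(2) fcycle(3)[OF qB] by blast
  then have rq: "rank q = 1" using rank_pos[OF qB] by simp
  have c: "coeff i q p = fcycle q {}"
    using 0 p0 rq qB zero_in_betti rank_zero by (simp add: coeff_def S_def incidence_def)
  have g: "gcycle (Suc i) q = scale_chain (fcycle q {}) (gcycle i p)"
    using chains_of_empty(1)[OF f] rq 0 p0 qB rank_zero by (simp add: gcycle_def)
  have cl: "cls (Suc i) q = cls i p" unfolding cls_def below p0 below_zero using 0 by simp
  show ?thesis
    unfolding gen_smult cl c g using 0 by (simp add: seq_map_def mult.assoc)
next
  case (Suc j)
  have qB: "q \<in> B0" and pB: "p \<in> B0" using q p Suc by (auto simp: seq_index_def zero_hat_betti)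
  have lt: "p < q" using pq by (simp add: covered_by_def)
  have deg: "int (Suc i - 1) - 1 = int (Suc i) - 2" "int (i - 1) - 1 = int (Suc i) - 3" using Suc by auto
  define z where "z = scale_chain a (gcycle (Suc i) q)"
  have z: "z \<in> chains_of {x \<in> B0. x < q} i" "simpl_boundary z = 0"
    unfolding z_def using gcycle_cycle[OF q] by (auto simp: simpl_boundary_scale intro: scale_chains_of)
  have zc: "z \<in> simpl_cycles (open_complex B q) (int (Suc i) - 2)"
    using z unfolding open_complex_betti deg(1)[symmetric] cycles_chains_of by simp
  define y where "y = scale_chain ((- 1) ^ Suc i) (link_chain p z)"
  have "seq_map B (Suc i) q p (cls (Suc i) q z) = cls i p y"
    unfolding cls_def deg y_def open_complex_betti[symmetric]
    by (rule seq_map_class[OF finite_betti _ _ pq _ zc]) (use zero_hat_betti zero_le_fun pB Suc in auto)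
  also have "cls i p y = cls i p (scale_chain (a * coeff i q p) (gcycle i p))"
  proof (cases "rank q = Suc i")
    case False
    then have "z = 0" "coeff i q p = 0" by (auto simp: z_def gcycle_def coeff_def S_def)
    then show ?thesis by (auto simp: y_def link_chain_def zero_fun_def)
  next
    case rq: True
    then have zf: "z = scale_chain a (fcycle q)" using qB by (simp add: z_def gcycle_def)
    show ?thesis
    proof (cases "rank p = i")
      case True
      have l: "scale_chain ((- 1) ^ rank q) (link_chain p (fcycle q)) = scale_chain (incidence q p) (fcycle p)"
        by (rule link_fund_cycle[OF pB qB lt]) (use rq True in simp)
      have "y = scale_chain (a * incidence q p) (fcycle p)"
      proof
        fix \<tau>
        have "y \<tau> = a * ((- 1) ^ rank q * link_chain p (fcycle q) \<tau>)"
          by (simp add: y_def zf link_chain_scale rq)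
        also have "\<dots> = a * (incidence q p * fcycle p \<tau>)" using fun_cong[OF l, of \<tau>] by simp
        finally show "y \<tau> = a * incidence q p * fcycle p \<tau>" by simp
      qed
      moreover have "coeff i q p = incidence q p" using rq True qB pB by (simp add: coeff_def S_def)
      moreover have "gcycle i p = fcycle p" using True pB by (simp add: gcycle_def)
      ultimately show ?thesis by simp
    next
      case False
      \<comment> \<open>Here maximality of \<open>p\<close> comes from the cover relation, as the
        ranks are not consecutive.\<close>
      have max: "\<not> p < x" if "x \<in> {x \<in> B0. x < q}" for x using that pq by (auto simp: covered_by_def)
      have W: "{x \<in> {x \<in> B0. x < q}. x < p} = {x \<in> B0. x < p}" using lt by auto
      have zi: "z \<in> chains_of {x \<in> B0. x < q} (Suc (i - 1))" using z(1) Suc by simp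
      have l: "link_chain p z \<in> chains_of {x \<in> B0. x < p} (i - 1)"
        using link_chains_of[OF finite_below_betti max zi] unfolding W .
      have "simpl_boundary (link_chain p z) = link_chain p (simpl_boundary z)"
        using link_boundary[OF finite_below_betti max zi] by simp
      also have "\<dots> = 0" unfolding z(2) by (auto simp: link_chain_def)
      finally have "simpl_boundary y = 0" unfolding y_def simpl_boundary_scale by auto
      moreover have "y \<in> chains_of {x \<in> B0. x < p} (i - 1)" unfolding y_def by (rule scale_chains_of[OF l])
      moreover have "i - 1 \<noteq> rank p - 1" using False Suc rank_pos[OF pB] by auto
      ultimately have "cls i p y = cls i p 0"
        unfolding cls_eq_iff using other_cycles[OF pB, of "i - 1" y] by auto
      moreover have "scale_chain (a * coeff i q p) (gcycle i p) = 0" using False by (auto simp: gcycle_def)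
      ultimately show ?thesis by simp
    qed
  qed
  finally show ?thesis unfolding gen_smult z_def .
qed

end

lemma irrelevant_single:
  fixes n :: "'x::finite mon"
  assumes "n \<noteq> 0"
  shows "Poly_Mapping.single n (c :: 'k::field) \<in> irrelevant_ideal"
proof -
  obtain x where x: "n x \<noteq> 0" using assms by (auto simp: fun_eq_iff)
  let ?e = "\<lambda>y. if y = x then 1 else 0 :: nat"
  have "?e \<le> n" using x by (auto simp: le_fun_def)
  then have "Poly_Mapping.single n c = Poly_Mapping.single (n - ?e) c * monomial ?e" by (rule single_split)
  moreover have "monomial ?e \<in> irrelevant_ideal"
    unfolding irrelevant_ideal_def by (rule subsetD[OF idl_self]) (rule rangeI)
  moreover have "ideal irrelevant_ideal (class_ring :: ('x, 'k) mpoly ring)"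
    unfolding irrelevant_ideal_def by (rule idl_ideal)
  ultimately show ?thesis using ideal_class_ring(3) by metis
qed

context rigid_monomial_ideal
begin

section \<open>The differential in free coordinates\<close>

definition Psi :: "nat \<Rightarrow> ('x mon \<Rightarrow> ('x, 'k) mpoly) \<Rightarrow> 'x mon \<Rightarrow> 'x mon \<Rightarrow> ('x mon set \<Rightarrow> 'k) set" where
  "Psi i = free_presentation.Psi (seq_index B i) (seq_summand B i) (gen i)"

abbreviation "F i \<equiv> homog_module B i :: ('x, 'k, 'x mon \<Rightarrow> 'x mon \<Rightarrow> ('x mon set \<Rightarrow> 'k) set) multigraded"
abbreviation "FM i \<equiv> free_module (S i) :: ('x, 'k, 'x mon \<Rightarrow> ('x, 'k) mpoly) multigraded"

lemma iso: "graded_iso (FM i) (F i) (Psi i)"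
  unfolding Psi_def homog_module_def by (rule free_presentation.Psi_iso[OF presentation])

text \<open>The differential of the resolution as a matrix of terms. The condition
  \<open>p < q\<close> stands in for the cover relation: for consecutive ranks the two agree by
  \<open>cover_rank\<close>.\<close>

definition dd :: "nat \<Rightarrow> ('x mon \<Rightarrow> ('x, 'k) mpoly) \<Rightarrow> 'x mon \<Rightarrow> ('x, 'k) mpoly" where
  "dd i g p = (if p \<in> S i
     then \<Sum>q | q \<in> S (Suc i) \<and> p < q. Poly_Mapping.single (q - p) (incidence q p) * g q else 0)"

text \<open>An element strictly between would have a rank strictly between \<open>i\<close> and
  \<open>Suc i\<close>.\<close>

lemma cover_rank:
  assumes "p \<in> S i" "q \<in> S (Suc i)" "p < q"
  shows "covered_by B p q"
proof -
  have B: "p \<in> B" "q \<in> B" "rank p = i" "rank q = Suc i" using assms by (auto simp: S_def)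
  have False if "y \<in> B" "p < y" "y < q" for y
    using rank_mono'[OF B(1) that(1,2)] rank_mono'[OF that(1) B(2) that(3)] B(3,4) by simp
  then show ?thesis using B assms(3) by (auto simp: covered_by_def)
qed

text \<open>Covers of nonconsecutive ranks carry the entry 0, and all comparable pairs of
  consecutive ranks are covers, so both sums agree. If \<open>p\<close> is not in
  \<open>S i\<close>, its summand is zero and any two coordinates have the same image.\<close>

lemma homog_diff_Psi: "homog_diff B (Suc i) (Psi (Suc i) g) = Psi i (dd i g)"
proof
  fix p
  show "homog_diff B (Suc i) (Psi (Suc i) g) p = Psi i (dd i g) p"
  proof (cases "p \<in> seq_index B i")
    case False
    then show ?thesis
      by (simp add: homog_diff_def Psi_def free_presentation.Psi_def[OF presentation])
  next
    case p: True
    let ?W = "seq_summand B i p"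
    have W: "cyclic_space ?W (gen i p)" using homol_cyclic[OF p] seq_summand_homol[OF p] by simp
    interpret W: cyclic_space ?W "gen i p" by (rule W)
    interpret T: Module.module class_ring "poly_tensor ?W :: ('x, 'k, 'x mon \<Rightarrow> ('x mon set \<Rightarrow> 'k) set) multigraded"
      by (rule W.poly_tensor_module)
    let ?C = "{q \<in> seq_index B (Suc i). covered_by B p q}"
    let ?r = "\<lambda>q. Poly_Mapping.single (q - p) (coeff i q p) * g q"
    have tm: "tensor_map (q - p) (seq_map B (Suc i) q p) ?W (Psi (Suc i) g q) = coeff_tensor ?W (gen i p) (?r q)"
      if q: "q \<in> ?C" for q
    proof -
      have "Psi (Suc i) g q = coeff_tensor (seq_summand B (Suc i) q) (gen (Suc i) q) (g q)"
        using q by (simp add: Psi_def free_presentation.Psi_def[OF presentation])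
      moreover have "seq_map B (Suc i) q p (a \<odot>\<^bsub>seq_summand B (Suc i) q\<^esub> gen (Suc i) q) =
          (a * coeff i q p) \<odot>\<^bsub>?W\<^esub> gen i p" for a
        using seq_map_gen[of q i p a] q p seq_summand_homol[of q "Suc i"] seq_summand_homol[OF p] by simp
      ultimately show ?thesis using tensor_map_coeff_tensor[OF W] by metis
    qed
    have "homog_diff B (Suc i) (Psi (Suc i) g) p =
      finsum (poly_tensor ?W) (\<lambda>q. tensor_map (q - p) (seq_map B (Suc i) q p) ?W (Psi (Suc i) g q)) ?C"
      using p by (simp add: homog_diff_def)
    also have "\<dots> = finsum (poly_tensor ?W) (\<lambda>q. coeff_tensor ?W (gen i p) (?r q)) ?C"
      by (rule T.M.finsum_cong') (auto simp: tm W.coeff_tensor_closed)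
    also have "\<dots> = coeff_tensor ?W (gen i p) (\<Sum>q\<in>?C. ?r q)"
      by (rule W.finsum_coeff_tensor)
    also have "\<dots> = coeff_tensor ?W (gen i p) (dd i g p)"
    proof (cases "p \<in> S i")
      case False
      then show ?thesis
        using free_presentation.coeff_tensor_trivial[OF presentation, of p i "\<Sum>q\<in>?C. ?r q"] p
        by (simp add: dd_def)
    next
      case True
      have "(\<Sum>q\<in>?C. ?r q) = (\<Sum>q | q \<in> S (Suc i) \<and> p < q. Poly_Mapping.single (q - p) (incidence q p) * g q)"
      proof (rule sum.mono_neutral_cong_right)
        show "finite ?C" using finite_index by simp
        show "{q. q \<in> S (Suc i) \<and> p < q} \<subseteq> ?C" using cover_rank[OF True] S_subset by blast
        show "\<forall>q\<in>?C - {q. q \<in> S (Suc i) \<and> p < q}. ?r q = 0" by (auto simp: coeff_def covered_by_def)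
      qed (use True in \<open>auto simp: coeff_def\<close>)
      then show ?thesis using True by (simp add: dd_def)
    qed
    also have "\<dots> = Psi i (dd i g) p"
      using p by (simp add: Psi_def free_presentation.Psi_def[OF presentation])
    finally show ?thesis .
  qed
qed

lemma dd_closed: "dd i g \<in> carrier (FM i)"
  by (simp add: free_module_def dd_def)

lemma dd_add: "dd i (g + g') = dd i g + dd i g'"
  by (auto simp: dd_def algebra_simps sum.distrib)

lemma dd_smult: "dd i (\<lambda>q. r * g q) = (\<lambda>p. r * dd i g p)"
  by (auto simp: dd_def sum_distrib_left mult.left_commute intro!: sum.cong)

abbreviation "below u \<equiv> {x \<in> B0. x \<le> u}"

text \<open>The coefficient of \<open>m\<close> in coordinate \<open>p\<close> has multidegree
  \<open>m + p\<close>. An element \<open>q\<close> can contribute to it only when \<open>q\<close>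
  divides \<open>m + p\<close>, so in this multidegree the homogenized differential is the incidence
  map of the elements below it.\<close>

lemma lookup_dd:
  assumes p: "p \<in> S i"
  shows "Poly_Mapping.lookup (dd i g p) m =
    incidence_map (below (m + p)) (Suc i) (\<lambda>q. Poly_Mapping.lookup (g q) (m + p - q)) p"
proof -
  have "Poly_Mapping.lookup (dd i g p) m =
    (\<Sum>q | q \<in> S (Suc i) \<and> p < q. if q - p \<le> m then incidence q p * Poly_Mapping.lookup (g q) (m - (q - p)) else 0)"
    using p by (simp add: dd_def lookup_sum lookup_single_mult)
  also have "\<dots> = (\<Sum>q | q \<in> below (m + p) \<and> rank q = Suc i \<and> p < q. Poly_Mapping.lookup (g q) (m + p - q) * incidence q p)"
  proof (rule sum.mono_neutral_cong_right)
    show "finite {q. q \<in> S (Suc i) \<and> p < q}" using finite_S by simp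
    show "{q. q \<in> below (m + p) \<and> rank q = Suc i \<and> p < q} \<subseteq> {q. q \<in> S (Suc i) \<and> p < q}" by (auto simp: S_Suc)
    have le: "q - p \<le> m \<longleftrightarrow> q \<le> m + p" for q :: "'x mon"
      by (simp add: le_fun_def le_diff_conv)
    show "\<forall>q\<in>{q. q \<in> S (Suc i) \<and> p < q} - {q. q \<in> below (m + p) \<and> rank q = Suc i \<and> p < q}.
        (if q - p \<le> m then incidence q p * Poly_Mapping.lookup (g q) (m - (q - p)) else 0) = 0"
      by (auto simp: le S_Suc)
    fix q assume q: "q \<in> {q. q \<in> below (m + p) \<and> rank q = Suc i \<and> p < q}"
    then have "p \<le> q" by auto
    then have "m - (q - p) = m + p - q" by (auto simp: le_fun_def)
    then show "(if q - p \<le> m then incidence q p * Poly_Mapping.lookup (g q) (m - (q - p)) else 0) =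
        Poly_Mapping.lookup (g q) (m + p - q) * incidence q p"
      using q by (simp add: le mult.commute)
  qed
  finally show ?thesis by (simp add: incidence_map_def)
qed

lemma dd_dd: "dd i (dd (Suc i) g) = 0"
proof (intro ext poly_mapping_eqI)
  fix p m
  show "Poly_Mapping.lookup (dd i (dd (Suc i) g) p) m = Poly_Mapping.lookup (0 p) m"
  proof (cases "p \<in> S i")
    case False
    then show ?thesis by (simp add: dd_def)
  next
    case True
    let ?u = "m + p"
    interpret lower_set 0 B0 rank fcycle "below ?u" by (rule lower_set_below)
    let ?x = "\<lambda>q. Poly_Mapping.lookup (g q) (?u - q)"
    have "Poly_Mapping.lookup (dd (Suc i) g q) (?u - q) = incidence_map (below ?u) (Suc (Suc i)) ?x q"
      if "q \<in> below ?u" "rank q = Suc i" for q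
    proof -
      have "?u - q + q = ?u" using that(1) by (auto simp: le_fun_def)
      moreover have "q \<in> S (Suc i)" using that by (simp add: S_Suc)
      ultimately show ?thesis using lookup_dd[of q "Suc i" g "?u - q"] by simp
    qed
    then have "Poly_Mapping.lookup (dd i (dd (Suc i) g) p) m =
        incidence_map (below ?u) (Suc i) (incidence_map (below ?u) (Suc (Suc i)) ?x) p"
      unfolding lookup_dd[OF True] incidence_map_def[of _ "Suc i"] by (intro sum.cong) auto
    also have "\<dots> = 0"
    proof (rule incidence_map_incidence_map)
      show "p \<in> insert 0 (below ?u)" using True by (auto simp: S_def le_fun_def)
      show "rank p = i" using True by (simp add: S_def)
    qed
    finally show ?thesis by simp
  qed
qed

text \<open>The equation is solved separately in each multidegree \<open>u\<close>. A nonzero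
  coefficient of \<open>g\<close> there comes from some \<open>q\<close> dividing \<open>u\<close>,
  so a generator divides \<open>u\<close> and the elements below \<open>u\<close> form an acyclic
  poset.\<close>

lemma dd_exact:
  assumes g: "g \<in> carrier (FM (Suc i))" and ker: "dd i g = 0"
  shows "\<exists>f\<in>carrier (FM (Suc (Suc i))). dd (Suc i) f = g"
proof -
  let ?x = "\<lambda>u q. Poly_Mapping.lookup (g q) (u - q)"
  \<comment> \<open>\<open>P u\<close> says that \<open>g\<close> has a nonzero component in
    multidegree \<open>u\<close>. Elsewhere the solution is forced to be 0, since arbitrary choices
    could have infinite support and not define polynomials.\<close>
  define P where "P = (\<lambda>u. \<exists>q\<in>below u. rank q = Suc i \<and> ?x u q \<noteq> 0)"
  have "\<exists>y. (\<forall>p\<in>below u. rank p = Suc i \<longrightarrow> incidence_map (below u) (Suc (Suc i)) y p = ?x u p) \<and> (\<not> P u \<longrightarrow> y = (\<lambda>_. 0))" for u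
  proof (cases "P u")
    case False
    then show ?thesis by (auto simp: P_def incidence_map_def)
  next
    case True
    then obtain q where q: "q \<in> below u" by (auto simp: P_def)
    then obtain g0 where "g0 \<in> G" "g0 \<le> q" using gen_below_lattice[of q] betti_subset by auto
    then have "\<exists>g\<in>G. g \<le> u" using q by (auto intro: order_trans)
    then have acyc: "acyclic_poset TYPE('k) (below u)" by (rule acyclic_below)
    interpret lower_set 0 B0 rank fcycle "below u" by (rule lower_set_below)
    have "\<exists>y. \<forall>p\<in>{q \<in> below u. rank q = Suc i}. incidence_map (below u) (Suc (Suc i)) y p = ?x u p"
    proof (rule incidence_map_exact[OF acyc])
      fix p assume p: "p \<in> insert 0 (below u)" "rank p = i"
      then have pu: "u - p + p = u" using zero_le_fun by (auto simp: le_fun_def)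
      have "p \<in> S i" using p zero_in_betti by (auto simp: S_def)
      from lookup_dd[OF this, of g "u - p"] show "incidence_map (below u) (Suc i) (?x u) p = 0"
        using ker pu by simp
    qed
    then obtain y where "\<forall>p\<in>{q \<in> below u. rank q = Suc i}. incidence_map (below u) (Suc (Suc i)) y p = ?x u p" ..
    then show ?thesis using True by (intro exI[of _ y]) simp
  qed
  then have "\<exists>y. \<forall>u. (\<forall>p\<in>below u. rank p = Suc i \<longrightarrow> incidence_map (below u) (Suc (Suc i)) (y u) p = ?x u p) \<and>
      (\<not> P u \<longrightarrow> y u = (\<lambda>_. 0))" by (intro choice allI)
  then obtain y where y: "\<And>u p. p \<in> below u \<Longrightarrow> rank p = Suc i \<Longrightarrow> incidence_map (below u) (Suc (Suc i)) (y u) p = ?x u p"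
    and y0: "\<And>u. \<not> P u \<Longrightarrow> y u = (\<lambda>_. 0)" by blast
  have finP: "finite {u. P u}"
  proof (rule finite_subset)
    show "{u. P u} \<subseteq> (\<Union>q\<in>S (Suc i). (\<lambda>m. m + q) ` Poly_Mapping.keys (g q))"
    proof
      fix u assume "u \<in> {u. P u}"
      then obtain q where q: "q \<in> below u" "rank q = Suc i" "?x u q \<noteq> 0" by (auto simp: P_def)
      then have "u = (u - q) + q" by (auto simp: le_fun_def)
      then have "u \<in> (\<lambda>m. m + q) ` Poly_Mapping.keys (g q)" using q(3) by (intro image_eqI[of _ _ "u - q"]) (auto simp: in_keys_iff)
      moreover have "q \<in> S (Suc i)" using q by (simp add: S_Suc)
      ultimately show "u \<in> (\<Union>q\<in>S (Suc i). (\<lambda>m. m + q) ` Poly_Mapping.keys (g q))" by blast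
    qed
    show "finite (\<Union>q\<in>S (Suc i). (\<lambda>m. m + q) ` Poly_Mapping.keys (g q))" using finite_S by auto
  qed
  \<comment> \<open>The coefficient of \<open>m\<close> in coordinate \<open>q\<close> is taken from
    the solution in multidegree \<open>m + q\<close>.\<close>
  define f where "f = (\<lambda>q. if q \<in> S (Suc (Suc i)) then Abs_poly_mapping (\<lambda>m. y (m + q) q) else 0)"
  have lf: "Poly_Mapping.lookup (f q) m = y (m + q) q" if "q \<in> S (Suc (Suc i))" for q m
  proof -
    have "finite {m. y (m + q) q \<noteq> 0}"
    proof (rule finite_subset)
      show "{m. y (m + q) q \<noteq> 0} \<subseteq> (\<lambda>u. u - q) ` {u. P u}"
      proof
        fix m assume "m \<in> {m. y (m + q) q \<noteq> 0}"
        then have "P (m + q)" using y0[of "m + q"] by (cases "P (m + q)") auto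
        moreover have "m = m + q - q" by auto
        ultimately show "m \<in> (\<lambda>u. u - q) ` {u. P u}" by blast
      qed
    qed (use finP in simp)
    then show ?thesis using that by (simp add: f_def)
  qed
  have "dd (Suc i) f = g"
  proof (intro ext poly_mapping_eqI)
    fix p m
    show "Poly_Mapping.lookup (dd (Suc i) f p) m = Poly_Mapping.lookup (g p) m"
    proof (cases "p \<in> S (Suc i)")
      case False
      then show ?thesis using g by (simp add: dd_def free_module_def)
    next
      case True
      let ?u = "m + p"
      have "Poly_Mapping.lookup (f q) (?u - q) = y ?u q" if "q \<in> below ?u" "rank q = Suc (Suc i)" for q
      proof -
        have "?u - q + q = ?u" using that(1) by (auto simp: le_fun_def)
        then show ?thesis using lf[of q "?u - q"] that by (simp add: S_Suc)
      qed
      then have "Poly_Mapping.lookup (dd (Suc i) f p) m = incidence_map (below ?u) (Suc (Suc i)) (y ?u) p"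
        unfolding lookup_dd[OF True] incidence_map_def by (intro sum.cong) auto
      also have "\<dots> = ?x ?u p" by (rule y) (use True in \<open>auto simp: S_Suc le_fun_def\<close>)
      also have "?u - p = m" by auto
      finally show ?thesis .
    qed
  qed
  moreover have "f \<in> carrier (FM (Suc (Suc i)))" by (simp add: f_def free_module_def)
  ultimately show ?thesis by blast
qed

text \<open>The factor of exponent \<open>q - p\<close> makes up for the difference between the
  degrees of the two generators.\<close>

lemma dd_hcomp:
  assumes g: "g \<in> hcomp (FM (Suc i)) u"
  shows "dd i g \<in> hcomp (FM i) u"
proof -
  have "mdeg m + mdeg p = u" if m: "m \<in> Poly_Mapping.keys (dd i g p)" for p m
  proof -
    have p: "p \<in> S i" using m by (auto simp: dd_def split: if_splits)
    have "(\<Sum>q | q \<in> S (Suc i) \<and> p < q. Poly_Mapping.lookup (Poly_Mapping.single (q - p) (incidence q p) * g q) m) \<noteq> 0"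
      using m p by (simp add: in_keys_iff dd_def lookup_sum)
    then obtain q where q: "q \<in> S (Suc i)" "p < q" "Poly_Mapping.lookup (Poly_Mapping.single (q - p) (incidence q p) * g q) m \<noteq> 0"
      by (blast dest: sum.not_neutral_contains_not_neutral)
    then have le: "q - p \<le> m" and k: "m - (q - p) \<in> Poly_Mapping.keys (g q)"
      by (auto simp: lookup_single_mult in_keys_iff split: if_splits)
    have "mdeg (m - (q - p)) + mdeg q = u" using g k by (auto simp: free_module_def)
    moreover have "m - (q - p) + q = m + p"
    proof
      fix x
      have "q x - p x \<le> m x" "p x \<le> q x" using le_funD[OF le, of x] le_funD[OF less_imp_le[OF q(2)], of x] by auto
      then show "(m - (q - p) + q) x = (m + p) x" by simp
    qed
    ultimately show ?thesis by (simp add: mdeg_add[symmetric])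
  qed
  then show ?thesis by (auto simp: free_module_def dd_def)
qed

text \<open>Nonzero elements of the Betti poset are monomials in \<open>M\<close>. Conversely a
  minimal generator has an empty open interval below it, hence rank 1 and a nonzero incidence with
  the minimum, and every monomial of \<open>M\<close> is a multiple of one.\<close>

lemma dd_image_ideal: "{dd 0 g 0 | g. g \<in> carrier (FM 1)} = M"
proof (intro equalityI subsetI)
  fix r assume "r \<in> {dd 0 g 0 | g. g \<in> carrier (FM 1)}"
  then obtain g where r: "r = dd 0 g 0" by blast
  have "Poly_Mapping.single (q - 0) (incidence q 0) * g q \<in> M" if "q \<in> S (Suc 0)" for q
  proof -
    have "q \<in> L" "q \<noteq> 0" using that betti_subset by (auto simp: S_Suc)
    then have "monomial q \<in> M" using gen_below_lattice gen_below by blast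
    then have "Poly_Mapping.single (q - 0) (incidence q 0) \<in> M" by (rule monomial_up) (auto simp: le_fun_def)
    then have "g q * Poly_Mapping.single (q - 0) (incidence q 0) \<in> M" by (rule ideal_closed(3))
    then show ?thesis by (simp only: mult.commute)
  qed
  then show "r \<in> M" unfolding r dd_def using ideal_closed(1) by (auto intro!: sum_closed)
next
  fix r assume r: "r \<in> M"
  let ?T = "{dd 0 g 0 | g. g \<in> carrier (FM 1)}"
  have add: "a + b \<in> ?T" if "a \<in> ?T" "b \<in> ?T" for a b
  proof -
    obtain g g' where "g \<in> carrier (FM 1)" "g' \<in> carrier (FM 1)" "a = dd 0 g 0" "b = dd 0 g' 0"
      using \<open>a \<in> ?T\<close> \<open>b \<in> ?T\<close> by blast
    then have "a + b = dd 0 (g + g') 0" "g + g' \<in> carrier (FM 1)" by (simp_all add: dd_add free_module_def)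
    then show ?thesis by blast
  qed
  have zero: "0 \<in> ?T"
    by (intro CollectI exI[of _ 0] conjI) (auto simp: dd_def free_module_def)
  have single: "Poly_Mapping.single m c \<in> ?T" if m: "monomial m \<in> M" for m c
  proof -
    obtain q where q: "q \<in> G" "q \<le> m" using m gen_below by blast
    have qB: "q \<in> B0" using q(1) gens_in_betti by blast
    have below: "{x \<in> B0. x < q} = {}" using below_gen[OF q(1)] betti_subset by blast
    have f: "fcycle q \<in> chains_of {} (rank q - 1)" using fcycle(1)[OF qB] unfolding below .
    then have "rank q - 1 = 0" using chains_of_empty(2) fcycle(3)[OF qB] by blast
    then have qS: "q \<in> S (Suc 0)" using rank_pos[OF qB] qB by (simp add: S_Suc)
    have "fcycle q {} \<noteq> 0"
    proof
      assume "fcycle q {} = 0"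
      then have "fcycle q = 0" using chains_of_empty(1)[OF f] by auto
      then show False using fcycle(3)[OF qB] by blast
    qed
    then have inc: "incidence q 0 \<noteq> 0" by (simp add: incidence_def)
    \<comment> \<open>The scalar compensates the normalisation of \<open>fcycle q\<close>, a nonzero
      but otherwise arbitrary multiple of the empty face.\<close>
    define g where "g = (\<lambda>p. if p = q then Poly_Mapping.single (m - q) (c / incidence q 0) else 0)"
    have "dd 0 g 0 = (\<Sum>p | p \<in> S (Suc 0) \<and> 0 < p. Poly_Mapping.single (p - 0) (incidence p 0) * g p)"
      by (simp add: dd_def S_0)
    also have "\<dots> = (\<Sum>p\<in>{q}. Poly_Mapping.single (p - 0) (incidence p 0) * g p)"
      by (rule sum.mono_neutral_right) (use finite_S qS qB pos_iff in \<open>auto simp: g_def\<close>)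
    also have "\<dots> = Poly_Mapping.single (q + (m - q)) c" using inc by (simp add: g_def mult_single)
    also have "q + (m - q) = m" using q(2) by (auto simp: le_fun_def)
    finally have "dd 0 g 0 = Poly_Mapping.single m c" .
    moreover have "g \<in> carrier (FM 1)" using qS by (auto simp: g_def free_module_def)
    ultimately show ?thesis by (metis (mono_tags, lifting) mem_Collect_eq)
  qed
  have "(\<Sum>m\<in>A. Poly_Mapping.single m (Poly_Mapping.lookup r m)) \<in> ?T" if "A \<subseteq> Poly_Mapping.keys r" for A
    using finite_subset[OF that finite_keys] that
  proof (induction A rule: finite_induct)
    case (insert m A)
    have "monomial m \<in> M" using insert.prems r mem_iff by blast
    then have "Poly_Mapping.single m (Poly_Mapping.lookup r m) \<in> ?T" by (rule single)
    moreover have "(\<Sum>m\<in>A. Poly_Mapping.single m (Poly_Mapping.lookup r m)) \<in> ?T" using insert by blast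
    ultimately show ?case unfolding sum.insert[OF insert.hyps] by (rule add)
  qed (use zero in simp)
  from this[OF subset_refl] show "r \<in> ?T" by (simp add: sum_single_keys)
qed

section \<open>Exactness, augmentation and minimality\<close>

lemma supports: "supports_resolution B M"
proof -
  let ?N = "graded_quot ring_module M :: ('x, 'k, ('x, 'k) mpoly set) multigraded"
  let ?R = "ring_module :: ('x, 'k, ('x, 'k) mpoly) multigraded"
  note pre = graded_iso.h_surj[OF iso] and closed = graded_iso.h_closed[OF iso]
  have d_closed: "homog_diff B (Suc i) x \<in> carrier (F i)" if "x \<in> carrier (F (Suc i))" for i x
    using pre[OF that] by (auto simp: homog_diff_Psi intro!: closed dd_closed)
  have free: "is_graded_free (F i)" for i
    by (rule graded_iso.is_graded_free_iso[OF iso free_module_graded_free[OF finite_S]])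
  have hom: "graded_hom (F (Suc i)) (F i) (homog_diff B (Suc i))" for i
    unfolding graded_hom_def LinearCombinations.module_hom_def
  proof (intro conjI CollectI allI impI)
    show "homog_diff B (Suc i) \<in> carrier (F (Suc i)) \<rightarrow> carrier (F i)" using d_closed by blast
  next
    fix x y assume "x \<in> carrier (F (Suc i)) \<and> y \<in> carrier (F (Suc i))"
    then obtain g g' where g: "g \<in> carrier (FM (Suc i))" "g' \<in> carrier (FM (Suc i))"
      and xy: "x = Psi (Suc i) g" "y = Psi (Suc i) g'" using pre by blast
    have "x \<oplus>\<^bsub>F (Suc i)\<^esub> y = Psi (Suc i) (g + g')"
      unfolding xy graded_iso.h_add[OF iso g, symmetric] by (simp add: free_module_def)
    then have "homog_diff B (Suc i) (x \<oplus>\<^bsub>F (Suc i)\<^esub> y) = Psi i (dd i g \<oplus>\<^bsub>FM i\<^esub> dd i g')"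
      by (simp add: homog_diff_Psi dd_add free_module_def)
    also have "\<dots> = Psi i (dd i g) \<oplus>\<^bsub>F i\<^esub> Psi i (dd i g')"
      by (rule graded_iso.h_add[OF iso dd_closed dd_closed])
    finally show "homog_diff B (Suc i) (x \<oplus>\<^bsub>F (Suc i)\<^esub> y) = homog_diff B (Suc i) x \<oplus>\<^bsub>F i\<^esub> homog_diff B (Suc i) y"
      unfolding xy homog_diff_Psi .
  next
    fix r :: "('x, 'k) mpoly" and x assume "r \<in> carrier class_ring \<and> x \<in> carrier (F (Suc i))"
    then obtain g where g: "g \<in> carrier (FM (Suc i))" and x: "x = Psi (Suc i) g" using pre by blast
    have "r \<odot>\<^bsub>F (Suc i)\<^esub> x = Psi (Suc i) (\<lambda>q. r * g q)"
      unfolding x graded_iso.h_smult[OF iso g, symmetric] by (simp add: free_module_def)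
    then have "homog_diff B (Suc i) (r \<odot>\<^bsub>F (Suc i)\<^esub> x) = Psi i (r \<odot>\<^bsub>FM i\<^esub> dd i g)"
      by (simp add: homog_diff_Psi dd_smult free_module_def)
    also have "\<dots> = r \<odot>\<^bsub>F i\<^esub> Psi i (dd i g)" by (rule graded_iso.h_smult[OF iso dd_closed])
    finally show "homog_diff B (Suc i) (r \<odot>\<^bsub>F (Suc i)\<^esub> x) = r \<odot>\<^bsub>F i\<^esub> homog_diff B (Suc i) x"
      unfolding x homog_diff_Psi .
  next
    fix u
    show "homog_diff B (Suc i) ` hcomp (F (Suc i)) u \<subseteq> hcomp (F i) u"
      unfolding graded_iso.h_hcomp[OF iso, symmetric] using dd_hcomp homog_diff_Psi by blast
  qed
  have exact: "homog_diff B (Suc (Suc i)) ` carrier (F (Suc (Suc i))) = a_kernel (F (Suc i)) (F i) (homog_diff B (Suc i))" for i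
    unfolding a_kernel_def'
  proof (intro equalityI subsetI)
    fix x assume "x \<in> homog_diff B (Suc (Suc i)) ` carrier (F (Suc (Suc i)))"
    then obtain g where x: "x = Psi (Suc i) (dd (Suc i) g)" using pre homog_diff_Psi by blast
    then have "homog_diff B (Suc i) x = Psi i 0" by (simp add: homog_diff_Psi dd_dd)
    also have "\<dots> = \<zero>\<^bsub>F i\<^esub>" using graded_iso.h_zero[OF iso, of i] by (simp add: free_module_def)
    finally show "x \<in> {x \<in> carrier (F (Suc i)). homog_diff B (Suc i) x = \<zero>\<^bsub>F i\<^esub>}"
      using x closed[OF dd_closed] by simp
  next
    fix x assume "x \<in> {x \<in> carrier (F (Suc i)). homog_diff B (Suc i) x = \<zero>\<^bsub>F i\<^esub>}"
    then have x: "x \<in> carrier (F (Suc i))" "homog_diff B (Suc i) x = \<zero>\<^bsub>F i\<^esub>" by auto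
    obtain g where g: "g \<in> carrier (FM (Suc i))" "x = Psi (Suc i) g" using pre[OF x(1)] by blast
    have z: "Psi i (dd i g) = \<zero>\<^bsub>F i\<^esub>" using x(2) unfolding g(2) homog_diff_Psi .
    have "dd i g = 0"
      using z graded_iso.h_eq_zero[OF iso dd_closed] by (simp add: free_module_def)
    then obtain f where f: "f \<in> carrier (FM (Suc (Suc i)))" "dd (Suc i) f = g" using dd_exact[OF g(1)] by blast
    then have "x = homog_diff B (Suc (Suc i)) (Psi (Suc (Suc i)) f)" using g(2) homog_diff_Psi by simp
    then show "x \<in> homog_diff B (Suc (Suc i)) ` carrier (F (Suc (Suc i)))" using closed[OF f(1)] by blast
  qed
  have aug: "\<exists>\<epsilon>. graded_hom (F 0) ?N \<epsilon> \<and> \<epsilon> ` carrier (F 0) = carrier ?N \<and>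
      homog_diff B 1 ` carrier (F 1) = a_kernel (F 0) ?N \<epsilon>"
  proof -
    \<comment> \<open>The single coordinate of position 0, taken modulo \<open>M\<close>;
      \<open>inv_into\<close> recovers it from the tensor module.\<close>
    define \<epsilon> where "\<epsilon> = (\<lambda>x. M +>\<^bsub>?R\<^esub> inv_into (carrier (FM 0)) (Psi 0) x 0)"
    have eps: "\<epsilon> (Psi 0 g) = M +>\<^bsub>?R\<^esub> g 0" if "g \<in> carrier (FM 0)" for g
      using graded_iso.bij[OF iso, of 0] that by (simp add: \<epsilon>_def bij_betw_def)
    have R: "add ?R = (+)" by (simp add: ring_module_def)
    have carN: "carrier ?N = (\<lambda>r. M +>\<^bsub>?R\<^esub> r) ` UNIV"
      using carrier_quot_module[of ?R M] by (simp add: graded_quot_def ring_module_def)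
    have addN: "(M +>\<^bsub>?R\<^esub> r) \<oplus>\<^bsub>?N\<^esub> (M +>\<^bsub>?R\<^esub> s) = M +>\<^bsub>?R\<^esub> (r + s)" for r s
      using quot_module_add[OF R ideal_closed(1,2)] by (simp add: graded_quot_def)
    have smultN: "a \<odot>\<^bsub>?N\<^esub> (M +>\<^bsub>?R\<^esub> r) = M +>\<^bsub>?R\<^esub> (a * r)" for a r
      using quot_module_smult[OF R ideal_closed(1,2), of a r] ideal_closed(3)
      by (simp add: graded_quot_def ring_module_def algebra_simps)
    have zeroN: "\<zero>\<^bsub>?N\<^esub> = M +>\<^bsub>?R\<^esub> 0"
      unfolding a_r_coset_plus[OF R] by (simp add: graded_quot_def quot_module_def)
    have ker: "M +>\<^bsub>?R\<^esub> r = \<zero>\<^bsub>?N\<^esub> \<longleftrightarrow> r \<in> M" for r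
      unfolding zeroN using a_r_coset_eq_iff[OF R ideal_closed(1), of r 0] ideal_closed(4) by simp
    have delta: "(\<lambda>q. if q = 0 then r else 0) \<in> carrier (FM 0)" for r :: "('x, 'k) mpoly"
      by (simp add: free_module_def S_0)
    have "graded_hom (F 0) ?N \<epsilon>"
      unfolding graded_hom_def LinearCombinations.module_hom_def
    proof (intro conjI CollectI allI impI)
      show "\<epsilon> \<in> carrier (F 0) \<rightarrow> carrier ?N" unfolding carN \<epsilon>_def by blast
    next
      fix x y assume "x \<in> carrier (F 0) \<and> y \<in> carrier (F 0)"
      then obtain g g' where g: "g \<in> carrier (FM 0)" "g' \<in> carrier (FM 0)"
        and xy: "x = Psi 0 g" "y = Psi 0 g'" using pre by blast
      have gg: "g + g' \<in> carrier (FM 0)" using g by (simp add: free_module_def)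
      have "x \<oplus>\<^bsub>F 0\<^esub> y = Psi 0 (g + g')"
        unfolding xy graded_iso.h_add[OF iso g, symmetric] by (simp add: free_module_def)
      then show "\<epsilon> (x \<oplus>\<^bsub>F 0\<^esub> y) = \<epsilon> x \<oplus>\<^bsub>?N\<^esub> \<epsilon> y"
        using eps[OF gg] eps[OF g(1)] eps[OF g(2)] addN xy by simp
    next
      fix r :: "('x, 'k) mpoly" and x assume "r \<in> carrier class_ring \<and> x \<in> carrier (F 0)"
      then obtain g where g: "g \<in> carrier (FM 0)" and x: "x = Psi 0 g" using pre by blast
      have rg: "(\<lambda>q. r * g q) \<in> carrier (FM 0)" using g by (simp add: free_module_def)
      have "r \<odot>\<^bsub>F 0\<^esub> x = Psi 0 (\<lambda>q. r * g q)"
        unfolding x graded_iso.h_smult[OF iso g, symmetric] by (simp add: free_module_def)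
      then show "\<epsilon> (r \<odot>\<^bsub>F 0\<^esub> x) = r \<odot>\<^bsub>?N\<^esub> \<epsilon> x" using eps[OF rg] eps[OF g] smultN x by simp
    next
      fix u
      show "\<epsilon> ` hcomp (F 0) u \<subseteq> hcomp ?N u"
      proof
        fix y assume "y \<in> \<epsilon> ` hcomp (F 0) u"
        then obtain g where g: "g \<in> hcomp (FM 0) u" "y = \<epsilon> (Psi 0 g)"
          unfolding graded_iso.h_hcomp[OF iso, symmetric] by blast
        have gc: "g \<in> carrier (FM 0)" using g(1) by (simp add: free_module_def)
        have "\<forall>q. \<forall>m\<in>Poly_Mapping.keys (g q). mdeg m + mdeg q = u" using g(1) by (simp add: free_module_def)
        from spec[OF this, of 0] have "g 0 \<in> hcomp ?R u" by (simp add: ring_module_def)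
        then show "y \<in> hcomp ?N u" unfolding g(2) eps[OF gc] by (simp add: graded_quot_def)
      qed
    qed
    moreover have "\<epsilon> ` carrier (F 0) = carrier ?N"
    proof (intro equalityI subsetI)
      fix y assume "y \<in> carrier ?N"
      then obtain r where r: "y = M +>\<^bsub>?R\<^esub> r" unfolding carN by blast
      have "y = \<epsilon> (Psi 0 (\<lambda>q. if q = 0 then r else 0))" using eps[OF delta] r by simp
      then show "y \<in> \<epsilon> ` carrier (F 0)" using closed[OF delta] by blast
    qed (auto simp: carN \<epsilon>_def)
    moreover have "homog_diff B 1 ` carrier (F 1) = a_kernel (F 0) ?N \<epsilon>"
      unfolding a_kernel_def'
    proof (intro equalityI subsetI)
      fix x assume "x \<in> homog_diff B 1 ` carrier (F 1)"
      then obtain y where y: "y \<in> carrier (F 1)" "x = homog_diff B 1 y" by blast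
      obtain g where g: "g \<in> carrier (FM 1)" "y = Psi 1 g" using pre[OF y(1)] by blast
      have x: "x = Psi 0 (dd 0 g)" using y(2) g(2) homog_diff_Psi[of 0 g] by simp
      have "dd 0 g 0 \<in> M" using dd_image_ideal g(1) by blast
      then show "x \<in> {x \<in> carrier (F 0). \<epsilon> x = \<zero>\<^bsub>?N\<^esub>}"
        using x closed[OF dd_closed] eps[OF dd_closed] ker by simp
    next
      fix x assume "x \<in> {x \<in> carrier (F 0). \<epsilon> x = \<zero>\<^bsub>?N\<^esub>}"
      then obtain g' where g': "g' \<in> carrier (FM 0)" "x = Psi 0 g'" "\<epsilon> x = \<zero>\<^bsub>?N\<^esub>" using pre by blast
      then have "g' 0 \<in> M" using eps ker by simp
      then obtain g where g: "g \<in> carrier (FM 1)" "g' 0 = dd 0 g 0" using dd_image_ideal by blast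
      have "g' = dd 0 g"
      proof
        fix q
        show "g' q = dd 0 g q"
          using g(2) g'(1) by (cases "q = 0") (auto simp: free_module_def dd_def S_0)
      qed
      then have "x = homog_diff B 1 (Psi 1 g)" using g'(2) homog_diff_Psi[of 0 g] by simp
      then show "x \<in> homog_diff B 1 ` carrier (F 1)" using closed[OF g(1)] by blast
    qed
    ultimately show ?thesis by blast
  qed
  have minimal: "homog_diff B (Suc i) ` carrier (F (Suc i)) \<subseteq>
      LinearCombinations.module.span class_ring (F i)
        {r \<odot>\<^bsub>F i\<^esub> x |r x. r \<in> irrelevant_ideal \<and> x \<in> carrier (F i)}" for i
  proof
    let ?X = "{r \<odot>\<^bsub>F i\<^esub> x |r x. r \<in> irrelevant_ideal \<and> x \<in> carrier (F i)}"
    interpret F: Module.module class_ring "F i" by (rule graded_iso.N'[OF iso])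
    have X: "?X \<subseteq> carrier (F i)" by (auto intro!: F.smult_closed)
    interpret Sp: LinearCombinations.submodule class_ring "F.span ?X" "F i" by (rule F.span_is_submodule[OF X])
    \<comment> \<open>Pulling the span back to coordinates makes it a set closed under ordinary
      addition, so the image of the differential can be treated term by term.\<close>
    let ?T = "{g \<in> carrier (FM i). Psi i g \<in> F.span ?X}"
    have T_add: "g + g' \<in> ?T" if "g \<in> ?T" "g' \<in> ?T" for g g'
    proof -
      have "Psi i (g \<oplus>\<^bsub>FM i\<^esub> g') = Psi i g \<oplus>\<^bsub>F i\<^esub> Psi i g'" using that by (intro graded_iso.h_add[OF iso]) auto
      then have "Psi i (g + g') \<in> F.span ?X" using Sp.m_closed that by (simp add: free_module_def)
      then show ?thesis using that by (simp add: free_module_def)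
    qed
    have T_zero: "0 \<in> ?T" using graded_iso.h_zero[OF iso, of i] Sp.zero_closed by (simp add: free_module_def)
    have T_sum: "sum f A \<in> ?T" if "\<And>a. a \<in> A \<Longrightarrow> f a \<in> ?T" for f and A :: "'x mon set"
      using that
    proof (induction A rule: infinite_finite_induct)
      case (insert a A)
      then have "f a + sum f A \<in> ?T" by (intro T_add) auto
      then show ?case using insert.hyps by (simp only: sum.insert simp_thms)
    qed (use T_zero in simp_all)
    fix x assume "x \<in> homog_diff B (Suc i) ` carrier (F (Suc i))"
    then obtain g where x: "x = Psi i (dd i g)" using pre homog_diff_Psi by blast
    \<comment> \<open>The vector with the entry \<open>g q\<close> in coordinate \<open>p\<close>:
      each matrix entry of the differential contributes one term times such a vector.\<close>
    define w where "w = (\<lambda>(p :: 'x mon) q. (\<lambda>p'. if p' = p then g q else 0))"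
    have term_T: "(\<lambda>p'. Poly_Mapping.single (q - p) (incidence q p) * w p q p') \<in> ?T"
      if "p \<in> S i" "p < q" for p q
    proof -
      have wc: "w p q \<in> carrier (FM i)" using that(1) by (auto simp: w_def free_module_def)
      let ?r = "Poly_Mapping.single (q - p) (incidence q p)"
      \<comment> \<open>Minimality comes from here: strict divisibility makes every matrix entry a
        multiple of a monomial other than 1.\<close>
      have "q - p \<noteq> 0"
      proof
        assume "q - p = 0"
        then have "q \<le> p" by (auto simp: le_fun_def fun_eq_iff)
        then show False using that(2) by auto
      qed
      then have "?r \<in> irrelevant_ideal" by (rule irrelevant_single)
      then have "?r \<odot>\<^bsub>F i\<^esub> Psi i (w p q) \<in> ?X" using closed[OF wc] by blast
      then have "Psi i (?r \<odot>\<^bsub>FM i\<^esub> w p q) \<in> F.span ?X"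
        using F.in_own_span[OF X] graded_iso.h_smult[OF iso wc] by auto
      then show ?thesis using wc by (simp add: free_module_def)
    qed
    have "dd i g = (\<Sum>p\<in>S i. \<Sum>q | q \<in> S (Suc i) \<and> p < q. (\<lambda>p'. Poly_Mapping.single (q - p) (incidence q p) * w p q p'))"
    proof
      fix p'
      have "(\<Sum>p\<in>S i. \<Sum>q | q \<in> S (Suc i) \<and> p < q. Poly_Mapping.single (q - p) (incidence q p) * w p q p') =
        (\<Sum>p\<in>S i. if p = p' then dd i g p' else 0)"
        by (intro sum.cong refl) (auto simp: w_def dd_def)
      then show "dd i g p' = (\<Sum>p\<in>S i. \<Sum>q | q \<in> S (Suc i) \<and> p < q. (\<lambda>p'. Poly_Mapping.single (q - p) (incidence q p) * w p q p')) p'"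
        using finite_S by (simp add: sum_fun_apply dd_def)
    qed
    also have "\<dots> \<in> ?T" by (intro T_sum term_T) auto
    finally show "x \<in> F.span ?X" unfolding x by blast
  qed
  show ?thesis
    unfolding supports_resolution_def minimal_free_resolution_def
  proof (intro conjI allI impI)
    fix i :: nat assume "1 \<le> i"
    then obtain j where j: "i = Suc j" by (cases i) auto
    show "graded_hom (F i) (F (i - 1)) (homog_diff B i)" using hom[of j] j by simp
    show "homog_diff B (i + 1) ` carrier (F (i + 1)) = a_kernel (F i) (F (i - 1)) (homog_diff B i)" using exact[of j] j by simp
    show "homog_diff B i ` carrier (F i) \<subseteq> LinearCombinations.module.span class_ring (F (i - 1))
        {r \<odot>\<^bsub>F (i - 1)\<^esub> x |r x. r \<in> irrelevant_ideal \<and> x \<in> carrier (F (i - 1))}" using minimal[of j] j by simp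
  qed (use free aug in auto)
qed

end

theorem theorem2p6:
  fixes M :: "('x::finite, 'k::field) mpoly set"
  assumes "monomial_ideal M"
    and "M \<noteq> UNIV"
    and "rigid M"
  shows "supports_resolution (betti_poset M) M"
proof -
  interpret rigid_monomial_ideal M by unfold_locales (use assms in auto)
  show ?thesis by (rule supports)
qed

end
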